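(* Let $u>0$ and let $n$ be a positive integer. Then $$U\left(\tfrac12u,\sqrt{2u}\,z\right)=\left(\frac{2e}{u}\right)^{u/4}\frac{1}{\{2u(1+z^2)\}^{1/4}}\exp\left\{-u\bar\xi+\sum_{s=1}^{n-1}(-1)^s\frac{\bar{\mathrm E}_s(\bar\beta)-\bar{\mathrm E}_s(1)}{u^s}\right\}\{1+\bar\eta_{n,2}(u,\bar\beta)\},$$ $$U\left(\tfrac12u,-\sqrt{2u}\,z\right)=\left(\frac{2e}{u}\right)^{u/4}\frac{1}{\{2u(1+z^2)\}^{1/4}}\exp\left\{u\bar\xi+\sum_{s=1}^{n-1}\frac{\bar{\mathrm E}_s(\bar\beta)-\bar{\mathrm E}_s(-1)}{u^s}\right\}\{1+\bar\eta_{n,1}(u,\bar\beta)\},$$ where for $j=1,2$ $$|\bar\eta_{n,j}(u,\bar\beta)|\le u^{-n}\omega_{n,j}(u,\bar\beta)\exp\left\{u^{-1}\varpi_{n,j}(u,\bar\beta)+u^{-n}\omega_{n,j}(u,\bar\beta)\right\},$$ $$\omega_{n,j}(u,\bar\beta)=2\int_{(-1)^j}^{\bar\beta}\left|\bar{\mathrm E}_n'(p)\,dp\right|+\sum_{s=1}^{n-1}\frac1{u^s}\int_{(-1)^j}^{\bar\beta}\left|\sum_{k=s}^{n-1}(1-p^2)^2\bar{\mathrm E}_k'(p)\bar{\mathrm E}_{s+n-k-1}'(p)\,dp\right|,$$ $$\varpi_{n,j}(u,\bar\beta)=4\sum_{s=0}^{n-2}\frac1{u^s}\int_{(-1)^j}^{\bar\beta}\left|\bar{\mathrm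 E}_{s+1}'(p)\,dp\right|.$$ For $j=2$ (respectively $j=1$) the integrals are along the image in the $\bar\beta$ plane of any admissible path (see context) joining $z$ to $\Re(z)=+\infty$ (respectively $\Re(z)=-\infty$), and the result holds for every $z$ for which such a path exists. For $j=2$ every $z\in\mathbb C$ is of this type except those on the two level curves $\Re(\bar\xi)=\text{const}$ emanating from $z=\pm i$ in the left half plane (including $z=\pm i$); for $j=1$ the exceptional set is the reflection of this in the imaginary axis.
   Context: $U(a,z)$ is the parabolic cylinder function: the solution of $y''-(\tfrac14z^2+a)y=0$ with $U(a,z)\sim z^{-a-1/2}e^{-z^2/4}$ as $z\to\infty$, $|\arg z|\le\frac34\pi-\delta$. $\bar\xi=\int_0^z(t^2+1)^{1/2}dt=\tfrac12z\sqrt{z^2+1}+\tfrac12\ln(z+\sqrt{z^2+1})$, real with the sign of $z$ for real $z$, and continuous in the plane cut along $z=\pm iy$, $1\le y<\infty$. $\bar\beta=z/\sqrt{z^2+1}$, positive for $z>0$, with the same cuts. (Bars are not complex conjugates.) If a path crosses a cut, $\bar\xi$, $\bar\beta$ and the fractional power of $1+z^2$ are continued continuously along it. $\bar{\mathrm E}_1(\bar\beta)=\frac1{24}\bar\beta(6-5\bar\beta^2)$, $\bar{\mathrm E}_2(\bar\beta)=\frac1{16}(1-\bar\beta^2)^2(5\bar\beta^2-2)$, and for $s\ge2$ $$\bar{\mathrm E}_{s+1}(\bar\beta)=-\tfrac12(1-\bar\beta^2)^2\bar{\mathrm E}_s'(\bar\beta)-\tfrac12\int_{\sigma(s)}^{\bar\beta}(1-p^2)^2\sum_{j=1}^{s-1}\bar{\mathrm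 E}_j'(p)\bar{\mathrm E}_{s-j}'(p)\,dp,$$ with $\sigma(s)=1$ for $s$ odd and $\sigma(s)=0$ for $s$ even. An admissible path is a path in the $z$ plane that avoids $z=\pm i$, consists of a finite chain of $R_2$ arcs (arcs with a parametrization whose second derivative is continuous and whose first derivative does not vanish), and along which $\Re(\bar\xi)$, varying continuously, is monotonic.
   Formalization: Along the path from z, Re(ξ̄) must be nondecreasing towards Re z=+∞ (nonincreasing towards −∞), not merely monotonic, as otherwise exceptional points are reached and the bound fails; paths whose β̄-image has infinite length, where the bound is infinite, are excluded. *)

theory Defs
  imports "HOL-Complex_Analysis.Complex_Analysis" "HOL-Library.Landau_Symbols"
begin

section \<open>The parabolic cylinder function\<close>

text \<open>All powers are principal; this is the intended branch because the sectors do not meet the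
  negative real axis. The sectors are nonempty only for small \<open>\<delta>\<close>; for the others the asymptotic
  condition is vacuous. The asymptotic condition makes the solution unique since it is recessive
  at \<open>+\<infinity>\<close>.\<close>

definition pcfU :: "complex \<Rightarrow> complex \<Rightarrow> complex" where
  "pcfU a = (THE f. f holomorphic_on UNIV \<and>
     (\<forall>z. deriv (deriv f) z - (z^2 / 4 + a) * f z = 0) \<and>
     (\<forall>\<delta>>0. f \<sim>[inf at_infinity (principal {z. \<bar>Arg z\<bar> \<le> 3/4 * pi - \<delta>})]
              (\<lambda>z. z powr (- a - 1/2) * exp (- (z^2) / 4))))"


section \<open>The variable \<open>\<xi>\<close> and the coefficients\<close>

text \<open>For \<open>z\<close> in the plane cut along \<open>\<plusminus>iy\<close>, \<open>1 \<le> y\<close>, the number \<open>1 + z\<^sup>2\<close> is not a nonpositive real,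
  and the plane is star-shaped about 0; so principal roots and segments from 0 give the branches
  that are continuous in the cut plane and real on the real axis.\<close>

definition xibar :: "complex \<Rightarrow> complex" where
  "xibar z = contour_integral (linepath 0 z) (\<lambda>t. csqrt (t^2 + 1))"

text \<open>The recurrence producing index \<open>s + 1\<close> is written with \<open>s = k + 2\<close>. The coefficients are
  polynomials, so integration along a segment is no restriction. Index 0 is not used.\<close>

fun Ebar :: "nat \<Rightarrow> complex \<Rightarrow> complex" where
  "Ebar 0 = (\<lambda>b. 0)"
| "Ebar (Suc 0) = (\<lambda>b. 1/24 * b * (6 - 5 * b^2))"
| "Ebar (Suc (Suc 0)) = (\<lambda>b. 1/16 * (1 - b^2)^2 * (5 * b^2 - 2))"
| "Ebar (Suc (Suc (Suc k))) = (\<lambda>b.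
     - (1/2) * (1 - b^2)^2 * deriv (Ebar (Suc (Suc k))) b
     - 1/2 * contour_integral (linepath (if odd (k + 2) then 1 else 0) b)
         (\<lambda>p. (1 - p^2)^2 *
           (\<Sum>j\<in>{1..k + 1}. deriv (Ebar j) p * deriv (Ebar (k + 2 - j)) p)))"


section \<open>Admissible paths to infinity\<close>

definition R2_arc_on :: "real set \<Rightarrow> (real \<Rightarrow> complex) \<Rightarrow> bool" where
  "R2_arc_on I \<gamma> \<longleftrightarrow> (\<exists>\<gamma>' \<gamma>''.
     (\<forall>t\<in>I. (\<gamma> has_vector_derivative \<gamma>' t) (at t within I) \<and> \<gamma>' t \<noteq> 0 \<and>
            (\<gamma>' has_vector_derivative \<gamma>'' t) (at t within I)) \<and>
     continuous_on I \<gamma>'')"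

definition R2_chain :: "(real \<Rightarrow> complex) \<Rightarrow> bool" where
  "R2_chain \<gamma> \<longleftrightarrow> (\<exists>m (\<tau> :: nat \<Rightarrow> real). \<tau> 0 = 0 \<and> (\<forall>i<m. \<tau> i < \<tau> (Suc i)) \<and>
     (\<forall>i<m. R2_arc_on {\<tau> i..\<tau> (Suc i)} \<gamma>) \<and> R2_arc_on {\<tau> m..} \<gamma>)"

text \<open>The functions \<open>Q\<close> and \<open>X\<close> of the path parameter are the continuations of \<open>(1 + z\<^sup>2)\<^bsup>1/4\<^esup>\<close> and of
  \<open>\<xi>\<close> along \<open>\<gamma>\<close>. Far out on \<open>\<gamma>\<close>, where \<open>\<bar>Re z\<bar>\<close> is large, they agree with the branches of the cut
  plane; this fixes them.\<close>

definition continued_along :: "(real \<Rightarrow> complex) \<Rightarrow> (real \<Rightarrow> complex) \<Rightarrow> (real \<Rightarrow> complex) \<Rightarrow> bool" where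
  "continued_along \<gamma> Q X \<longleftrightarrow>
     continuous_on {0..} Q \<and> (\<forall>t\<ge>0. Q t ^ 4 = 1 + (\<gamma> t)^2) \<and>
     (\<forall>\<^sub>F t in at_top. Q t = (1 + (\<gamma> t)^2) powr (1/4)) \<and>
     (\<forall>t\<ge>0. ((\<lambda>s. (Q s)^2 * vector_derivative \<gamma> (at s)) has_integral (X t - X 0)) {0..t}) \<and>
     (\<forall>\<^sub>F t in at_top. X t = xibar (\<gamma> t))"

definition beta_along :: "(real \<Rightarrow> complex) \<Rightarrow> (real \<Rightarrow> complex) \<Rightarrow> real \<Rightarrow> complex" where
  "beta_along \<gamma> Q t = \<gamma> t / (Q t)^2"

text \<open>Here \<open>\<sigma>\<close> is 1 for paths from \<open>z\<close> to \<open>Re z = +\<infinity>\<close> and \<open>-1\<close> for paths from \<open>z\<close> to \<open>Re z = -\<infinity>\<close>.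
  The monotonicity of \<open>Re \<xi>\<close> is oriented: towards \<open>Re z = \<plusminus>\<infinity>\<close> it varies in the direction of
  \<open>\<plusminus>\<infinity>\<close>, which is the limit of \<open>Re \<xi>\<close> on the real axis. A path going the other way (for example
  to infinity in the direction \<open>arg z = 3\<pi>/10\<close>, where \<open>Re \<xi> \<rightarrow> -\<infinity>\<close>) would reach points of the
  exceptional curves and does not control the error.
  The last condition says that the image in the \<open>\<beta>\<close> plane has finite length. Near its end
  \<open>\<beta> = \<sigma>\<close>, where \<open>E\<^sub>1'\<close> does not vanish, an image of infinite length makes \<open>\<integral>\<bar>E\<^sub>1'(p) dp\<bar>\<close> diverge,
  hence \<open>\<omega>\<^sub>1\<close> and, for \<open>n \<ge> 2\<close>, \<open>\<varpi>\<^sub>n\<close>, and the error bound would be infinite. With the condition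
  all the integrals below converge.\<close>

definition admissible_to :: "real \<Rightarrow> complex \<Rightarrow> (real \<Rightarrow> complex) \<Rightarrow> (real \<Rightarrow> complex) \<Rightarrow>
    (real \<Rightarrow> complex) \<Rightarrow> bool" where
  "admissible_to \<sigma> z \<gamma> Q X \<longleftrightarrow>
     R2_chain \<gamma> \<and> \<gamma> 0 = z \<and> (\<forall>t\<ge>0. \<gamma> t \<noteq> \<i> \<and> \<gamma> t \<noteq> -\<i>) \<and>
     filterlim (\<lambda>t. \<sigma> * Re (\<gamma> t)) at_top at_top \<and>
     continued_along \<gamma> Q X \<and>
     mono_on {0..} (\<lambda>t. \<sigma> * Re (X t)) \<and>
     (\<lambda>t. vector_derivative (beta_along \<gamma> Q) (at t)) absolutely_integrable_on {0..}"

text \<open>The two level curves of \<open>Re \<xi>\<close> that start at \<open>\<plusminus>i\<close> and run in the left half plane.\<close>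

definition left_level_curves :: "complex set" where
  "left_level_curves = {\<i>, -\<i>} \<union>
     {z. \<exists>c. path c \<and> pathstart c \<in> {\<i>, -\<i>} \<and> pathfinish c = z \<and>
        (\<forall>t\<in>{0<..1}. Re (c t) < 0 \<and> Re (xibar (c t)) = Re (xibar (pathstart c)))}"


section \<open>The error bounds\<close>

text \<open>The integral of \<open>\<bar>g(p) dp\<bar>\<close> along the path \<open>B\<close> in the \<open>\<beta>\<close> plane.\<close>

definition abs_path_integral :: "(real \<Rightarrow> complex) \<Rightarrow> (complex \<Rightarrow> complex) \<Rightarrow> real" where
  "abs_path_integral B g = integral {0..} (\<lambda>t. norm (g (B t) * vector_derivative B (at t)))"

definition omega :: "nat \<Rightarrow> real \<Rightarrow> (real \<Rightarrow> complex) \<Rightarrow> real" where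
  "omega n u B = 2 * abs_path_integral B (deriv (Ebar n)) +
     (\<Sum>s\<in>{1..<n}. 1 / u^s * abs_path_integral B
        (\<lambda>p. \<Sum>k\<in>{s..<n}. (1 - p^2)^2 * deriv (Ebar k) p * deriv (Ebar (s + n - k - 1)) p))"

text \<open>The index range is \<open>0 \<le> s \<le> n - 2\<close>, which is empty for \<open>n = 1\<close>.\<close>

definition varpi :: "nat \<Rightarrow> real \<Rightarrow> (real \<Rightarrow> complex) \<Rightarrow> real" where
  "varpi n u B = 4 * (\<Sum>s<n - 1. 1 / u^s * abs_path_integral B (deriv (Ebar (s + 1))))"

definition error_bound :: "nat \<Rightarrow> real \<Rightarrow> (real \<Rightarrow> complex) \<Rightarrow> real" where
  "error_bound n u B = omega n u B / u^n * exp (varpi n u B / u + omega n u B / u^n)"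

end

theory Submission
  imports Defs "HOL-Real_Asymp.Real_Asymp"
begin

text \<open>Along an admissible path write \<open>S = - u\<xi> + \<Sum> (-1)\<^sup>s E\<^sub>s(\<beta>) / u\<^sup>s\<close> and let \<open>1 + e\<close> be the quotient of \<open>U\<close> by
  its exponential approximation. In the variable \<open>\<xi>\<close> the differential equation becomes
  \<open>e'' + 2S'e' = g(1 + e)\<close>, where the recurrence for \<open>E\<^sub>s\<close> makes \<open>g\<close> of order \<open>u\<^bsup>1-n\<^esup>\<close>. Since \<open>e\<close> and \<open>e'\<close> vanish at
  the end of the path and \<open>Re \<xi>\<close> is monotone on it, a Gronwall argument from the end backwards bounds \<open>e\<close>.
  The behaviour of \<open>U\<close> at the end comes from an integral representation whose contour is rotated to cover the
  whole sector of the definition. The case of \<open>Re z \<rightarrow> -\<infinity>\<close> is the reflection of the other in the origin.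

  For the exceptional set substitute \<open>z = sinh w\<close>, so that \<open>(1 + z\<^sup>2)\<^bsup>1/2\<^esup> = cosh w\<close> and \<open>\<xi> = (w + sinh w cosh w)/2\<close> are
  single valued, with branch points at the zeros of \<open>cosh w\<close>. Paths are constructed in the \<open>w\<close> plane, from
  vertical segments, horizontal rays and curves on which \<open>Re \<xi>\<close> is constant or nearly so. Conversely, a path
  that starts with \<open>Re \<xi> \<ge> 0\<close> cannot leave the sheet \<open>Re w \<ge> 0\<close>, \<open>\<bar>Im w\<bar> < \<pi>/2\<close>.\<close>

section \<open>An integral representation of the parabolic cylinder function\<close>

text \<open>U is entire, so changing sheets affects only its approximation: the fourth root
  \<open>Q\<close> and \<xi> are carried along the path as functions of its parameter, and all
  derivatives with respect to \<xi> are taken there. At the end of the path nothing is known but Re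
  z -> infinity. Hence the asymptotics of U must be uniform in the whole right half plane, including
  the directions near the imaginary axis where exp(-z^2/4) is large; the unrotated integral loses
  uniformity there, and turning its ray by almost \<pi>/4 either way restores it. That e' vanishes
  at the end as well is not contained in the asymptotics and comes from Cauchy's estimate.
  Admissibility ties the sheet to the cut plane only at the far end. The two square roots over one z
  give opposite values of Re \<xi>, and w -> i\<pi> - w exchanges them, so a start in the left half
  plane is placed where Re \<xi> < 0. This choice is void exactly when Re \<xi> = 0, which is how
  the exceptional curves arise.\<close>

lemma integral_powr_exp_real:
  assumes "\<alpha> > 0" "r > (0::real)"
  shows "(\<lambda>s. s powr (\<alpha> - 1) * exp (- r * s)) integrable_on {0<..}"
proof -
  have "(\<lambda>t. complex_of_real t powr (of_real \<alpha> - 1) / of_real (exp (r * t))) absolutely_integrable_on {0<..}"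
    using assms by (intro absolutely_integrable_Gamma_integral) auto
  hence "(\<lambda>t. norm (complex_of_real t powr (of_real \<alpha> - 1) / of_real (exp (r * t)))) integrable_on {0<..}"
    by (simp add: absolutely_integrable_on_def)
  moreover have "norm (complex_of_real t powr (of_real \<alpha> - 1) / of_real (exp (r * t)))
      = t powr (\<alpha> - 1) * exp (- r * t)" if "t \<in> {0<..}" for t
    using that by (simp add: norm_divide norm_powr_real_powr exp_minus field_simps)
  ultimately show ?thesis
    by (rule integrable_eq)
qed

lemma absolutely_integrable_Gamma_dominated:
  fixes g :: "real \<Rightarrow> complex"
  assumes cont: "continuous_on {0<..} g" and "\<alpha> > 0" "r > 0"
    and le: "\<And>s. s > 0 \<Longrightarrow> norm (g s) \<le> C * (s powr (\<alpha> - 1) * exp (- r * s))"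
  shows "g absolutely_integrable_on {0<..}"
proof -
  have int: "(\<lambda>t. C * (t powr (\<alpha> - 1) * exp (- r * t))) integrable_on {0<..}"
    using integral_powr_exp_real[OF assms(2,3)] by (rule integrable_on_mult_right)
  show ?thesis
  proof (rule measurable_bounded_by_integrable_imp_absolutely_integrable[OF _ _ int])
    show "g \<in> borel_measurable (lebesgue_on {0<..})"
      by (intro continuous_imp_measurable_on_sets_lebesgue cont) auto
  qed (use le in auto)
qed

text \<open>With \<alpha> = a + 1/2, \<kappa> = exp(2i\<theta>) and w = exp(i\<theta>) z this is, up
  to a constant factor, the integrand on the ray arg s = \<theta> after the ray has been turned into
  the positive axis. Treating \<kappa> and w as independent parameters lets \<kappa> = 0 give the
  Gamma integral.\<close>

definition pcf_integrand :: "real \<Rightarrow> complex \<Rightarrow> complex \<Rightarrow> real \<Rightarrow> complex" where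
  "pcf_integrand \<alpha> \<kappa> w s = of_real (s powr (\<alpha> - 1)) * exp (- (\<kappa> * of_real s ^ 2 / 2) - w * of_real s)"

definition pcf_integral :: "real \<Rightarrow> complex \<Rightarrow> complex \<Rightarrow> complex" where
  "pcf_integral \<alpha> \<kappa> w = integral {0<..} (pcf_integrand \<alpha> \<kappa> w)"

text \<open>Convergence at infinity is due to the Gaussian factor or, on the boundary Re \<kappa> =
  0, to the factor exp(-ws).\<close>

definition pcf_dom :: "complex \<Rightarrow> complex \<Rightarrow> bool" where
  "pcf_dom \<kappa> w \<longleftrightarrow> Re \<kappa> > 0 \<or> (Re \<kappa> = 0 \<and> Re w > 0)"

lemma pcf_dom_bound:
  assumes "pcf_dom \<kappa> w"
  obtains C r :: real where "C > 0" "r > 0"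
    "\<And>s. norm (exp (- (\<kappa> * of_real s ^ 2 / 2) - w * of_real s)) \<le> C * exp (- r * s)"
proof (cases "Re \<kappa> > 0")
  case True
  define k where "k = Re \<kappa>"
  have "norm (exp (- (\<kappa> * of_real s ^ 2 / 2) - w * of_real s)) \<le> exp ((1 - Re w)^2 / (2 * k)) * exp (- 1 * s)" for s
  proof -
    have "- (k * s^2 / 2) - Re w * s \<le> (1 - Re w)^2 / (2 * k) - s"
    proof -
      \<comment> \<open>Completing the square absorbs the linear term, whatever its sign, into the
        constant; the decay rate 1 is an arbitrary choice.\<close>
      have "0 \<le> (k * s - (1 - Re w))^2 / (2 * k)" using True by (simp add: k_def)
      also have "\<dots> = k * s^2 / 2 - s * (1 - Re w) + (1 - Re w)^2 / (2*k)"
        using True by (simp add: k_def power2_eq_square field_simps)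
      finally show ?thesis by (simp add: algebra_simps)
    qed
    thus ?thesis by (simp add: k_def flip: exp_add of_real_power)
  qed
  thus ?thesis using that[of "exp ((1 - Re w)^2 / (2 * k))" 1] by simp
next
  case False
  hence "Re \<kappa> = 0" "Re w > 0" using assms by (auto simp: pcf_dom_def)
  thus ?thesis using that[of 1 "Re w"] by (simp flip: of_real_power)
qed

lemma continuous_on_pcf_integrand: "continuous_on {0<..} (pcf_integrand \<alpha> \<kappa> w)"
  unfolding pcf_integrand_def by (intro continuous_intros) auto

lemma absolutely_integrable_pcf_integrand:
  assumes "pcf_dom \<kappa> w" "\<alpha> > 0"
  shows "pcf_integrand \<alpha> \<kappa> w absolutely_integrable_on {0<..}"
proof -
  obtain C r where Cr: "C > 0" "r > 0"
    "\<And>s. norm (exp (- (\<kappa> * of_real s ^ 2 / 2) - w * of_real s)) \<le> C * exp (- r * s)"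
    using pcf_dom_bound[OF assms(1)] by metis
  show ?thesis
  proof (rule absolutely_integrable_Gamma_dominated[OF continuous_on_pcf_integrand assms(2) Cr(2)])
    fix s :: real assume "s > 0"
    show "norm (pcf_integrand \<alpha> \<kappa> w s) \<le> C * (s powr (\<alpha> - 1) * exp (- r * s))"
      using mult_left_mono[OF Cr(3)[of s], of "s powr (\<alpha> - 1)"]
      by (simp add: pcf_integrand_def norm_mult mult_ac del: norm_exp_eq_Re)
  qed
qed

lemma pcf_integrand_Suc: "s > 0 \<Longrightarrow> pcf_integrand (\<alpha> + 1) \<kappa> w s = of_real s * pcf_integrand \<alpha> \<kappa> w s"
  by (simp add: pcf_integrand_def powr_diff)

text \<open>Differentiation under the integral sign by a quadratic remainder: exp(-hs) - 1 + hs is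
  at most |h|^2 s^2 exp(|h|s) in modulus, so the difference quotient misses its limit by |h| times
  an integral with \<alpha> + 2 in place of \<alpha>.\<close>

lemma pcf_integral_has_field_derivative:
  assumes dom: "pcf_dom \<kappa> w" and \<alpha>: "\<alpha> > 0"
  shows "(pcf_integral \<alpha> \<kappa> has_field_derivative - pcf_integral (\<alpha> + 1) \<kappa> w) (at w)"
proof -
  obtain C r where C: "C > 0" and r: "r > 0" and Cr:
    "\<And>s. norm (exp (- (\<kappa> * of_real s ^ 2 / 2) - w * of_real s)) \<le> C * exp (- r * s)"
    using pcf_dom_bound[OF dom] by metis
  let ?D = "\<lambda>s. s powr (\<alpha> + 2 - 1) * exp (- (r/2) * s)"
  have Dint: "?D integrable_on {0<..}"
    using \<alpha> r by (intro integral_powr_exp_real) auto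
  define K where "K = C * integral {0<..} ?D"
  have int0: "pcf_integrand \<beta> \<kappa> w integrable_on {0<..}" if "\<beta> > 0" for \<beta>
    using absolutely_integrable_pcf_integrand[OF dom that] set_lebesgue_integral_eq_integral(1) by blast
  \<comment> \<open>Within this radius exp(|h|s) uses up at most half of the decay rate r, and Re (w
    + h) stays positive in the case Re \<kappa> = 0.\<close>
  define e where "e = min (r/2) (if Re \<kappa> = 0 then Re w / 2 else r / 2)"
  have e: "e > 0" "e \<le> r/2" using r dom by (auto simp: e_def pcf_dom_def)
  have bound: "norm (pcf_integral \<alpha> \<kappa> (w + h) - pcf_integral \<alpha> \<kappa> w + h * pcf_integral (\<alpha> + 1) \<kappa> w) \<le> K * norm h ^ 2"
    if h: "norm h < e" for h
  proof -
    have "pcf_dom \<kappa> (w + h)"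
      using dom h abs_Re_le_cmod[of h] by (auto simp: pcf_dom_def e_def min_def split: if_splits)
    hence inth: "pcf_integrand \<alpha> \<kappa> (w + h) integrable_on {0<..}"
      using absolutely_integrable_pcf_integrand[OF _ \<alpha>] set_lebesgue_integral_eq_integral(1) by blast
    have "pcf_integral \<alpha> \<kappa> (w + h) - pcf_integral \<alpha> \<kappa> w + h * pcf_integral (\<alpha> + 1) \<kappa> w =
      integral {0<..} (\<lambda>s. pcf_integrand \<alpha> \<kappa> (w + h) s - pcf_integrand \<alpha> \<kappa> w s + h * pcf_integrand (\<alpha> + 1) \<kappa> w s)"
      unfolding pcf_integral_def using inth int0[of \<alpha>] int0[of "\<alpha> + 1"] \<alpha>
      by (simp add: integral_add integral_diff integrable_diff integrable_on_mult_right)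
    also have "norm \<dots> \<le> integral {0<..} (\<lambda>s. norm h ^ 2 * C * ?D s)"
    proof (rule integral_norm_bound_integral)
      show "(\<lambda>s. pcf_integrand \<alpha> \<kappa> (w + h) s - pcf_integrand \<alpha> \<kappa> w s + h * pcf_integrand (\<alpha> + 1) \<kappa> w s) integrable_on {0<..}"
        using inth int0[of \<alpha>] int0[of "\<alpha> + 1"] \<alpha> by (intro integrable_add integrable_diff integrable_on_mult_right) auto
      show "(\<lambda>s. norm h ^ 2 * C * ?D s) integrable_on {0<..}"
        using Dint by (rule integrable_on_mult_right)
      fix s :: real assume "s \<in> {0<..}"
      hence s: "s > 0" by simp
      define E where "E = exp (- (\<kappa> * of_real s ^ 2 / 2) - w * of_real s)"
      have "exp (- (\<kappa> * of_real s ^ 2 / 2) - (w + h) * of_real s) = E * exp (- h * of_real s)"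
        unfolding E_def exp_add [symmetric] by (rule arg_cong[of _ _ exp]) (simp add: algebra_simps)
      hence "pcf_integrand \<alpha> \<kappa> (w + h) s - pcf_integrand \<alpha> \<kappa> w s + h * pcf_integrand (\<alpha> + 1) \<kappa> w s
          = of_real (s powr (\<alpha> - 1)) * E * (exp (- h * of_real s) - (1 + (- h * of_real s)))"
        unfolding pcf_integrand_Suc[OF s] by (simp add: pcf_integrand_def E_def algebra_simps)
      also have "norm \<dots> = s powr (\<alpha> - 1) * norm E * norm (exp (- h * of_real s) - (1 + (- h * of_real s)))"
        by (simp add: norm_mult)
      also have "\<dots> \<le> s powr (\<alpha> - 1) * (C * exp (- r * s)) * (exp (r / 2 * s) * (norm h * s)^2)"
      proof (intro mult_mono)
        show "norm E \<le> C * exp (- r * s)" unfolding E_def by (rule Cr)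
        have "norm (exp (- h * of_real s) - (1 + (- h * of_real s))) \<le> exp (norm h * s) * (norm h * s)^2"
          using Taylor_exp_field[of "- h * of_real s" 1] s by (simp add: norm_mult power2_eq_square)
        also have "\<dots> \<le> exp (r / 2 * s) * (norm h * s)^2"
          using h e s by (intro mult_right_mono) auto
        finally show "norm (exp (- h * of_real s) - (1 + (- h * of_real s))) \<le> exp (r / 2 * s) * (norm h * s)^2" .
      qed (use C in auto)
      also have "\<dots> = norm h ^ 2 * C * ?D s"
      proof -
        have "exp (- r * s) * exp (r/2 * s) = exp (- (r/2) * s)"
          by (subst exp_add [symmetric]) (simp add: field_simps)
        moreover have "s powr (\<alpha> + 2 - 1) = s powr (\<alpha> - 1) * s^2"
          using s by (simp add: powr_diff powr_add powr_numeral power2_eq_square)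
        ultimately show ?thesis by (simp only: power_mult_distrib mult_ac) (metis mult.left_commute)
      qed
      finally show "norm (pcf_integrand \<alpha> \<kappa> (w + h) s - pcf_integrand \<alpha> \<kappa> w s + h * pcf_integrand (\<alpha> + 1) \<kappa> w s) \<le> norm h ^ 2 * C * ?D s" .
    qed
    also have "\<dots> = K * norm h ^ 2" by (simp add: K_def)
    finally show ?thesis .
  qed
  have "((\<lambda>h. (pcf_integral \<alpha> \<kappa> (w + h) - pcf_integral \<alpha> \<kappa> w) / h - (- pcf_integral (\<alpha> + 1) \<kappa> w)) \<longlongrightarrow> 0) (at 0)"
  proof (rule Lim_null_comparison)
    show "((\<lambda>h::complex. K * norm h) \<longlongrightarrow> 0) (at 0)"
      by (rule tendsto_eq_intros refl | simp)+
    show "\<forall>\<^sub>F h in at 0. norm ((pcf_integral \<alpha> \<kappa> (w + h) - pcf_integral \<alpha> \<kappa> w) / h - (- pcf_integral (\<alpha> + 1) \<kappa> w)) \<le> K * norm h"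
      unfolding eventually_at
    proof (intro exI[of _ e] conjI ballI impI e)
      fix h :: complex assume "h \<noteq> 0 \<and> dist h 0 < e"
      hence h: "h \<noteq> 0" "norm h < e" by auto
      have "(pcf_integral \<alpha> \<kappa> (w + h) - pcf_integral \<alpha> \<kappa> w) / h - (- pcf_integral (\<alpha> + 1) \<kappa> w)
        = (pcf_integral \<alpha> \<kappa> (w + h) - pcf_integral \<alpha> \<kappa> w + h * pcf_integral (\<alpha> + 1) \<kappa> w) / h"
        using h by (simp add: field_simps)
      also have "norm \<dots> \<le> K * norm h ^ 2 / norm h"
        unfolding norm_divide by (intro divide_right_mono bound h) auto
      also have "\<dots> = K * norm h" using h by (simp add: power2_eq_square)
      finally show "norm ((pcf_integral \<alpha> \<kappa> (w + h) - pcf_integral \<alpha> \<kappa> w) / h - (- pcf_integral (\<alpha> + 1) \<kappa> w)) \<le> K * norm h" .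
    qed
  qed
  thus ?thesis
    unfolding DERIV_def by (rule LIM_zero_cancel)
qed

lemma tendsto_integral_Ici:
  fixes g :: "real \<Rightarrow> 'a::euclidean_space"
  assumes "g absolutely_integrable_on {a..}"
  shows "((\<lambda>b. integral {a..b} g) \<longlongrightarrow> integral {a..} g) at_top"
proof -
  have "((\<lambda>b. set_lebesgue_integral lebesgue {a..b} g) \<longlongrightarrow> set_lebesgue_integral lebesgue {a..} g) at_top"
    using assms by (intro tendsto_set_lebesgue_integral_at_top) auto
  moreover have "g absolutely_integrable_on {a..b}" for b
    by (rule set_integrable_subset[OF assms]) auto
  ultimately show ?thesis
    using assms by (simp add: set_lebesgue_integral_eq_integral)
qed

text \<open>The combination is the integral of d/ds (s^\<alpha> exp(-\<kappa>s^2/2 - ws)), whose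
  boundary values vanish: at 0 because \<alpha> > 0, at infinity by the decay.\<close>

lemma pcf_integral_recurrence:
  assumes dom: "pcf_dom \<kappa> w" and \<alpha>: "\<alpha> > 0"
  shows "of_real \<alpha> * pcf_integral \<alpha> \<kappa> w - \<kappa> * pcf_integral (\<alpha> + 2) \<kappa> w - w * pcf_integral (\<alpha> + 1) \<kappa> w = 0"
proof -
  let ?E = "\<lambda>s::real. exp (- (\<kappa> * of_real s ^ 2 / 2) - w * of_real s)"
  define F where "F s = of_real (s powr \<alpha>) * ?E s" for s
  define f where "f s = of_real \<alpha> * pcf_integrand \<alpha> \<kappa> w s - \<kappa> * pcf_integrand (\<alpha> + 2) \<kappa> w s
      - w * pcf_integrand (\<alpha> + 1) \<kappa> w s" for s
  have abs: "pcf_integrand \<beta> \<kappa> w absolutely_integrable_on {0<..}" if "\<beta> > 0" for \<beta>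
    by (rule absolutely_integrable_pcf_integrand[OF dom that])
  have int0: "pcf_integrand \<beta> \<kappa> w integrable_on {0<..}" if "\<beta> > 0" for \<beta>
    using abs[OF that] set_lebesgue_integral_eq_integral(1) by blast
  have f_abs: "f absolutely_integrable_on {0<..}"
    unfolding f_def using \<alpha> by (intro set_integral_diff set_integrable_mult_right abs) auto
  have f_abs0: "f absolutely_integrable_on {0..}"
  proof (rule absolutely_integrable_spike_set[OF f_abs])
    show "negligible {x \<in> {0<..} - {0..}. f x \<noteq> 0}" by (rule negligible_subset[of "{}"]) auto
    show "negligible {x \<in> {0..} - {0<..}. f x \<noteq> 0}" by (rule negligible_subset[of "{0}"]) auto
  qed
  have deriv: "(F has_vector_derivative f s) (at s)" if "s > 0" for s
  proof -
    have "((\<lambda>s. s powr \<alpha>) has_real_derivative \<alpha> * s powr (\<alpha> - 1)) (at s)"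
      using that by (auto intro!: derivative_eq_intros)
    hence 1: "((\<lambda>s. complex_of_real (s powr \<alpha>)) has_vector_derivative of_real (\<alpha> * s powr (\<alpha> - 1))) (at s)"
      by (intro has_vector_derivative_of_real) (simp add: has_real_derivative_iff_has_vector_derivative)
    have 2: "(?E has_vector_derivative ((- \<kappa> * of_real s - w) * ?E s)) (at s)"
      by (rule has_vector_derivative_real_field) (auto intro!: derivative_eq_intros)
    have "(F has_vector_derivative of_real (\<alpha> * s powr (\<alpha> - 1)) * ?E s + of_real (s powr \<alpha>) * ((- \<kappa> * of_real s - w) * ?E s)) (at s)"
      unfolding F_def using has_vector_derivative_mult[OF 1 2] by (simp add: add.commute)
    also have "of_real (\<alpha> * s powr (\<alpha> - 1)) * ?E s + of_real (s powr \<alpha>) * ((- \<kappa> * of_real s - w) * ?E s) = f s"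
    proof -
      have "s powr (\<alpha> + 2 - 1) = s * s powr \<alpha>" "s powr (\<alpha> + 1 - 1) = s powr \<alpha>"
        using that powr_mult_base[of s \<alpha>] by (simp_all add: add.commute)
      thus ?thesis by (simp add: f_def pcf_integrand_def algebra_simps)
    qed
    finally show ?thesis .
  qed
  have int: "integral {0..N} f = F N" if "N \<ge> 0" for N
  proof -
    have "continuous_on {0..N} F"
      unfolding F_def using \<alpha> by (intro continuous_intros continuous_on_powr') auto
    hence "(f has_integral (F N - F 0)) {0..N}"
      using that deriv by (intro fundamental_theorem_of_calculus_interior) auto
    moreover have "F 0 = 0" by (simp add: F_def)
    ultimately show ?thesis by (simp add: integral_unique)
  qed
  obtain C r where C: "C > 0" and r: "r > 0" and Cr: "\<And>s. norm (?E s) \<le> C * exp (- r * s)"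
    using pcf_dom_bound[OF dom] by metis
  have "(F \<longlongrightarrow> 0) at_top"
  proof (rule Lim_null_comparison)
    show "((\<lambda>s. s powr \<alpha> * (C * exp (- r * s))) \<longlongrightarrow> 0) at_top"
      using C r \<alpha> by real_asymp
    show "\<forall>\<^sub>F s in at_top. norm (F s) \<le> s powr \<alpha> * (C * exp (- r * s))"
      using Cr by (auto simp: F_def norm_mult simp del: norm_exp_eq_Re intro!: always_eventually mult_left_mono)
  qed
  moreover have "((\<lambda>N. integral {0..N} f) \<longlongrightarrow> integral {0..} f) at_top"
    by (rule tendsto_integral_Ici[OF f_abs0])
  hence "(F \<longlongrightarrow> integral {0..} f) at_top"
    by (rule Lim_transform_eventually) (auto intro: eventually_mono[OF eventually_ge_at_top[of 0]] int)
  ultimately have "integral {0..} f = 0"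
    using tendsto_unique by (metis trivial_limit_at_top_linorder)
  moreover have "integral {0..} f = integral {0<..} f"
  proof (rule integral_spike_set)
    show "negligible {x \<in> {0..} - {0<..}. f x \<noteq> 0}" by (rule negligible_subset[of "{0}"]) auto
    show "negligible {x \<in> {0<..} - {0..}. f x \<noteq> 0}" by (rule negligible_subset[of "{}"]) auto
  qed
  moreover have "integral {0<..} f = of_real \<alpha> * pcf_integral \<alpha> \<kappa> w - \<kappa> * pcf_integral (\<alpha> + 2) \<kappa> w - w * pcf_integral (\<alpha> + 1) \<kappa> w"
    unfolding f_def pcf_integral_def using \<alpha> int0
    by (simp add: integral_diff integrable_diff integrable_on_mult_right)
  ultimately show ?thesis by simp
qed

text \<open>For \<kappa> = 0 the recurrence says that the product of the integral with w^\<alpha>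
  has derivative zero; the half plane is convex, and w = 1 gives the constant.\<close>

lemma pcf_integral_0:
  assumes w: "Re w > 0" and \<alpha>: "\<alpha> > 0"
  shows "pcf_integral \<alpha> 0 w = of_real (Gamma \<alpha>) * w powr (- of_real \<alpha>)"
proof -
  define G where "G z = pcf_integral \<alpha> 0 z * z powr of_real \<alpha>" for z
  have der: "(G has_field_derivative 0) (at z)" if z: "Re z > 0" for z
  proof -
    have dom: "pcf_dom 0 z" using z by (simp add: pcf_dom_def)
    have z0: "z \<notin> \<real>\<^sub>\<le>\<^sub>0" "z \<noteq> 0" using z by (auto simp: complex_nonpos_Reals_iff)
    have "(G has_field_derivative (- pcf_integral (\<alpha> + 1) 0 z * z powr of_real \<alpha>
             + pcf_integral \<alpha> 0 z * (of_real \<alpha> * z powr (of_real \<alpha> - 1)))) (at z)"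
      unfolding G_def using z0
      by (auto intro!: derivative_eq_intros pcf_integral_has_field_derivative[OF dom \<alpha>])
    moreover have "of_real \<alpha> * pcf_integral \<alpha> 0 z = z * pcf_integral (\<alpha> + 1) 0 z"
      using pcf_integral_recurrence[OF dom \<alpha>] by simp
    hence "- pcf_integral (\<alpha> + 1) 0 z * z powr of_real \<alpha>
             + pcf_integral \<alpha> 0 z * (of_real \<alpha> * z powr (of_real \<alpha> - 1)) = 0"
      using z0 by (simp add: powr_diff field_simps)
    ultimately show ?thesis by simp
  qed
  have "convex {z. Re z > 0}" by (rule convex_halfspace_Re_gt)
  moreover have "(G has_field_derivative 0) (at z within {z. Re z > 0})" if "z \<in> {z. Re z > 0}" for z
    using der that by (auto intro: has_field_derivative_at_within)
  ultimately obtain c where c: "\<And>z. z \<in> {z. Re z > 0} \<Longrightarrow> G z = c"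
    using has_field_derivative_zero_constant[of "{z. Re z > 0}" G] by blast
  have "pcf_integral \<alpha> 0 1 = of_real (Gamma \<alpha>)"
  proof -
    have "((\<lambda>t. of_real t powr (of_real \<alpha> - 1) / of_real (exp t)) has_integral Gamma (complex_of_real \<alpha>)) {0<..}"
      by (rule Gamma_integral_complex') (use \<alpha> in auto)
    hence "(pcf_integrand \<alpha> 0 1 has_integral Gamma (complex_of_real \<alpha>)) {0<..}"
    proof (rule has_integral_eq[rotated])
      fix s :: real assume "s \<in> {0<..}"
      hence 1: "complex_of_real s powr (of_real \<alpha> - 1) = of_real (s powr (\<alpha> - 1))"
        using powr_of_real[of s "\<alpha> - 1"] by simp
      have 2: "exp (- (0 * complex_of_real s ^ 2 / 2) - 1 * of_real s) = 1 / of_real (exp s)"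
        unfolding exp_of_real [symmetric] by (simp add: exp_minus inverse_eq_divide)
      show "of_real s powr (of_real \<alpha> - 1) / of_real (exp s) = pcf_integrand \<alpha> 0 1 s"
        unfolding pcf_integrand_def 1 2 by simp
    qed
    thus ?thesis by (simp add: pcf_integral_def integral_unique Gamma_complex_of_real)
  qed
  hence "c = of_real (Gamma \<alpha>)" using c[of 1] by (simp add: G_def)
  hence "G w = of_real (Gamma \<alpha>)" using c w by simp
  moreover have "w \<noteq> 0" using w by auto
  ultimately show ?thesis
    by (simp add: G_def powr_minus field_simps)
qed

lemma norm_exp_minus_one_le:
  fixes x :: complex
  assumes "Re x \<le> 0"
  shows "norm (exp x - 1) \<le> norm x"
proof -
  have "norm (exp x - exp 0) \<le> 1 * norm (x - 0)"
  proof (rule field_differentiable_bound[of "{z. Re z \<le> 0}" exp exp])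
    show "convex {z. Re z \<le> 0}" by (rule convex_halfspace_Re_le)
  qed (use assms in \<open>auto intro!: derivative_eq_intros\<close>)
  thus ?thesis by simp
qed

text \<open>Dropping the Gaussian factor changes it by at most |\<kappa>|s^2/2, since |exp x - 1|
  \<le> |x| for Re x \<le> 0; the total change is again a Gamma integral, with exponent \<alpha> + 2
  and argument Re w.\<close>

lemma pcf_integral_asymp_bound:
  assumes \<kappa>: "Re \<kappa> > 0" and w: "Re w > 0" and \<alpha>: "\<alpha> > 0"
  shows "norm (pcf_integral \<alpha> \<kappa> w - of_real (Gamma \<alpha>) * w powr (- of_real \<alpha>))
     \<le> norm \<kappa> / 2 * (Gamma (\<alpha> + 2) * Re w powr (- (\<alpha> + 2)))"
proof -
  have dom: "pcf_dom \<kappa> w" "pcf_dom 0 w" "pcf_dom 0 (of_real (Re w))" using assms by (auto simp: pcf_dom_def)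
  have int0: "pcf_integrand \<beta> k v integrable_on {0<..}" if "\<beta> > 0" "pcf_dom k v" for \<beta> k v
    using absolutely_integrable_pcf_integrand[OF that(2,1)] set_lebesgue_integral_eq_integral(1) by blast
  let ?D = "\<lambda>s. s powr (\<alpha> + 2 - 1) * exp (- Re w * s)"
  have "integral {0<..} (\<lambda>s. complex_of_real (?D s)) = pcf_integral (\<alpha> + 2) 0 (of_real (Re w))"
    unfolding pcf_integral_def by (rule integral_cong) (simp add: pcf_integrand_def exp_of_real [symmetric])
  also have "\<dots> = of_real (Gamma (\<alpha> + 2) * Re w powr (- (\<alpha> + 2)))"
    using pcf_integral_0[of "of_real (Re w)" "\<alpha> + 2"] w \<alpha> by (simp add: powr_of_real [symmetric])
  finally have "complex_of_real (integral {0<..} ?D) = of_real (Gamma (\<alpha> + 2) * Re w powr (- (\<alpha> + 2)))"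
  proof -
    have "((\<lambda>s. complex_of_real (?D s)) has_integral of_real (integral {0<..} ?D)) {0<..}"
      using integral_powr_exp_real[of "\<alpha> + 2" "Re w"] w \<alpha>
      by (intro has_integral_of_real integrable_integral) auto
    from integral_unique[OF this] show "integral {0<..} (\<lambda>s. complex_of_real (?D s)) = of_real (Gamma (\<alpha> + 2) * Re w powr (- (\<alpha> + 2)))
      \<Longrightarrow> complex_of_real (integral {0<..} ?D) = of_real (Gamma (\<alpha> + 2) * Re w powr (- (\<alpha> + 2)))"
      by simp
  qed
  hence D: "integral {0<..} ?D = Gamma (\<alpha> + 2) * Re w powr (- (\<alpha> + 2))"
    by (simp only: of_real_eq_iff)
  have Dint: "?D integrable_on {0<..}"
    using \<alpha> w by (intro integral_powr_exp_real) auto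
  have "pcf_integral \<alpha> \<kappa> w - of_real (Gamma \<alpha>) * w powr (- of_real \<alpha>) =
     integral {0<..} (\<lambda>s. pcf_integrand \<alpha> \<kappa> w s - pcf_integrand \<alpha> 0 w s)"
    using pcf_integral_0[OF w \<alpha>] int0[OF \<alpha> dom(1)] int0[OF \<alpha> dom(2)]
    by (simp add: pcf_integral_def integral_diff)
  also have "norm \<dots> \<le> integral {0<..} (\<lambda>s. norm \<kappa> / 2 * ?D s)"
  proof (rule integral_norm_bound_integral)
    show "(\<lambda>s. pcf_integrand \<alpha> \<kappa> w s - pcf_integrand \<alpha> 0 w s) integrable_on {0<..}"
      using int0[OF \<alpha> dom(1)] int0[OF \<alpha> dom(2)] by (rule integrable_diff)
    show "(\<lambda>s. norm \<kappa> / 2 * ?D s) integrable_on {0<..}"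
      using Dint by (rule integrable_on_mult_right)
    fix s :: real assume "s \<in> {0<..}"
    hence s: "s > 0" by simp
    have "pcf_integrand \<alpha> \<kappa> w s - pcf_integrand \<alpha> 0 w s =
       of_real (s powr (\<alpha> - 1)) * exp (- w * of_real s) * (exp (- (\<kappa> * of_real s ^ 2 / 2)) - 1)"
    proof -
      have "exp (- (\<kappa> * of_real s ^ 2 / 2) - w * of_real s) = exp (- w * of_real s) * exp (- (\<kappa> * of_real s ^ 2 / 2))"
        unfolding exp_add [symmetric] by (rule arg_cong[of _ _ exp]) simp
      thus ?thesis by (simp add: pcf_integrand_def algebra_simps)
    qed
    also have "norm \<dots> \<le> s powr (\<alpha> - 1) * exp (- Re w * s) * (norm \<kappa> * s^2 / 2)"
    proof -
      have "norm (exp (- (\<kappa> * of_real s ^ 2 / 2)) - 1) \<le> norm (- (\<kappa> * of_real s ^ 2 / 2))"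
        by (rule norm_exp_minus_one_le) (use \<kappa> in \<open>simp flip: of_real_power\<close>)
      also have "\<dots> = norm \<kappa> * s^2 / 2" by (simp add: norm_mult norm_power)
      finally show ?thesis unfolding norm_mult by (intro mult_mono) auto
    qed
    also have "\<dots> = norm \<kappa> / 2 * ?D s"
      using s by (simp add: powr_diff powr_add powr_numeral power2_eq_square)
    finally show "norm (pcf_integrand \<alpha> \<kappa> w s - pcf_integrand \<alpha> 0 w s) \<le> norm \<kappa> / 2 * ?D s" .
  qed
  also have "\<dots> = norm \<kappa> / 2 * (Gamma (\<alpha> + 2) * Re w powr (- (\<alpha> + 2)))"
    using D by simp
  finally show ?thesis .
qed

text \<open>The integral of \<open>s\<^bsup>a-1/2\<^esup> exp (- s\<^sup>2/2 - zs)\<close> along the ray \<open>arg s = \<theta>\<close>, normalised. The value does not depend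
  on \<open>\<theta>\<close>, but each ray shows the asymptotics of \<open>U\<close> only for \<open>\<bar>arg z + \<theta>\<bar> < \<pi>/2\<close>.\<close>

definition pcf_sol :: "real \<Rightarrow> real \<Rightarrow> complex \<Rightarrow> complex" where
  "pcf_sol a \<theta> z = exp (- (z^2) / 4) * (cis (\<theta> * (a + 1/2)) * pcf_integral (a + 1/2) (cis (2 * \<theta>)) (cis \<theta> * z)
      / of_real (Gamma (a + 1/2)))"

context
  fixes a \<theta> :: real
  assumes a: "a > 0" and \<theta>: "\<bar>\<theta>\<bar> < pi / 4"
begin

lemma cos_2\<theta>: "cos (2 * \<theta>) > 0"
  using \<theta> by (intro cos_gt_zero_pi) auto

lemma pcf_dom_\<theta>: "pcf_dom (cis (2 * \<theta>)) w"
  using cos_2\<theta> by (simp add: pcf_dom_def)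

text \<open>Two differentiations raise \<alpha> to \<alpha> + 1 and \<alpha> + 2; the recurrence
  eliminates the raised integrals and leaves \<alpha> - 1/2 = a beside z^2/4.\<close>

lemma pcf_sol_derivs:
  obtains f' where "\<And>z. (pcf_sol a \<theta> has_field_derivative f' z) (at z)"
    "\<And>z. (f' has_field_derivative (z^2 / 4 + of_real a) * pcf_sol a \<theta> z) (at z)"
proof -
  define \<alpha> where "\<alpha> = a + 1/2"
  define c where "c = cis \<theta>"
  define K where "K = cis (\<theta> * \<alpha>) / of_real (Gamma \<alpha>)"
  define J where "J \<beta> = pcf_integral \<beta> (cis (2 * \<theta>))" for \<beta>
  have \<alpha>: "\<alpha> > 0" using a by (simp add: \<alpha>_def)
  have c2: "cis (2 * \<theta>) = c * c" by (simp add: c_def cis_mult)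
  have DJ: "((\<lambda>z. J \<beta> (c * z)) has_field_derivative - J (\<beta> + 1) (c * z) * c) (at z)" if "\<beta> > 0" for \<beta> z
  proof -
    have "((\<lambda>z. c * z) has_field_derivative c) (at z)" by (auto intro!: derivative_eq_intros)
    from DERIV_chain2[OF pcf_integral_has_field_derivative[OF pcf_dom_\<theta> that] this]
    show ?thesis by (simp add: J_def)
  qed
  have rec: "of_real \<alpha> * J \<alpha> (c * z) - c * c * J (\<alpha> + 2) (c * z) - c * z * J (\<alpha> + 1) (c * z) = 0" for z
    using pcf_integral_recurrence[OF pcf_dom_\<theta> \<alpha>, of "c * z"] by (simp add: J_def c2)
  have sol: "pcf_sol a \<theta> = (\<lambda>z. K * exp (- (z^2) / 4) * J \<alpha> (c * z))"
    by (simp add: fun_eq_iff pcf_sol_def K_def J_def \<alpha>_def c_def)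
  define f' where "f' z = K * exp (- (z^2) / 4) * (- J (\<alpha> + 1) (c * z) * c - z / 2 * J \<alpha> (c * z))" for z
  have DE: "((\<lambda>z. K * exp (- (z^2) / 4)) has_field_derivative - z / 2 * (K * exp (- (z^2) / 4))) (at z)" for z
    by (auto intro!: derivative_eq_intros)
  show ?thesis
  proof
    fix z
    show "(pcf_sol a \<theta> has_field_derivative f' z) (at z)"
      unfolding sol f'_def
      by (rule DERIV_cong[OF DERIV_mult[OF DE DJ[OF \<alpha>]]]) (simp add: algebra_simps)
    have al1: "\<alpha> + 1 > 0" and al2: "\<alpha> + 1 + 1 = \<alpha> + 2" using \<alpha> by auto
    have "(f' has_field_derivative K * exp (- (z^2) / 4) *
      (c * c * J (\<alpha> + 2) (c * z) + z * c * J (\<alpha> + 1) (c * z) - J \<alpha> (c * z) / 2 + z^2 / 4 * J \<alpha> (c * z))) (at z)"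
      unfolding f'_def
      by (rule DERIV_cong[OF DERIV_mult[OF DE DERIV_diff[OF DERIV_mult[OF DERIV_minus[OF DJ[OF al1]] DERIV_const]
            DERIV_mult[OF DERIV_cdivide[OF DERIV_ident] DJ[OF \<alpha>]]]]])
         (simp add: algebra_simps al2 power2_eq_square)
    also have "c * c * J (\<alpha> + 2) (c * z) + z * c * J (\<alpha> + 1) (c * z) - J \<alpha> (c * z) / 2 + z^2 / 4 * J \<alpha> (c * z)
        = (z^2 / 4 + of_real a) * J \<alpha> (c * z)"
      using rec[of z] by (simp add: \<alpha>_def algebra_simps)
    finally show "(f' has_field_derivative (z^2 / 4 + of_real a) * pcf_sol a \<theta> z) (at z)"
      by (simp add: sol mult_ac)
  qed
qed

lemma holomorphic_pcf_sol: "pcf_sol a \<theta> holomorphic_on UNIV"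
  by (rule pcf_sol_derivs) (auto simp: holomorphic_on_open)

lemma pcf_sol_ode: "deriv (deriv (pcf_sol a \<theta>)) z - (z^2 / 4 + of_real a) * pcf_sol a \<theta> z = 0"
proof (rule pcf_sol_derivs)
  fix f' assume 1: "\<And>z. (pcf_sol a \<theta> has_field_derivative f' z) (at z)"
    and 2: "\<And>z. (f' has_field_derivative (z^2 / 4 + of_real a) * pcf_sol a \<theta> z) (at z)"
  have "deriv (pcf_sol a \<theta>) = f'" using 1 by (auto intro: DERIV_imp_deriv)
  thus ?thesis using DERIV_imp_deriv[OF 2, of z] by simp
qed

text \<open>For w = exp(i\<theta>) z and |arg w| \<le> \<pi>/2 - \<delta> one has Re w \<ge> |z| sin
  \<delta>, so the remainder, a multiple of (Re w)^(-\<alpha>-2), is of relative order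
  |z|^(-2).\<close>

lemma pcf_sol_asymp:
  assumes \<delta>: "\<delta> > 0"
  shows "((\<lambda>z. pcf_sol a \<theta> z / (z powr (- of_real a - 1/2) * exp (- (z^2) / 4))) \<longlongrightarrow> 1)
      (inf at_infinity (principal {z. \<bar>Arg z + \<theta>\<bar> \<le> pi / 2 - \<delta>}))"
proof -
  define \<alpha> where "\<alpha> = a + 1/2"
  have \<alpha>: "\<alpha> > 0" using a by (simp add: \<alpha>_def)
  define \<Gamma> where "\<Gamma> = Gamma \<alpha>"
  have \<Gamma>: "\<Gamma> > 0" using \<alpha> by (simp add: \<Gamma>_def Gamma_real_pos)
  define F where "F = inf at_infinity (principal {z::complex. \<bar>Arg z + \<theta>\<bar> \<le> pi / 2 - \<delta>})"
  \<comment> \<open>For \<delta> > \<pi>/2 the sector is empty; the minimum keeps sin d positive in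
    that case too.\<close>
  define d where "d = min \<delta> (pi/2)"
  define S where "S = sin d"
  have S: "S > 0" using \<delta> pi_gt_zero unfolding S_def d_def by (intro sin_gt_zero) (auto simp: min_def)
  define C where "C = Gamma (\<alpha> + 2) * S powr (- (\<alpha> + 2)) / (2 * \<Gamma>)"
  have "F \<le> at_infinity" by (simp add: F_def)
  have lim: "((\<lambda>z. C * norm z powr (-2)) \<longlongrightarrow> 0) F"
  proof (rule filterlim_mono[OF _ order.refl \<open>F \<le> at_infinity\<close>])
    have "((\<lambda>x::real. C * x powr (-2)) \<longlongrightarrow> 0) at_top" by real_asymp
    thus "((\<lambda>z::complex. C * norm z powr (-2)) \<longlongrightarrow> 0) at_infinity"
      by (rule filterlim_compose[OF _ filterlim_norm_at_top])
  qed
  have "\<forall>\<^sub>F z in F. norm (pcf_sol a \<theta> z / (z powr (- of_real a - 1/2) * exp (- (z^2) / 4)) - 1) \<le> C * norm z powr (-2)"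
    unfolding F_def eventually_inf_principal
  proof (rule eventually_mono[OF eventually_at_infinityI[of 1]])
    fix z :: complex assume z1: "1 \<le> norm z"
    show "z \<in> {z. \<bar>Arg z + \<theta>\<bar> \<le> pi / 2 - \<delta>} \<longrightarrow>
       norm (pcf_sol a \<theta> z / (z powr (- of_real a - 1/2) * exp (- (z^2) / 4)) - 1) \<le> C * norm z powr (-2)"
    proof
      assume "z \<in> {z. \<bar>Arg z + \<theta>\<bar> \<le> pi / 2 - \<delta>}"
      hence arg: "\<bar>Arg z + \<theta>\<bar> \<le> pi / 2 - \<delta>" by simp
      have z0: "z \<noteq> 0" using z1 by auto
      define \<phi> where "\<phi> = Arg z + \<theta>"
      define w where "w = cis \<theta> * z"
      have zr: "z = rcis (norm z) (Arg z)" by (simp add: rcis_cmod_Arg)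
      have w_eq: "w = rcis (norm z) \<phi>"
        unfolding w_def \<phi>_def by (subst zr) (simp add: cis_rcis_eq rcis_mult add.commute)
      have \<phi>: "\<bar>\<phi>\<bar> \<le> pi/2 - \<delta>" using arg by (simp add: \<phi>_def)
      have d: "d = \<delta>" using \<phi> \<delta> by (auto simp: d_def)
      have w0: "w \<noteq> 0" "norm w = norm z" using z0 by (auto simp: w_def norm_mult)
      have Argw: "Arg w = \<phi>"
        by (rule Arg_unique'[of "norm z"]) (use z0 \<phi> \<delta> pi_gt_zero w_eq in \<open>auto simp: rcis_def cis_conv_exp\<close>)
      have Rew: "Re w \<ge> norm z * S"
      proof -
        have "cos \<phi> = cos \<bar>\<phi>\<bar>" by simp
        also have "\<dots> \<ge> cos (pi/2 - \<delta>)" using \<phi> \<delta> pi_gt_zero by (intro cos_monotone_0_pi_le) auto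
        hence "cos \<bar>\<phi>\<bar> \<ge> S" by (simp add: cos_diff S_def d)
        finally have "cos \<phi> \<ge> S" .
        thus ?thesis by (simp add: w_eq mult_left_mono)
      qed
      have Rew0: "Re w > 0" using Rew S z0 by (smt (verit) mult_pos_pos zero_less_norm_iff)
      have wp: "w powr (- of_real \<alpha>) = cis (- \<theta> * \<alpha>) * z powr (- of_real \<alpha>)"
      proof -
        have "Ln w = \<i> * of_real \<theta> + Ln z"
          using w0 z0 by (simp add: Ln_Arg Argw \<phi>_def algebra_simps)
        thus ?thesis using w0 z0 by (simp add: powr_def cis_conv_exp exp_add [symmetric] algebra_simps)
      qed
      have zp: "z powr (- of_real \<alpha>) \<noteq> 0" "w powr (- of_real \<alpha>) \<noteq> 0" using z0 w0 by auto
      have "pcf_sol a \<theta> z / (z powr (- of_real a - 1/2) * exp (- (z^2) / 4)) =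
         pcf_integral \<alpha> (cis (2 * \<theta>)) w / (of_real \<Gamma> * w powr (- of_real \<alpha>))"
      proof -
        have "cis (- \<theta> * \<alpha>) * cis (\<theta> * \<alpha>) = 1" by (simp add: cis_mult)
        hence "cis (\<theta> * \<alpha>) = 1 / cis (- \<theta> * \<alpha>)" by (simp add: field_simps)
        moreover have "- complex_of_real a - 1/2 = - of_real \<alpha>" by (simp add: \<alpha>_def)
        ultimately show ?thesis
          unfolding pcf_sol_def wp by (simp add: \<alpha>_def [symmetric] w_def [symmetric] \<Gamma>_def [symmetric])
      qed
      hence "norm (pcf_sol a \<theta> z / (z powr (- of_real a - 1/2) * exp (- (z^2) / 4)) - 1)
        = norm ((pcf_integral \<alpha> (cis (2 * \<theta>)) w - of_real \<Gamma> * w powr (- of_real \<alpha>)) / (of_real \<Gamma> * w powr (- of_real \<alpha>)))"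
        using zp \<Gamma> by (simp add: diff_divide_distrib)
      also have "\<dots> = norm (pcf_integral \<alpha> (cis (2 * \<theta>)) w - of_real \<Gamma> * w powr (- of_real \<alpha>)) / (\<Gamma> * norm z powr (- \<alpha>))"
      proof -
        have "norm (w powr (- of_real \<alpha>)) = norm z powr (- \<alpha>)"
          using w0 z0 by (simp add: powr_def norm_exp_eq_Re)
        thus ?thesis using \<Gamma> by (simp add: norm_divide norm_mult)
      qed
      also have "\<dots> \<le> (norm (cis (2 * \<theta>)) / 2 * (Gamma (\<alpha> + 2) * Re w powr (- (\<alpha> + 2)))) / (\<Gamma> * norm z powr (- \<alpha>))"
        unfolding \<Gamma>_def using \<Gamma> cos_2\<theta> Rew0 \<alpha>
        by (intro divide_right_mono pcf_integral_asymp_bound) (auto simp: \<Gamma>_def)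
      also have "\<dots> \<le> (1 / 2 * (Gamma (\<alpha> + 2) * (norm z * S) powr (- (\<alpha> + 2)))) / (\<Gamma> * norm z powr (- \<alpha>))"
        using Rew S z0 \<alpha> \<Gamma> Gamma_real_pos[of "\<alpha> + 2"]
        by (intro divide_right_mono mult_mono powr_mono2') (auto intro!: mult_nonneg_nonneg less_imp_le)
      also have "\<dots> = C * norm z powr (-2)"
      proof -
        have "norm z powr (- (\<alpha> + 2)) = norm z powr (- \<alpha>) * norm z powr (-2)"
          by (simp add: powr_add [symmetric])
        thus ?thesis using S z0 \<Gamma> by (simp add: C_def powr_mult)
      qed
      finally show "norm (pcf_sol a \<theta> z / (z powr (- of_real a - 1/2) * exp (- (z^2) / 4)) - 1) \<le> C * norm z powr (-2)" .
    qed
  qed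
  from Lim_null_comparison[OF this lim] show ?thesis
    unfolding F_def by (rule LIM_zero_cancel)
qed

end

section \<open>Uniqueness of the recessive solution\<close>

text \<open>The Wronskian is a constant c and (f/g)' = c/g^2. As f/g tends to 1 on S, Cauchy's
  estimate on discs inside S bounds (f/g)' along the ray through v, whereas g^2 tends to 0 there
  together with \<open>D\<close>; so c = 0 and f/g is constant.\<close>

lemma pcf_unique:
  fixes f g D :: "complex \<Rightarrow> complex" and a v :: complex
  assumes f: "f holomorphic_on UNIV" "\<And>z. deriv (deriv f) z - (z^2 / 4 + a) * f z = 0"
    and g: "g holomorphic_on UNIV" "\<And>z. deriv (deriv g) z - (z^2 / 4 + a) * g z = 0"
    and fD: "((\<lambda>z. f z / D z) \<longlongrightarrow> 1) (inf at_infinity (principal S))"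
    and gD: "((\<lambda>z. g z / D z) \<longlongrightarrow> 1) (inf at_infinity (principal S))"
    and v: "norm v = 1"
    and ball: "\<forall>\<^sub>F t in at_top. ball (of_real t * v) 1 \<subseteq> S"
    and D0: "((\<lambda>t. D (of_real t * v)) \<longlongrightarrow> 0) at_top"
  shows "f = g"
proof -
  let ?F = "inf at_infinity (principal S)"
  define W where "W z = deriv f z * g z - f z * deriv g z" for z
  have df: "(f has_field_derivative deriv f z) (at z)" for z
    using f(1) holomorphic_derivI by blast
  have dg: "(g has_field_derivative deriv g z) (at z)" for z
    using g(1) holomorphic_derivI by blast
  have ddf: "(deriv f has_field_derivative (z^2/4 + a) * f z) (at z)" for z
  proof -
    have "deriv f holomorphic_on UNIV" using f(1) by (rule holomorphic_deriv) auto
    hence "(deriv f has_field_derivative deriv (deriv f) z) (at z)" using holomorphic_derivI by blast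
    thus ?thesis using f(2)[of z] by simp
  qed
  have ddg: "(deriv g has_field_derivative (z^2/4 + a) * g z) (at z)" for z
  proof -
    have "deriv g holomorphic_on UNIV" using g(1) by (rule holomorphic_deriv) auto
    hence "(deriv g has_field_derivative deriv (deriv g) z) (at z)" using holomorphic_derivI by blast
    thus ?thesis using g(2)[of z] by simp
  qed
  have "(W has_field_derivative 0) (at z)" for z
  proof -
    have "(W has_field_derivative ((z^2/4 + a) * f z) * g z + deriv g z * deriv f z - (deriv f z * deriv g z + (z^2/4 + a) * g z * f z)) (at z)"
      unfolding W_def by (rule DERIV_cong[OF DERIV_diff[OF DERIV_mult[OF ddf dg] DERIV_mult[OF df ddg]]]) simp
    thus ?thesis by (simp add: mult_ac)
  qed
  then obtain c where c: "\<And>z. W z = c"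
    using has_field_derivative_zero_constant[of UNIV W] by auto
  have lim: "((\<lambda>z. f z / g z) \<longlongrightarrow> 1) ?F"
  proof -
    have "((\<lambda>z. (f z / D z) / (g z / D z)) \<longlongrightarrow> 1) ?F"
      using tendsto_divide[OF fD gD] by simp
    moreover have "\<forall>\<^sub>F z in ?F. f z / D z / (g z / D z) = f z / g z"
      using tendsto_imp_eventually_ne[OF gD, of 0, simplified] by (auto elim!: eventually_mono)
    ultimately show ?thesis by (rule Lim_transform_eventually)
  qed
  have g0: "\<forall>\<^sub>F z in ?F. g z \<noteq> 0"
    using tendsto_imp_eventually_ne[OF gD, of 0, simplified] by (auto elim!: eventually_mono)
  have evball: "\<forall>\<^sub>F t in at_top. \<forall>z\<in>ball (of_real t * v) 1. P z" if "\<forall>\<^sub>F z in ?F. P z" for P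
  proof -
    have "\<exists>b. \<forall>z. b \<le> norm z \<longrightarrow> z \<in> S \<longrightarrow> P z"
      using that unfolding eventually_inf_principal eventually_at_infinity by simp
    then obtain b where b: "\<And>z. norm z \<ge> b \<Longrightarrow> z \<in> S \<Longrightarrow> P z" by blast
    show ?thesis
      using ball eventually_ge_at_top[of "\<bar>b\<bar> + 1"]
    proof eventually_elim
      case (elim t)
      show ?case
      proof
        fix z assume z: "z \<in> ball (of_real t * v) 1"
        have "norm (of_real t * v) - norm z \<le> norm (of_real t * v - z)" by (rule norm_triangle_ineq2)
        hence "norm z \<ge> b" using z elim by (simp add: dist_norm norm_mult v)
        thus "P z" using z elim b by blast
      qed
    qed
  qed
  define h where "h z = f z / g z" for z
  have hder: "(h has_field_derivative c / (g z)^2) (at z)" if "g z \<noteq> 0" for z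
    unfolding h_def
    by (rule DERIV_cong[OF DERIV_divide[OF df dg that]]) (simp add: c [symmetric, of z] W_def power2_eq_square mult_ac)
  have cbound: "\<forall>\<^sub>F t in at_top. norm (c / (g (of_real t * v))^2) \<le> 2 * e" if e: "e > 0" for e
  proof -
    have "\<forall>\<^sub>F z in ?F. g z \<noteq> 0 \<and> norm (h z - 1) < e"
      using tendstoD[OF lim e] g0 by eventually_elim (simp add: h_def dist_norm)
    from evball[OF this] show ?thesis
    proof eventually_elim
      case (elim t)
      let ?z = "of_real t * v"
      have hh: "((\<lambda>z. h z - 1) has_field_derivative c / (g z)^2) (at z)" if "z \<in> ball ?z 1" for z
        using hder[of z] elim that by (auto intro!: derivative_eq_intros)
      have "norm ((deriv ^^ 1) (\<lambda>z. h z - 1) ?z) \<le> fact 1 * e / (1/2) ^ 1"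
      proof (rule Cauchy_inequality)
        have hol: "(\<lambda>z. h z - 1) holomorphic_on ball ?z 1"
          unfolding holomorphic_on_open[OF open_ball] using hh by blast
        thus "(\<lambda>z. h z - 1) holomorphic_on ball ?z (1/2)"
          by (rule holomorphic_on_subset) (auto intro: subset_ball)
        from hol have "continuous_on (ball ?z 1) (\<lambda>z. h z - 1)" by (rule holomorphic_on_imp_continuous_on)
        thus "continuous_on (cball ?z (1/2)) (\<lambda>z. h z - 1)" by (rule continuous_on_subset) auto
        fix x assume "norm (?z - x) = 1/2"
        thus "norm (h x - 1) \<le> e" using elim by (auto simp: dist_norm intro: less_imp_le)
      qed auto
      moreover have "deriv (\<lambda>z. h z - 1) ?z = c / (g ?z)^2"
        using hh[of ?z] by (auto intro: DERIV_imp_deriv)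
      ultimately show ?case by simp
    qed
  qed
  have gt: "((\<lambda>t. g (of_real t * v)) \<longlongrightarrow> 0) at_top"
  proof -
    have "((\<lambda>t. g (of_real t * v) / D (of_real t * v)) \<longlongrightarrow> 1) at_top"
    proof (rule tendstoI)
      fix e :: real assume "e > 0"
      from evball[OF tendstoD[OF gD this]] show "\<forall>\<^sub>F t in at_top. dist (g (of_real t * v) / D (of_real t * v)) 1 < e"
        by eventually_elim auto
    qed
    from tendsto_mult[OF this D0] have "((\<lambda>t. g (of_real t * v) / D (of_real t * v) * D (of_real t * v)) \<longlongrightarrow> 0) at_top" by simp
    moreover have "\<forall>\<^sub>F t in at_top. g (of_real t * v) / D (of_real t * v) * D (of_real t * v) = g (of_real t * v)"
      using evball[OF tendsto_imp_eventually_ne[OF gD, of 0, simplified]] by eventually_elim auto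
    ultimately show ?thesis by (rule Lim_transform_eventually)
  qed
  have "c = 0"
  proof (rule ccontr)
    assume "c \<noteq> 0"
    have lim0: "((\<lambda>t. (g (of_real t * v))^2) \<longlongrightarrow> 0) at_top" using tendsto_power[OF gt, of 2] by simp
    have "norm c / 4 > 0" using \<open>c \<noteq> 0\<close> by simp
    from tendstoD[OF lim0 this] have "\<forall>\<^sub>F t in at_top. norm ((g (of_real t * v))^2) < norm c / 4"
      by simp
    hence "\<forall>\<^sub>F t::real in at_top. False"
      using cbound[of 1, OF zero_less_one] evball[OF g0]
    proof eventually_elim
      case (elim t)
      let ?q = "norm ((g (of_real t * v))^2)"
      have "?q > 0" using elim by auto
      moreover have "norm c / ?q \<le> 2" using elim(2) by (simp add: norm_divide)
      ultimately have "norm c \<le> 2 * ?q" by (simp add: field_simps)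
      thus ?case using elim(1) \<open>?q > 0\<close> by simp
    qed
    thus False by simp
  qed
  \<comment> \<open>With c = 0 the quotient is constant on a disc free of zeros of g; the identity
    theorem extends f = l g to the plane, and the common asymptotics give l = 1.\<close>
  have "\<exists>t. \<forall>z\<in>ball (of_real t * v) 1. g z \<noteq> 0"
    using evball[OF g0] unfolding eventually_at_top_linorder by (meson order.refl)
  then obtain t where t: "\<And>z. z\<in>ball (of_real t * v) 1 \<Longrightarrow> g z \<noteq> 0" by blast
  have "(h has_field_derivative 0) (at z within ball (of_real t * v) 1)" if "z \<in> ball (of_real t * v) 1" for z
    using hder[OF t[OF that]] \<open>c = 0\<close> by (auto intro: has_field_derivative_at_within)
  then obtain l where l: "\<And>z. z \<in> ball (of_real t * v) 1 \<Longrightarrow> h z = l"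
    using has_field_derivative_zero_constant[of "ball (of_real t * v) 1" h] by auto
  have eq: "f z = l * g z" for z
  proof -
    have "f z - l * g z = 0"
    proof (rule analytic_continuation_open[of "ball (of_real t * v) 1" UNIV "\<lambda>z. f z - l * g z" "\<lambda>_. 0"])
      show "(\<lambda>z. f z - l * g z) holomorphic_on UNIV" by (intro holomorphic_intros f g)
      show "f z - l * g z = 0" if "z \<in> ball (of_real t * v) 1" for z
        using l[OF that] t[OF that] by (simp add: h_def field_simps)
    qed auto
    thus ?thesis by simp
  qed
  have "((\<lambda>z. f z / g z) \<longlongrightarrow> l) ?F"
    by (rule Lim_transform_eventually[OF tendsto_const]) (use g0 in eventually_elim, simp add: eq)
  moreover have "?F \<noteq> bot"
  proof
    assume "?F = bot"
    hence "\<forall>\<^sub>F z in ?F. False" by simp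
    from evball[OF this] have "\<forall>\<^sub>F t::real in at_top. False"
      by eventually_elim (meson centre_in_ball zero_less_one)
    thus False by simp
  qed
  ultimately have "l = 1" using tendsto_unique lim by blast
  thus ?thesis using eq by auto
qed

text \<open>Seen from the origin, a disc of fixed radius around t cis \<phi> subtends an angle that
  tends to 0: divide by t and use the continuity of \<open>Arg\<close> at cis \<phi>.\<close>

lemma eventually_ball_Arg:
  assumes \<phi>: "\<bar>\<phi>\<bar> < pi" and \<epsilon>: "\<epsilon> > 0"
  shows "\<forall>\<^sub>F t in at_top. ball (of_real t * cis \<phi>) 1 \<subseteq> {z. \<bar>Arg z - \<phi>\<bar> < \<epsilon>}"
proof -
  have Arg: "Arg (cis \<phi>) = \<phi>" using \<phi> by (intro Arg_cis) auto
  have "cis \<phi> \<notin> \<real>\<^sub>\<le>\<^sub>0"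
    using \<phi> Arg Arg_eq_pi[of "cis \<phi>"] complex_nonpos_Reals_iff[of "cis \<phi>"]
    by (metis abs_of_pos cis_neq_zero complex_eqI less_irrefl order_le_less pi_gt_zero zero_complex.simps)
  hence "isCont Arg (cis \<phi>)" by (rule continuous_at_Arg)
  then obtain d where d: "d > 0" "\<And>w. dist w (cis \<phi>) < d \<Longrightarrow> dist (Arg w) (Arg (cis \<phi>)) < \<epsilon>"
    using \<epsilon> unfolding continuous_at_eps_delta by (metis dist_commute)
  show ?thesis
    using eventually_gt_at_top[of "1 / d"] eventually_gt_at_top[of 0]
  proof eventually_elim
    case (elim t)
    show ?case
    proof
      fix z assume z: "z \<in> ball (of_real t * cis \<phi>) 1"
      have "dist (z / of_real t) (cis \<phi>) = norm ((z - of_real t * cis \<phi>) / of_real t)"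
        using elim by (simp add: dist_norm field_simps)
      also have "\<dots> < d"
        using z elim d(1) by (simp add: dist_norm norm_divide norm_minus_commute field_simps)
      finally have "dist (Arg (z / of_real t)) (Arg (cis \<phi>)) < \<epsilon>" by (rule d(2))
      moreover have "Arg (z / of_real t) = Arg z" using elim by (simp add: Arg_divide_of_real)
      ultimately show "z \<in> {z. \<bar>Arg z - \<phi>\<bar> < \<epsilon>}" by (simp add: Arg dist_real_def)
    qed
  qed
qed

lemma pcf_leading_tendsto_0:
  fixes a :: real
  assumes "a > 0" "cos (2 * \<phi>) > 0"
  shows "((\<lambda>t. (of_real t * cis \<phi>) powr (- of_real a - 1/2) * exp (- ((of_real t * cis \<phi>)^2) / 4)) \<longlongrightarrow> 0) at_top"
proof (rule tendsto_norm_zero_cancel)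
  have "((\<lambda>t. t powr (- a - 1/2) * exp (- (t^2 * cos (2 * \<phi>) / 4))) \<longlongrightarrow> 0) at_top"
    using assms by real_asymp
  moreover have "\<forall>\<^sub>F t in at_top. t powr (- a - 1/2) * exp (- (t^2 * cos (2 * \<phi>) / 4)) =
    norm ((of_real t * cis \<phi>) powr (- of_real a - 1/2) * exp (- ((of_real t * cis \<phi>)^2) / 4))"
    using eventually_gt_at_top[of 0]
  proof eventually_elim
    case (elim t)
    have "norm ((of_real t * cis \<phi>) powr (- of_real a - 1/2)) = t powr (- a - 1/2)"
      using elim by (simp add: powr_def norm_exp_eq_Re norm_mult)
    moreover have "(of_real t * cis \<phi>)^2 = of_real (t^2) * cis (2 * \<phi>)"
      by (simp add: power_mult_distrib power2_eq_square cis_mult)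
    hence "norm (exp (- ((of_real t * cis \<phi>)^2) / 4)) = exp (- (t^2 * cos (2 * \<phi>) / 4))"
      by (simp del: of_real_power)
    ultimately show ?case by (simp add: norm_mult)
  qed
  ultimately show "((\<lambda>t. norm ((of_real t * cis \<phi>) powr (- of_real a - 1/2) * exp (- ((of_real t * cis \<phi>)^2) / 4))) \<longlongrightarrow> 0) at_top"
    by (rule Lim_transform_eventually)
qed

text \<open>The sectors in which the two rays show the leading term overlap around arg z =
  -\<theta>/2, a direction in which that term is recessive because |\<theta>| < \<pi>/4.\<close>

lemma pcf_sol_indep:
  assumes a: "a > 0" and \<theta>: "\<bar>\<theta>\<bar> < pi / 4"
  shows "pcf_sol a \<theta> = pcf_sol a 0"
proof -
  define D where "D z = z powr (- of_real a - 1/2) * exp (- (z^2) / 4)" for z :: complex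
  define S where "S = {z. \<bar>Arg z + \<theta>\<bar> \<le> pi / 2 - pi / 4} \<inter> {z. \<bar>Arg z + 0\<bar> \<le> pi / 2 - pi / 4}"
  have F: "inf at_infinity (principal S) \<le> inf at_infinity (principal {z. \<bar>Arg z + \<theta>\<bar> \<le> pi / 2 - pi / 4})"
       "inf at_infinity (principal S) \<le> inf at_infinity (principal {z. \<bar>Arg z + 0\<bar> \<le> pi / 2 - pi / 4})"
    by (intro inf_mono order.refl; simp add: S_def)+
  have 0: "\<bar>0::real\<bar> < pi / 4" by simp
  show ?thesis
  proof (rule pcf_unique[where a = "of_real a" and D = D and S = S and v = "cis (- \<theta> / 2)"])
    show "((\<lambda>z. pcf_sol a \<theta> z / D z) \<longlongrightarrow> 1) (inf at_infinity (principal S))"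
      unfolding D_def by (rule filterlim_mono[OF pcf_sol_asymp[OF a \<theta>] order.refl F(1)]) simp
    show "((\<lambda>z. pcf_sol a 0 z / D z) \<longlongrightarrow> 1) (inf at_infinity (principal S))"
      unfolding D_def by (rule filterlim_mono[OF pcf_sol_asymp[OF a 0] order.refl F(2)]) simp
    have "\<forall>\<^sub>F t in at_top. ball (of_real t * cis (- \<theta> / 2)) 1 \<subseteq> {z. \<bar>Arg z - (- \<theta> / 2)\<bar> < pi / 8}"
      using \<theta> by (intro eventually_ball_Arg) auto
    moreover have "{z. \<bar>Arg z - (- \<theta> / 2)\<bar> < pi / 8} \<subseteq> S"
    proof
      fix z assume "z \<in> {z. \<bar>Arg z - (- \<theta> / 2)\<bar> < pi / 8}"
      hence "Arg z - (- \<theta> / 2) < pi / 8" "- (Arg z - (- \<theta> / 2)) < pi / 8"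
        unfolding mem_Collect_eq abs_less_iff by blast+
      moreover have "\<theta> < pi / 4" "- \<theta> < pi / 4" using \<theta> unfolding abs_less_iff by blast+
      ultimately show "z \<in> S"
        unfolding S_def mem_Collect_eq Int_iff abs_le_iff by (intro conjI; linarith)
    qed
    ultimately show "\<forall>\<^sub>F t in at_top. ball (of_real t * cis (- \<theta> / 2)) 1 \<subseteq> S"
      by (auto elim!: eventually_mono)
    show "((\<lambda>t. D (of_real t * cis (- \<theta> / 2))) \<longlongrightarrow> 0) at_top"
      unfolding D_def using a \<theta> by (intro pcf_leading_tendsto_0) (auto intro!: cos_gt_zero_pi)
  qed (use holomorphic_pcf_sol[OF a \<theta>] pcf_sol_ode[OF a \<theta>] holomorphic_pcf_sol[OF a 0] pcf_sol_ode[OF a 0] in auto)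
qed

section \<open>Asymptotics in the full sector and identification with \<open>pcfU\<close>\<close>

text \<open>The rays \<theta> and -\<theta> with \<theta> = \<pi>/4 - d/2 tilt the sector |arg z|
  \<le> \<pi>/2 - d/2 downwards and upwards. The losses d/2 of rotation and sector add up to d, so
  together the tilted sectors cover |arg z| \<le> 3\<pi>/4 - d.\<close>

lemma pcf_sol_asymp_full:
  assumes a: "a > 0" and \<delta>: "\<delta> > 0"
  shows "((\<lambda>z. pcf_sol a 0 z / (z powr (- of_real a - 1/2) * exp (- (z^2) / 4))) \<longlongrightarrow> 1)
      (inf at_infinity (principal {z. \<bar>Arg z\<bar> \<le> 3/4 * pi - \<delta>}))"
proof -
  define d where "d = min \<delta> (pi / 4)"
  have d: "d > 0" "d \<le> \<delta>" "d \<le> pi / 4" using \<delta> by (auto simp: d_def)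
  define \<theta> where "\<theta> = pi / 4 - d / 2"
  have \<theta>: "\<bar>\<theta>\<bar> < pi / 4" "\<bar>- \<theta>\<bar> < pi / 4" using d by (auto simp: \<theta>_def)
  let ?S = "\<lambda>\<theta>. {z. \<bar>Arg z + \<theta>\<bar> \<le> pi / 2 - d / 2}"
  let ?r = "\<lambda>z. pcf_sol a 0 z / (z powr (- of_real a - 1/2) * exp (- (z^2) / 4))"
  have "(?r \<longlongrightarrow> 1) (inf at_infinity (principal (?S \<theta>)))" "(?r \<longlongrightarrow> 1) (inf at_infinity (principal (?S (- \<theta>))))"
    using pcf_sol_asymp[OF a \<theta>(1), of "d / 2"] pcf_sol_asymp[OF a \<theta>(2), of "d / 2"]
      pcf_sol_indep[OF a \<theta>(1)] pcf_sol_indep[OF a \<theta>(2)] d by simp_all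
  hence "(?r \<longlongrightarrow> 1) (sup (inf at_infinity (principal (?S \<theta>))) (inf at_infinity (principal (?S (- \<theta>)))))"
    by (rule filterlim_sup)
  moreover have "inf at_infinity (principal {z. \<bar>Arg z\<bar> \<le> 3/4 * pi - \<delta>}) \<le> 
     sup (inf at_infinity (principal (?S \<theta>))) (inf at_infinity (principal (?S (- \<theta>))))"
  proof -
    have "{z. \<bar>Arg z\<bar> \<le> 3/4 * pi - \<delta>} \<subseteq> ?S \<theta> \<union> ?S (- \<theta>)"
      using d by (auto simp: \<theta>_def abs_if split: if_splits)
    hence "inf at_infinity (principal {z. \<bar>Arg z\<bar> \<le> 3/4 * pi - \<delta>}) \<le> inf at_infinity (principal (?S \<theta> \<union> ?S (- \<theta>)))"
      by (intro inf_mono) auto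
    also have "principal (?S \<theta> \<union> ?S (- \<theta>)) = sup (principal (?S \<theta>)) (principal (?S (- \<theta>)))" by simp
    finally show ?thesis by (simp only: inf_sup_distrib1)
  qed
  ultimately show ?thesis by (rule filterlim_mono[OF _ order.refl])
qed

lemma pcfU_eq_pcf_sol:
  assumes a: "a > 0"
  shows "pcfU (of_real a) = pcf_sol a 0"
  unfolding pcfU_def
proof (rule the_equality)
  let ?D = "\<lambda>z. z powr (- of_real a - 1/2) * exp (- (z^2) / 4)"
  let ?F = "\<lambda>\<delta>. inf at_infinity (principal {z. \<bar>Arg z\<bar> \<le> 3/4 * pi - \<delta>})"
  have 0: "\<bar>0::real\<bar> < pi / 4" by simp
  show "pcf_sol a 0 holomorphic_on UNIV \<and>
     (\<forall>z. deriv (deriv (pcf_sol a 0)) z - (z^2 / 4 + of_real a) * pcf_sol a 0 z = 0) \<and>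
     (\<forall>\<delta>>0. pcf_sol a 0 \<sim>[?F \<delta>] ?D)"
    using holomorphic_pcf_sol[OF a 0] pcf_sol_ode[OF a 0] asymp_equivI'[OF pcf_sol_asymp_full[OF a]] by blast
  fix f assume f: "f holomorphic_on UNIV \<and> (\<forall>z. deriv (deriv f) z - (z^2 / 4 + of_real a) * f z = 0) \<and>
     (\<forall>\<delta>>0. f \<sim>[?F \<delta>] ?D)"
  have D0: "\<forall>\<^sub>F z in ?F (pi/2). ?D z \<noteq> 0"
    unfolding eventually_inf_principal by (rule eventually_mono[OF eventually_not_equal_at_infinity[of 0]]) auto
  \<comment> \<open>For \<delta> = \<pi>/2 the sector is |arg z| \<le> \<pi>/4; it surrounds the
    positive axis, where the leading term is recessive.\<close>
  show "f = pcf_sol a 0"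
  proof (rule pcf_unique[where a = "of_real a" and D = ?D and S = "{z. \<bar>Arg z\<bar> \<le> 3/4 * pi - pi / 2}" and v = "cis 0"])
    have "f \<sim>[?F (pi/2)] ?D" using f pi_half_gt_zero by blast
    thus "((\<lambda>z. f z / ?D z) \<longlongrightarrow> 1) (?F (pi/2))"
      by (rule asymp_equivD_strong) (use D0 in \<open>auto elim!: eventually_mono\<close>)
    show "((\<lambda>z. pcf_sol a 0 z / ?D z) \<longlongrightarrow> 1) (?F (pi/2))"
      by (rule pcf_sol_asymp_full[OF a]) simp
    have "\<forall>\<^sub>F t in at_top. ball (of_real t * cis 0) 1 \<subseteq> {z. \<bar>Arg z - 0\<bar> < pi / 4}"
      by (intro eventually_ball_Arg) auto
    thus "\<forall>\<^sub>F t in at_top. ball (of_real t * cis 0) 1 \<subseteq> {z. \<bar>Arg z\<bar> \<le> 3/4 * pi - pi / 2}"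
      by (auto elim!: eventually_mono dest!: subsetD)
    show "((\<lambda>t. ?D (of_real t * cis 0)) \<longlongrightarrow> 0) at_top"
      using a by (intro pcf_leading_tendsto_0) auto
  qed (use f holomorphic_pcf_sol[OF a 0] pcf_sol_ode[OF a 0] in auto)
qed

lemma pcfU_derivs:
  assumes a: "a > (0::real)"
  obtains f' where "\<And>z. (pcfU (of_real a) has_field_derivative f' z) (at z)"
    "\<And>z. (f' has_field_derivative (z^2 / 4 + of_real a) * pcfU (of_real a) z) (at z)"
  unfolding pcfU_eq_pcf_sol[OF a] using a pi_gt_zero by (elim pcf_sol_derivs[of a 0, rotated 2]) auto

lemma pcfU_asymp_halfplane:
  assumes a: "a > (0::real)"
  shows "((\<lambda>z. pcfU (of_real a) z / (z powr (- of_real a - 1/2) * exp (- (z^2) / 4))) \<longlongrightarrow> 1)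
      (inf at_infinity (principal {z. Re z > 0}))"
proof -
  have "((\<lambda>z. pcfU (of_real a) z / (z powr (- of_real a - 1/2) * exp (- (z^2) / 4))) \<longlongrightarrow> 1)
      (inf at_infinity (principal {z. \<bar>Arg z\<bar> \<le> 3/4 * pi - pi / 4}))"
    unfolding pcfU_eq_pcf_sol[OF a] by (rule pcf_sol_asymp_full[OF a]) simp
  moreover have "inf at_infinity (principal {z. Re z > 0}) \<le> inf at_infinity (principal {z. \<bar>Arg z\<bar> \<le> 3/4 * pi - pi / 4})"
  proof (intro inf_mono order.refl, unfold principal_le_iff, safe)
    fix z :: complex assume "Re z > 0"
    moreover from this have "z \<noteq> 0" by auto
    ultimately have "\<bar>Arg z\<bar> < pi / 2" using Re_Ln_pos_lt[of z] Arg_eq_Im_Ln[of z] by auto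
    thus "\<bar>Arg z\<bar> \<le> 3/4 * pi - pi / 4" by simp
  qed
  ultimately show ?thesis by (rule filterlim_mono[OF _ order.refl])
qed

section \<open>The coefficients\<close>

text \<open>Turns the segment integral in the recurrence of \<open>Ebar\<close> into a difference of
  values of one primitive, so that it can be differentiated and its dependence on the base point is
  explicit.\<close>

lemma entire_primitive:
  assumes "g holomorphic_on (UNIV :: complex set)"
  obtains G where "\<And>z. (G has_field_derivative g z) (at z)"
    "\<And>a b. contour_integral (linepath a b) g = G b - G a"
proof -
  obtain G where G: "\<And>z. z \<in> UNIV \<Longrightarrow> (G has_field_derivative g z) (at z within UNIV)"
    using holomorphic_convex_primitive'[OF convex_UNIV open_UNIV assms] by blast
  have "contour_integral (linepath a b) g = G b - G a" for a b
    using contour_integral_primitive[of UNIV G g "linepath a b"] G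
    by (intro contour_integral_unique) auto
  thus ?thesis using that G by auto
qed

text \<open>Holomorphy of the lower coefficients supplies the primitive of the integrand; the
  differentiated recurrence, which the later algebra uses, drops out of the same
  representation.\<close>

lemma Ebar_holomorphic_and_rec:
  "Ebar s holomorphic_on UNIV \<and>
   (s \<ge> 3 \<longrightarrow> (\<forall>b. deriv (Ebar s) b = - (1/2) * deriv (\<lambda>b. (1 - b^2)^2 * deriv (Ebar (s - 1)) b) b
      - 1/2 * ((1 - b^2)^2 * (\<Sum>j\<in>{1..<s-1}. deriv (Ebar j) b * deriv (Ebar (s - 1 - j)) b))))"
proof (induction s rule: less_induct)
  case (less s)
  have hol: "deriv (Ebar r) holomorphic_on UNIV" if "r < s" for r
    using less[OF that] by (intro holomorphic_deriv) auto
  consider "s = 0" | "s = 1" | "s = 2" | k where "s = Suc (Suc (Suc k))"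
    by (metis One_nat_def Suc_1 not0_implies_Suc)
  thus ?case
  proof cases
    case 4
    let ?E = "Ebar (Suc (Suc k))"
    let ?g = "\<lambda>p. (1 - p^2)^2 * (\<Sum>j\<in>{1..k + 1}. deriv (Ebar j) p * deriv (Ebar (k + 2 - j)) p)"
    have g: "?g holomorphic_on UNIV" using 4 by (intro holomorphic_intros hol) auto
    obtain G where G: "\<And>z. (G has_field_derivative ?g z) (at z)"
      "\<And>a b. contour_integral (linepath a b) ?g = G b - G a"
      using entire_primitive[OF g] by blast
    let ?c = "(if odd (k + 2) then 1 else 0) :: complex"
    let ?h = "\<lambda>b. (1 - b^2)^2 * deriv ?E b"
    have h: "?h holomorphic_on UNIV" using 4 by (intro holomorphic_intros hol) auto
    have eq: "Ebar s = (\<lambda>b. - (1/2) * ?h b - 1/2 * (G b - G ?c))"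
      unfolding 4 Ebar.simps G(2) by (simp add: mult.assoc)
    have "(?h has_field_derivative deriv ?h b) (at b)" for b
      using h holomorphic_derivI by blast
    hence der: "(Ebar s has_field_derivative (- (1/2) * deriv ?h b - 1/2 * ?g b)) (at b)" for b
      unfolding eq by (rule DERIV_cong[OF DERIV_diff[OF DERIV_cmult DERIV_cmult[OF DERIV_diff[OF G(1) DERIV_const]]]]) auto
    have "Ebar s holomorphic_on UNIV"
      unfolding holomorphic_on_open[OF open_UNIV] using der by blast
    moreover have "deriv (Ebar s) b = - (1/2) * deriv ?h b - 1/2 * ?g b" for b
      using der by (rule DERIV_imp_deriv)
    moreover have "s - 1 = Suc (Suc k)" "k + 2 = Suc (Suc k)" "{1..k + 1} = {1..<Suc (Suc k)}" using 4 by auto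
    ultimately show ?thesis by (simp only:) blast
  qed (auto simp: numeral_2_eq_2 intro!: holomorphic_intros)
qed

lemma Ebar_holomorphic: "Ebar s holomorphic_on A"
  using Ebar_holomorphic_and_rec holomorphic_on_subset by blast

lemma deriv_Ebar_holomorphic: "deriv (Ebar s) holomorphic_on A"
  using holomorphic_deriv[OF Ebar_holomorphic open_UNIV] holomorphic_on_subset by blast

lemma Ebar_has_field_derivative: "(Ebar s has_field_derivative deriv (Ebar s) b) (at b)"
  using Ebar_holomorphic[of s UNIV] holomorphic_derivI by blast

text \<open>\<open>dE\<^sub>s/d\<xi>\<close> as a function of \<open>\<beta>\<close>, since \<open>d\<beta>/d\<xi> = (1 - \<beta>\<^sup>2)\<^sup>2\<close>.\<close>

definition Fbar :: "nat \<Rightarrow> complex \<Rightarrow> complex" where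
  "Fbar s b = (1 - b^2)^2 * deriv (Ebar s) b"

lemma Fbar_has_field_derivative: "(Fbar s has_field_derivative deriv (Fbar s) b) (at b)"
proof -
  have "Fbar s holomorphic_on UNIV"
    unfolding Fbar_def by (intro holomorphic_intros deriv_Ebar_holomorphic)
  thus ?thesis using holomorphic_derivI by blast
qed

lemma deriv_Ebar_1: "deriv (Ebar (Suc 0)) b = (6 - 15 * b^2) / 24"
  by (rule DERIV_imp_deriv) (auto intro!: derivative_eq_intros simp: field_simps power2_eq_square)

lemma Fbar_1: "Fbar (Suc 0) b = (1 - b^2)^2 * (2 - 5 * b^2) / 8"
  by (simp add: Fbar_def deriv_Ebar_1 del: Ebar.simps)

text \<open>This is the coefficient of v^(-s) in S'' + S'^2 = v^2 + 2 F_1, where S' = v + F_1/v +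
  F_2/v^2 + ... and primes denote d/d\<xi>. For s = 1 the sum is empty, and the explicit second
  coefficient is -F_1/2.\<close>

lemma Fbar_rec:
  assumes "s \<ge> 1"
  shows "2 * Fbar (Suc s) b + (1 - b^2)^2 * deriv (Fbar s) b + (\<Sum>j\<in>{1..<s}. Fbar j b * Fbar (s - j) b) = 0"
proof (cases "s = 1")
  case True
  have "(Ebar (Suc (Suc 0)) has_field_derivative - (1/2) * deriv (Fbar (Suc 0)) b) (at b)"
  proof -
    have "Ebar (Suc (Suc 0)) = (\<lambda>b. - (1/2) * Fbar (Suc 0) b)"
      by (simp add: fun_eq_iff Fbar_1 field_simps)
    thus ?thesis using Fbar_has_field_derivative[of "Suc 0" b] by (auto intro!: derivative_eq_intros)
  qed
  hence "deriv (Ebar (Suc (Suc 0))) b = - (1/2) * deriv (Fbar (Suc 0)) b"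
    by (rule DERIV_imp_deriv)
  thus ?thesis using True by (simp add: Fbar_def del: Ebar.simps)
next
  case False
  have "deriv (Ebar (Suc s)) b = - (1/2) * deriv (Fbar s) b
      - 1/2 * ((1 - b^2)^2 * (\<Sum>j\<in>{1..<s}. deriv (Ebar j) b * deriv (Ebar (s - j)) b))"
    using Ebar_holomorphic_and_rec[of "Suc s"] assms False by (simp add: Fbar_def [abs_def])
  moreover have "2 * (w * (- (1/2) * d - 1/2 * (w * S))) = - (w * d) - w * w * S" for w d S :: complex
    by (simp add: field_simps)
  ultimately have "2 * Fbar (Suc s) b = - ((1 - b^2)^2 * deriv (Fbar s) b) - (1 - b^2)^2 * (1 - b^2)^2 * (\<Sum>j\<in>{1..<s}. deriv (Ebar j) b * deriv (Ebar (s - j)) b)"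
    unfolding Fbar_def[of "Suc s"] by (simp only:)
  also have "(1 - b^2)^2 * (1 - b^2)^2 * (\<Sum>j\<in>{1..<s}. deriv (Ebar j) b * deriv (Ebar (s - j)) b)
     = (\<Sum>j\<in>{1..<s}. Fbar j b * Fbar (s - j) b)"
    unfolding sum_distrib_left Fbar_def by (intro sum.cong) (simp_all add: mult_ac)
  finally show ?thesis by simp
qed

section \<open>Parity of the coefficients\<close>

text \<open>For an even integrand the base point 0 makes the primitive odd; for an odd integrand
  every primitive is even, and the base point 1 preserves this.\<close>

lemma Ebar_parity: "Ebar s (- b) = (-1) ^ s * Ebar s b"
proof (induction s arbitrary: b rule: less_induct)
  case (less s)
  have D: "deriv (Ebar r) (- b) = - ((-1) ^ r * deriv (Ebar r) b)" if "r < s" for r b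
  proof -
    have "((\<lambda>b. Ebar r (- b)) has_field_derivative deriv (Ebar r) (- b) * (-1)) (at b)"
      by (rule DERIV_chain2[OF Ebar_has_field_derivative]) (auto intro!: derivative_eq_intros)
    moreover have "((\<lambda>b. Ebar r (- b)) has_field_derivative (-1) ^ r * deriv (Ebar r) b) (at b)"
      unfolding less[OF that] by (intro DERIV_cmult Ebar_has_field_derivative)
    ultimately have "deriv (Ebar r) (- b) * (-1) = (-1) ^ r * deriv (Ebar r) b"
      by (rule DERIV_unique)
    thus ?thesis by (metis minus_minus mult_minus1_right)
  qed
  consider "s = 0" | "s = 1" | "s = 2" | k where "s = Suc (Suc (Suc k))"
    by (metis One_nat_def Suc_1 not0_implies_Suc)
  thus ?case
  proof cases
    case 4
    define g where "g = (\<lambda>p. (1 - p^2)^2 * (\<Sum>j\<in>{1..k + 1}. deriv (Ebar j) p * deriv (Ebar (k + 2 - j)) p))"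
    have g: "g holomorphic_on UNIV" unfolding g_def by (intro holomorphic_intros deriv_Ebar_holomorphic)
    obtain G where G: "\<And>z. (G has_field_derivative g z) (at z)"
      "\<And>a b. contour_integral (linepath a b) g = G b - G a"
      using entire_primitive[OF g] by blast
    have gpar: "g (- p) = (-1) ^ k * g p" for p
    proof -
      have "deriv (Ebar j) (- p) * deriv (Ebar (k + 2 - j)) (- p) = (-1) ^ k * (deriv (Ebar j) p * deriv (Ebar (k + 2 - j)) p)"
        if "j \<in> {1..k+1}" for j
      proof -
        have "(-1::complex) ^ j * (-1) ^ (k + 2 - j) = (-1) ^ k" using that by (simp flip: power_add)
        moreover have "j < s" "k + 2 - j < s" using that 4 by auto
        ultimately show ?thesis by (simp add: D mult_ac)
      qed
      hence "(\<Sum>j\<in>{1..k+1}. deriv (Ebar j) (- p) * deriv (Ebar (k + 2 - j)) (- p)) =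
          (-1) ^ k * (\<Sum>j\<in>{1..k+1}. deriv (Ebar j) p * deriv (Ebar (k + 2 - j)) p)"
        unfolding sum_distrib_left by (rule sum.cong[OF refl])
      thus ?thesis unfolding g_def by (simp only: power2_minus mult.left_commute)
    qed
    let ?c = "(if odd (k + 2) then 1 else 0) :: complex"
    have E: "Ebar s b = - (1/2) * (1 - b^2)^2 * deriv (Ebar (k + 2)) b - 1/2 * (G b - G ?c)" for b
      using G(2) unfolding 4 Ebar.simps g_def by simp
    have "G (- b) - G ?c = - ((-1) ^ k * (G b - G ?c))" for b
    proof -
      have "((\<lambda>b. G (- b) + (-1) ^ k * G b) has_field_derivative g (- b) * (-1) + (-1)^k * g b) (at b)" for b
        by (intro DERIV_add DERIV_cmult G(1) DERIV_chain2[OF G(1)]) (auto intro!: derivative_eq_intros)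
      hence "((\<lambda>b. G (- b) + (-1) ^ k * G b) has_field_derivative 0) (at b within UNIV)" for b
        by (simp add: gpar)
      then obtain C where C: "\<And>b. G (- b) + (-1) ^ k * G b = C"
        using has_field_derivative_zero_constant[OF convex_UNIV, of "\<lambda>b. G (- b) + (-1) ^ k * G b"] by auto
      show ?thesis
      proof (cases "odd k")
        case True
        thus ?thesis using C[of b] C[of 0] by (simp add: algebra_simps)
      next
        case False
        thus ?thesis using C[of b] C[of 0] by (simp add: algebra_simps)
      qed
    qed
    note Gpar = this
    have Dpar: "deriv (Ebar (k + 2)) (- b) = - ((-1) ^ k * deriv (Ebar (k + 2)) b)" for b
      using D[of "k + 2" b] 4 by simp
    have sgn: "(-1) ^ s = - ((-1) ^ k :: complex)" using 4 by simp
    have "- (1/2) * w * (- (m * d)) - 1/2 * (- (m * h)) = - m * (- (1/2) * w * d - 1/2 * h)" for w m d h :: complex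
      by (simp add: algebra_simps)
    thus ?thesis unfolding E[of "- b"] E[of b] Gpar Dpar sgn power2_minus .
  qed (auto simp: numeral_2_eq_2)
qed

lemma deriv_Ebar_parity: "deriv (Ebar s) (- b) = - ((-1) ^ s * deriv (Ebar s) b)"
proof -
  have "((\<lambda>b. Ebar s (- b)) has_field_derivative deriv (Ebar s) (- b) * (-1)) (at b)"
    by (rule DERIV_chain2[OF Ebar_has_field_derivative]) (auto intro!: derivative_eq_intros)
  moreover have "((\<lambda>b. Ebar s (- b)) has_field_derivative (-1) ^ s * deriv (Ebar s) b) (at b)"
    unfolding Ebar_parity by (intro DERIV_cmult Ebar_has_field_derivative)
  ultimately have "deriv (Ebar s) (- b) * (-1) = (-1) ^ s * deriv (Ebar s) b"
    by (rule DERIV_unique)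
  thus ?thesis by (metis minus_minus mult_minus1_right)
qed

section \<open>Residual of the truncated ansatz\<close>

text \<open>The pairs with j + k = m < n are those that the recurrence cancels; the others are
  sorted by s = j + k + 1 - n, the numbering of the sums in \<omega>.\<close>

lemma square_sum_split:
  fixes A :: "nat \<Rightarrow> 'a::comm_semiring_1"
  shows "(\<Sum>s\<in>{1..<n}. A s) ^ 2 = (\<Sum>m\<in>{1..<n}. \<Sum>j\<in>{1..<m}. A j * A (m - j)) +
     (\<Sum>s\<in>{1..<n}. \<Sum>k\<in>{s..<n}. A k * A (s + n - k - 1))"
proof -
  let ?P = "{1..<n} \<times> {1..<n}"
  have "(\<Sum>s\<in>{1..<n}. A s) ^ 2 = (\<Sum>(j,k)\<in>?P. A j * A k)"
    by (simp add: power2_eq_square sum_product sum.cartesian_product)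
  also have "\<dots> = (\<Sum>(j,k)\<in>?P \<inter> {(j,k). j + k < n}. A j * A k) + (\<Sum>(j,k)\<in>?P \<inter> - {(j,k). j + k < n}. A j * A k)"
    by (rule sum.Int_Diff[of ?P _ "{(j,k). j + k < n}", unfolded Diff_eq]) simp
  also have "(\<Sum>(j,k)\<in>?P \<inter> {(j,k). j + k < n}. A j * A k) = (\<Sum>(m,j)\<in>(SIGMA m:{1..<n}. {1..<m}). A j * A (m - j))"
    by (rule sum.reindex_bij_witness[where i = "\<lambda>(m,j). (j, m - j)" and j = "\<lambda>(j,k). (j + k, j)"]) auto
  also have "\<dots> = (\<Sum>m\<in>{1..<n}. \<Sum>j\<in>{1..<m}. A j * A (m - j))"
    by (simp add: sum.Sigma)
  also have "(\<Sum>(j,k)\<in>?P \<inter> - {(j,k). j + k < n}. A j * A k) = (\<Sum>(s,k)\<in>(SIGMA s:{1..<n}. {s..<n}). A k * A (s + n - k - 1))"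
    by (rule sum.reindex_bij_witness[where i = "\<lambda>(s,k). (k, s + n - k - 1)" and j = "\<lambda>(j,k). (j + k + 1 - n, j)"]) auto
  also have "\<dots> = (\<Sum>s\<in>{1..<n}. \<Sum>k\<in>{s..<n}. A k * A (s + n - k - 1))"
    by (simp add: sum.Sigma)
  finally show ?thesis .
qed

text \<open>The residual of the truncated exponential ansatz: with \<open>S' = v + \<Sigma> F\<^sub>s / v\<^sup>s\<close> and \<open>\<psi> = 2 F\<^sub>1\<close>,
  \<open>v\<^sup>2 + \<psi> - S'' - S'\<^sup>2\<close> only has terms of order \<open>v\<^bsup>1-n\<^esup>\<close> and beyond.\<close>

lemma LG_residual:
  fixes v :: "'a::field_char_0" and F DF :: "nat \<Rightarrow> 'a"
  assumes v: "v \<noteq> 0" and n: "n \<ge> 1"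
    and rec: "\<And>s. s \<ge> 1 \<Longrightarrow> 2 * F (Suc s) + DF s + (\<Sum>j\<in>{1..<s}. F j * F (s - j)) = 0"
  shows "v^2 + 2 * F 1 - (\<Sum>s\<in>{1..<n}. DF s / v ^ s) - (v + (\<Sum>s\<in>{1..<n}. F s / v ^ s))^2
    = 2 * F n / v ^ (n - 1) - (\<Sum>s\<in>{1..<n}. (\<Sum>k\<in>{s..<n}. F k * F (s + n - k - 1)) / v ^ (s + n - 1))"
proof -
  define A where "A s = F s / v ^ s" for s
  have sq: "(\<Sum>s\<in>{1..<n}. A s) ^ 2 = (\<Sum>m\<in>{1..<n}. (\<Sum>j\<in>{1..<m}. F j * F (m - j)) / v ^ m) +
     (\<Sum>s\<in>{1..<n}. (\<Sum>k\<in>{s..<n}. F k * F (s + n - k - 1)) / v ^ (s + n - 1))"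
    unfolding square_sum_split sum_divide_distrib
  proof (intro arg_cong2[of _ _ _ _ "(+)"] sum.cong refl)
    fix m j assume "m \<in> {1..<n}" "j \<in> {1..<m}"
    hence "v ^ m = v ^ j * v ^ (m - j)" by (simp flip: power_add)
    thus "A j * A (m - j) = F j * F (m - j) / v ^ m" by (simp add: A_def)
  next
    fix s k assume "s \<in> {1..<n}" "k \<in> {s..<n}"
    hence "v ^ (s + n - 1) = v ^ k * v ^ (s + n - k - 1)" by (simp flip: power_add)
    thus "A k * A (s + n - k - 1) = F k * F (s + n - k - 1) / v ^ (s + n - 1)" by (simp add: A_def)
  qed
  \<comment> \<open>Multiplication by v lowers each order by one: the first term becomes 2 F_1, and
    the term missing at the other end, 2 F_n / v^(n-1), is the leading term of the residual.\<close>
  have lin: "2 * v * (\<Sum>s\<in>{1..<n}. A s) = 2 * F 1 + (\<Sum>s\<in>{1..<n}. 2 * F (Suc s) / v ^ s) - 2 * F n / v ^ (n - 1)"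
    using n
  proof (induction n rule: nat_induct_at_least)
    case (Suc n)
    have "2 * v * (\<Sum>s\<in>{1..<Suc n}. A s) = 2 * v * (\<Sum>s\<in>{1..<n}. A s) + 2 * v * A n"
      using Suc.hyps by (simp add: algebra_simps)
    also have "2 * v * A n = 2 * F n / v ^ (n - 1)"
      using v Suc.hyps by (cases n) (simp_all add: A_def field_simps)
    finally show ?case using Suc by simp
  qed simp
  have "(\<Sum>s\<in>{1..<n}. DF s / v ^ s) = (\<Sum>s\<in>{1..<n}. - (2 * F (Suc s) / v ^ s) - (\<Sum>j\<in>{1..<s}. F j * F (s - j)) / v ^ s)"
  proof (intro sum.cong refl)
    fix s assume "s \<in> {1..<n}"
    hence "DF s = - (2 * F (Suc s)) - (\<Sum>j\<in>{1..<s}. F j * F (s - j))"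
    proof -
      have gen: "d = (x + d + y) - x - y" for x d y :: 'a by simp
      have "2 * F (Suc s) + DF s + (\<Sum>j\<in>{1..<s}. F j * F (s - j)) = 0"
        using rec[of s] \<open>s \<in> {1..<n}\<close> by auto
      from gen[of "DF s" "2 * F (Suc s)" "\<Sum>j\<in>{1..<s}. F j * F (s - j)", unfolded this]
      show ?thesis by (simp only: diff_0)
    qed
    thus "DF s / v ^ s = - (2 * F (Suc s) / v ^ s) - (\<Sum>j\<in>{1..<s}. F j * F (s - j)) / v ^ s"
      by (simp add: diff_divide_distrib)
  qed
  hence DF: "(\<Sum>s\<in>{1..<n}. DF s / v ^ s) = - (\<Sum>s\<in>{1..<n}. 2 * F (Suc s) / v ^ s) - (\<Sum>s\<in>{1..<n}. (\<Sum>j\<in>{1..<s}. F j * F (s - j)) / v ^ s)"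
    by (simp add: sum_subtractf sum_negf)
  have "(v + (\<Sum>s\<in>{1..<n}. A s))^2 = v^2 + 2 * v * (\<Sum>s\<in>{1..<n}. A s) + (\<Sum>s\<in>{1..<n}. A s)^2"
    by (simp add: power2_eq_square algebra_simps)
  thus ?thesis unfolding DF sq lin A_def [symmetric] by simp
qed

section \<open>A Gronwall argument on a half line\<close>

lemma integral_from_has_vector_derivative:
  fixes f :: "real \<Rightarrow> 'a::banach"
  assumes f: "f integrable_on {a..b}" and t: "a < t" "t < b" and cont: "isCont f t"
  shows "((\<lambda>t. integral {t..b} f) has_vector_derivative - f t) (at t)"
proof -
  have "((\<lambda>u. integral {a..u} f) has_vector_derivative f t) (at t within {a..b} - {})"
    using cont t by (intro integral_has_vector_derivative_continuous_at f) (auto simp: continuous_at_imp_continuous_within)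
  hence 1: "((\<lambda>u. integral {a..u} f) has_vector_derivative f t) (at t)"
    using t by (simp add: at_within_Icc_at)
  have "((\<lambda>u. integral {a..b} f - integral {a..u} f) has_vector_derivative 0 - f t) (at t)"
    by (intro has_vector_derivative_diff has_vector_derivative_const 1)
  moreover have "integral {a..b} f - integral {a..u} f = integral {u..b} f" if "u \<in> {a<..<b}" for u
    using Henstock_Kurzweil_Integration.integral_combine[of a u b f] f that by (simp add: algebra_simps)
  ultimately show ?thesis
    using t by (auto intro: has_vector_derivative_transform_within_open[of _ _ t "{a<..<b}"])
qed

lemma continuous_on_integral_from:
  fixes f :: "real \<Rightarrow> 'a::banach"
  assumes "f integrable_on {a..b}"
  shows "continuous_on {a..b} (\<lambda>t. integral {t..b} f)"
proof -
  have "continuous_on {a..b} (\<lambda>t. integral {a..b} f - integral {a..t} f)"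
    by (intro continuous_intros indefinite_integral_continuous_1 assms)
  moreover have "integral {a..b} f - integral {a..u} f = integral {u..b} f" if "u \<in> {a..b}" for u
    using Henstock_Kurzweil_Integration.integral_combine[of a u b f] assms that by (simp add: algebra_simps)
  ultimately show ?thesis by (rule continuous_on_eq)
qed

lemma gronwall_piecewise:
  fixes M k :: "real \<Rightarrow> real"
  assumes ab: "a \<le> b" and M: "continuous_on {a..b} M" and k: "k integrable_on {a..b}"
    and T: "finite T" and kc: "\<And>t. t \<in> {a<..<b} - T \<Longrightarrow> isCont k t" and k0: "\<And>t. t \<in> {a..b} \<Longrightarrow> k t \<ge> 0"
    and kM: "(\<lambda>t. k t * M t) integrable_on {a..b}"
    and le: "\<And>t. t \<in> {a..b} \<Longrightarrow> M t \<le> c + integral {t..b} (\<lambda>t. k t * M t)"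
  shows "M a \<le> c * exp (integral {a..b} k)"
proof -
  define K where "K t = integral {t..b} k" for t
  define I where "I t = c + integral {t..b} (\<lambda>t. k t * M t)" for t
  define N where "N t = exp (- K t) * I t" for t
  define N' where "N' t = (if t \<in> {a<..<b} - T then exp (- K t) * (k t * I t - k t * M t) else 0)" for t
  have "(N' has_integral N b - N a) {a..b}"
  proof (rule fundamental_theorem_of_calculus_interior_strong[OF T ab])
    show "continuous_on {a..b} N"
      unfolding N_def I_def K_def
      by (intro continuous_intros continuous_on_integral_from k kM)
    fix t assume t: "t \<in> {a<..<b} - T"
    have Mt: "isCont M t" using M t by (auto intro: continuous_on_interior)
    have K': "(K has_real_derivative - k t) (at t)"
      unfolding K_def has_real_derivative_iff_has_vector_derivative
      using t kc by (intro integral_from_has_vector_derivative[OF k]) auto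
    have I': "(I has_real_derivative - (k t * M t)) (at t)"
    proof -
      have "((\<lambda>t. integral {t..b} (\<lambda>t. k t * M t)) has_real_derivative - (k t * M t)) (at t)"
        unfolding has_real_derivative_iff_has_vector_derivative
        using t kc Mt by (intro integral_from_has_vector_derivative[OF kM]) auto
      from DERIV_add[OF DERIV_const[of c] this] show ?thesis by (simp add: I_def [abs_def])
    qed
    have "(N has_real_derivative exp (- K t) * (k t * I t - k t * M t)) (at t)"
      unfolding N_def by (auto intro!: derivative_eq_intros K' I' simp: algebra_simps)
    thus "(N has_vector_derivative N' t) (at t)"
      using t by (simp add: N'_def has_real_derivative_iff_has_vector_derivative)
  qed
  hence "N b - N a \<ge> 0"
  proof (rule has_integral_nonneg)
    fix t assume t: "t \<in> {a..b}"
    have "k t * M t \<le> k t * I t" using le[OF t] k0[OF t] by (intro mult_left_mono) (auto simp: I_def)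
    thus "0 \<le> N' t" by (simp add: N'_def)
  qed
  hence "exp (- K a) * I a \<le> c" by (simp add: N_def I_def K_def)
  hence "I a \<le> c * exp (K a)" by (simp add: exp_minus field_simps)
  moreover have "M a \<le> I a" using le[of a] ab by (simp add: I_def)
  ultimately show ?thesis by (simp add: K_def)
qed

lemma integrable_mult_continuous:
  fixes f g :: "real \<Rightarrow> real"
  assumes "f absolutely_integrable_on {a..b}" "continuous_on {a..b} g"
  shows "(\<lambda>t. f t * g t) absolutely_integrable_on {a..b}"
proof -
  have "(\<lambda>t. g t * f t) absolutely_integrable_on {a..b}"
  proof (rule absolutely_integrable_bounded_measurable_product_real)
    show "g \<in> borel_measurable (lebesgue_on {a..b})"
      by (intro continuous_imp_measurable_on_sets_lebesgue assms) auto
    show "bounded (g ` {a..b})"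
      by (intro compact_imp_bounded compact_continuous_image assms) auto
  qed (use assms in auto)
  thus ?thesis by (simp add: mult.commute)
qed

text \<open>The error \<open>e\<close> of an exponential ansatz satisfies \<open>e'' + 2S'e' = g(1 + e)\<close>. With \<open>q = e'/(2u)\<close>, both
  \<open>q\<close> and \<open>e - q\<close> are integrals of the same majorant, so no second-order kernel has to be estimated.\<close>

lemma volterra_bound:
  fixes q e x x' p g :: "real \<Rightarrow> complex" and \<alpha> \<beta> :: "real \<Rightarrow> real" and u :: real
  assumes u: "u > 0" and T: "finite T"
    and contq: "continuous_on {0..} q" and conte: "continuous_on {0..} e" and contx: "continuous_on {0..} x"
    and x': "\<And>t. t > 0 \<Longrightarrow> t \<notin> T \<Longrightarrow> (x has_vector_derivative x' t) (at t)"
    and q': "\<And>t. t > 0 \<Longrightarrow> t \<notin> T \<Longrightarrow>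
      (q has_vector_derivative x' t * ((2 * of_real u - 2 * p t) * q t + g t * (1 + e t) / (2 * of_real u))) (at t)"
    and e': "\<And>t. t > 0 \<Longrightarrow> t \<notin> T \<Longrightarrow> (e has_vector_derivative x' t * (2 * of_real u * q t)) (at t)"
    and mono: "mono_on {0..} (\<lambda>t. Re (x t))"
    and \<alpha>: "\<alpha> absolutely_integrable_on {0..}" "\<And>t. \<alpha> t \<ge> 0" "\<And>t. t > 0 \<Longrightarrow> t \<notin> T \<Longrightarrow> isCont \<alpha> t"
      "\<And>t. t > 0 \<Longrightarrow> t \<notin> T \<Longrightarrow> norm (x' t * p t) \<le> \<alpha> t"
    and \<beta>: "\<beta> absolutely_integrable_on {0..}" "\<And>t. \<beta> t \<ge> 0" "\<And>t. t > 0 \<Longrightarrow> t \<notin> T \<Longrightarrow> isCont \<beta> t"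
      "\<And>t. t > 0 \<Longrightarrow> t \<notin> T \<Longrightarrow> norm (x' t * g t) / u \<le> \<beta> t"
    and q0: "(q \<longlongrightarrow> 0) at_top" and e0: "(e \<longlongrightarrow> 0) at_top"
  shows "norm (e 0) \<le> integral {0..} \<beta> * exp (2 * integral {0..} \<alpha> + integral {0..} \<beta>)"
proof -
  define V where "V = integral {0..} \<alpha>"
  define \<Omega> where "\<Omega> = integral {0..} \<beta>"
  \<comment> \<open>The size of the boundary values at an artificial end S of the path; it tends to
    0 as S recedes to infinity.\<close>
  define \<epsilon> where "\<epsilon> S = max (norm (q S)) (norm (e S - q S))" for S
  have main: "norm (e 0) \<le> (2 * \<epsilon> S + \<Omega>) * exp (2 * V + \<Omega>)" if S: "S > 0" for S
  proof -
    define \<rho> where "\<rho> t = 2 * (\<alpha> t * norm (q t)) + \<beta> t * (1 + norm (e t)) / 2" for t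
    define M where "M t = \<epsilon> S + integral {t..S} \<rho>" for t
    have cq: "continuous_on {0..S} q" and ce: "continuous_on {0..S} e" and cx: "continuous_on {0..S} x"
      using contq conte contx by (auto intro: continuous_on_subset)
    have \<alpha>S: "\<alpha> absolutely_integrable_on {0..S}" and \<beta>S: "\<beta> absolutely_integrable_on {0..S}"
      using set_integrable_subset[OF \<alpha>(1)] set_integrable_subset[OF \<beta>(1)] by auto
    have \<alpha>i: "\<alpha> integrable_on {0..S}" and \<beta>i: "\<beta> integrable_on {0..S}"
      using \<alpha>S \<beta>S set_lebesgue_integral_eq_integral(1) by blast+
    have i1: "(\<lambda>t. \<alpha> t * norm (q t)) absolutely_integrable_on {0..S}"
      by (intro integrable_mult_continuous \<alpha>S continuous_intros cq)
    have i2: "(\<lambda>t. \<beta> t * ((1 + norm (e t)) / 2)) absolutely_integrable_on {0..S}"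
      by (intro integrable_mult_continuous \<beta>S continuous_intros ce) auto
    have \<rho>i: "\<rho> integrable_on {0..S}"
      unfolding \<rho>_def using set_lebesgue_integral_eq_integral(1)[OF i1] set_lebesgue_integral_eq_integral(1)[OF i2]
      by (intro integrable_add integrable_on_mult_right) auto
    have \<rho>0: "\<rho> t \<ge> 0" for t
      using \<alpha>(2)[of t] \<beta>(2)[of t] by (simp add: \<rho>_def)
    have \<rho>it: "\<rho> integrable_on {t..S}" if "t \<ge> 0" for t
      using integrable_on_subinterval[OF \<rho>i, of t S] that by auto
    define r where "r t = x' t * (g t * (1 + e t) / (2 * of_real u) - 2 * p t * q t)" for t
    have r: "norm (r t) \<le> \<rho> t" if "t > 0" "t \<notin> T" for t
    proof -
      have "r t = (x' t * g t) / of_real u * (1 + e t) / 2 - 2 * (x' t * p t * q t)"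
        using u by (simp add: r_def field_simps)
      also have "norm \<dots> \<le> norm ((x' t * g t) / of_real u * (1 + e t) / 2) + norm (2 * (x' t * p t * q t))"
        by (rule norm_triangle_ineq4)
      also have "norm ((x' t * g t) / of_real u * (1 + e t) / 2) = (norm (x' t * g t) / u) * norm (1 + e t) / 2"
        using u by (simp add: norm_mult norm_divide)
      also have "\<dots> \<le> \<beta> t * (1 + norm (e t)) / 2"
        using \<beta>(2,4)[of t] that norm_triangle_ineq[of 1 "e t"]
        by (intro divide_right_mono mult_mono) auto
      also have "norm (2 * (x' t * p t * q t)) = 2 * (norm (x' t * p t) * norm (q t))"
        by (simp add: norm_mult)
      also have "\<dots> \<le> 2 * (\<alpha> t * norm (q t))"
        using \<alpha>(4)[of t] that by (intro mult_left_mono mult_right_mono) auto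
      finally show ?thesis by (simp add: \<rho>_def)
    qed
    have qM: "norm (q t) \<le> M t" if t: "0 \<le> t" "t \<le> S" for t
    proof -
      \<comment> \<open>The integrating factor removes the term 2uq; for s \<ge> t its modulus is at
        most 1 since Re x is nondecreasing.\<close>
      define \<Phi> where "\<Phi> s = q s * exp (2 * of_real u * (x t - x s))" for s
      define \<phi> where "\<phi> s = (if s \<in> {t<..<S} - T then r s * exp (2 * of_real u * (x t - x s)) else 0)" for s
      have "(\<phi> has_integral \<Phi> S - \<Phi> t) {t..S}"
      proof (rule fundamental_theorem_of_calculus_interior_strong[OF T t(2)])
        show "continuous_on {t..S} \<Phi>"
          unfolding \<Phi>_def using t
          by (intro continuous_intros continuous_on_subset[OF cq] continuous_on_subset[OF cx]) auto
        fix s assume s: "s \<in> {t<..<S} - T"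
        hence s': "s > 0" "s \<notin> T" using t by auto
        have "((\<lambda>s. 2 * of_real u * (x t - x s)) has_vector_derivative 2 * of_real u * (0 - x' s)) (at s)"
          by (intro has_vector_derivative_mult_right has_vector_derivative_diff has_vector_derivative_const x' s')
        from field_vector_diff_chain_at[OF this DERIV_exp]
        have "((\<lambda>s. exp (2 * of_real u * (x t - x s))) has_vector_derivative
            (2 * of_real u * (0 - x' s)) * exp (2 * of_real u * (x t - x s))) (at s)"
          by (simp add: o_def)
        from has_vector_derivative_mult[OF q'[OF s'] this] s
        show "(\<Phi> has_vector_derivative \<phi> s) (at s)"
          unfolding \<Phi>_def \<phi>_def r_def by (simp add: algebra_simps)
      qed
      hence "\<Phi> S - \<Phi> t = integral {t..S} \<phi>" "\<phi> integrable_on {t..S}"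
        by (auto simp: integral_unique has_integral_integrable)
      moreover have "norm (integral {t..S} \<phi>) \<le> integral {t..S} \<rho>"
      proof (rule integral_norm_bound_integral)
        show "\<phi> integrable_on {t..S}" by fact
        show "\<rho> integrable_on {t..S}" using t by (intro \<rho>it)
        fix s assume s: "s \<in> {t..S}"
        show "norm (\<phi> s) \<le> \<rho> s"
        proof (cases "s \<in> {t<..<S} - T")
          case True
          have "Re (x t) \<le> Re (x s)" using mono t True by (auto simp: mono_on_def)
          hence "norm (exp (2 * of_real u * (x t - x s))) \<le> 1" using u by (simp add: mult_nonneg_nonpos)
          moreover have "norm (r s) \<le> \<rho> s" using r True t by auto
          ultimately show ?thesis using True \<rho>0[of s]
            by (auto simp: \<phi>_def norm_mult simp del: norm_exp_eq_Re intro: mult_le_one[THEN order_trans] order_trans[OF mult_mono[of _ "\<rho> s" _ 1]])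
        qed (use \<rho>0 in \<open>auto simp: \<phi>_def\<close>)
      qed
      moreover have "norm (\<Phi> S) \<le> \<epsilon> S"
      proof -
        have "Re (x t) \<le> Re (x S)" using mono t by (auto simp: mono_on_def)
        hence "norm (exp (2 * of_real u * (x t - x S))) \<le> 1" using u by (simp add: mult_nonneg_nonpos)
        hence "norm (\<Phi> S) \<le> norm (q S) * 1"
          unfolding \<Phi>_def norm_mult by (intro mult_left_mono) auto
        thus ?thesis by (simp add: \<epsilon>_def)
      qed
      moreover have "\<Phi> t = \<Phi> S - (\<Phi> S - \<Phi> t)" by simp
      hence "norm (\<Phi> t) \<le> norm (\<Phi> S) + norm (\<Phi> S - \<Phi> t)" by (metis norm_triangle_ineq4)
      moreover have "\<Phi> t = q t" by (simp add: \<Phi>_def)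
      ultimately show ?thesis unfolding M_def by simp
    qed
    have eM: "norm (e t - q t) \<le> M t" if t: "0 \<le> t" "t \<le> S" for t
    proof -
      \<comment> \<open>In (e - q)' the terms 2uq cancel, so the same majorant serves without any
        exponential factor.\<close>
      define \<Phi> where "\<Phi> s = e s - q s" for s
      define \<phi> where "\<phi> s = (if s \<in> {t<..<S} - T then - r s else 0)" for s
      have "(\<phi> has_integral \<Phi> S - \<Phi> t) {t..S}"
      proof (rule fundamental_theorem_of_calculus_interior_strong[OF T t(2)])
        show "continuous_on {t..S} \<Phi>"
          unfolding \<Phi>_def using t
          by (intro continuous_intros continuous_on_subset[OF cq] continuous_on_subset[OF ce]) auto
        fix s assume s: "s \<in> {t<..<S} - T"
        hence s': "s > 0" "s \<notin> T" using t by auto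
        from has_vector_derivative_diff[OF e'[OF s'] q'[OF s']] s
        show "(\<Phi> has_vector_derivative \<phi> s) (at s)"
          unfolding \<Phi>_def \<phi>_def r_def by (simp add: algebra_simps)
      qed
      hence "\<Phi> S - \<Phi> t = integral {t..S} \<phi>" "\<phi> integrable_on {t..S}"
        by (auto simp: integral_unique has_integral_integrable)
      moreover have "norm (integral {t..S} \<phi>) \<le> integral {t..S} \<rho>"
      proof (rule integral_norm_bound_integral)
        show "\<phi> integrable_on {t..S}" by fact
        show "\<rho> integrable_on {t..S}" using t by (intro \<rho>it)
        fix s assume s: "s \<in> {t..S}"
        show "norm (\<phi> s) \<le> \<rho> s" using r[of s] \<rho>0[of s] t by (auto simp: \<phi>_def)
      qed
      moreover have "norm (\<Phi> S) \<le> \<epsilon> S" by (simp add: \<epsilon>_def \<Phi>_def)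
      moreover have "\<Phi> t = \<Phi> S - (\<Phi> S - \<Phi> t)" by simp
      hence "norm (\<Phi> t) \<le> norm (\<Phi> S) + norm (\<Phi> S - \<Phi> t)" by (metis norm_triangle_ineq4)
      ultimately show ?thesis unfolding M_def by (simp add: \<Phi>_def)
    qed
    define k where "k t = 2 * \<alpha> t + \<beta> t" for t
    have cM: "continuous_on {0..S} M"
      unfolding M_def by (intro continuous_intros continuous_on_integral_from \<rho>i)
    have k_abs: "k absolutely_integrable_on {0..S}"
      unfolding k_def using \<alpha>S \<beta>S by (intro set_integral_add(1) set_integrable_mult_right) auto
    have kM: "(\<lambda>t. k t * M t) integrable_on {0..S}"
      using integrable_mult_continuous[OF k_abs cM] set_lebesgue_integral_eq_integral(1) by blast
    have ki: "k integrable_on {0..S}"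
      using k_abs set_lebesgue_integral_eq_integral(1) by blast
    \<comment> \<open>Both |q| and |e - q| are below M, hence |e| \<le> 2M; this closes the
      inequality for M.\<close>
    have \<rho>_le: "\<rho> t \<le> k t * M t + \<beta> t / 2" if t: "0 \<le> t" "t \<le> S" for t
    proof -
      have "norm (e t) \<le> norm (q t) + norm (e t - q t)"
        using norm_triangle_ineq[of "q t" "e t - q t"] by simp
      hence "norm (e t) \<le> 2 * M t" using qM[OF t] eM[OF t] by simp
      hence "\<beta> t * (1 + norm (e t)) / 2 \<le> \<beta> t * (1 + 2 * M t) / 2"
        using \<beta>(2)[of t] by (intro divide_right_mono mult_left_mono) auto
      moreover have "2 * (\<alpha> t * norm (q t)) \<le> 2 * (\<alpha> t * M t)"
        using qM[OF t] \<alpha>(2)[of t] by (intro mult_left_mono) auto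
      ultimately show ?thesis by (simp add: \<rho>_def k_def algebra_simps add_divide_distrib)
    qed
    \<comment> \<open>The inhomogeneous part contributes \<Omega>/2 to M; the factor in |e| \<le> 2M
      turns it into \<Omega>.\<close>
    have M0: "M 0 \<le> (\<epsilon> S + \<Omega> / 2) * exp (integral {0..S} k)"
    proof (rule gronwall_piecewise[OF _ cM ki T _ _ kM])
      fix t assume "t \<in> {0<..<S} - T"
      thus "isCont k t" unfolding k_def using \<alpha>(3)[of t] \<beta>(3)[of t] by (intro continuous_intros) auto
    next
      fix t assume "t \<in> {0..S}"
      thus "k t \<ge> 0" using \<alpha>(2)[of t] \<beta>(2)[of t] by (simp add: k_def)
    next
      fix t assume t: "t \<in> {0..S}"
      have kMt: "(\<lambda>t. k t * M t) integrable_on {t..S}" and \<beta>t: "\<beta> integrable_on {t..S}"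
        using integrable_on_subinterval[OF kM, of t S] integrable_on_subinterval[OF \<beta>i, of t S] t by auto
      have "integral {t..S} \<rho> \<le> integral {t..S} (\<lambda>t. k t * M t + \<beta> t / 2)"
        using t \<rho>_le by (intro integral_le \<rho>it integrable_add kMt integrable_on_divide \<beta>t) auto
      also have "\<dots> = integral {t..S} (\<lambda>t. k t * M t) + integral {t..S} \<beta> / 2"
        using kMt \<beta>t by (simp add: integral_add integrable_on_divide)
      also have "integral {t..S} \<beta> \<le> \<Omega>"
        unfolding \<Omega>_def using t \<beta>(2) \<beta>t set_lebesgue_integral_eq_integral(1)[OF \<beta>(1)]
        by (intro integral_subset_le) auto
      finally show "M t \<le> \<epsilon> S + \<Omega> / 2 + integral {t..S} (\<lambda>t. k t * M t)" by (simp add: M_def)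
    qed (use S in auto)
    have "integral {0..S} k = 2 * integral {0..S} \<alpha> + integral {0..S} \<beta>"
      unfolding k_def using \<alpha>i \<beta>i by (simp add: integral_add integrable_on_mult_right)
    also have "\<dots> \<le> 2 * V + \<Omega>"
      unfolding V_def \<Omega>_def using \<alpha>(2) \<beta>(2) \<alpha>i \<beta>i set_lebesgue_integral_eq_integral(1)[OF \<alpha>(1)] set_lebesgue_integral_eq_integral(1)[OF \<beta>(1)]
      by (intro add_mono mult_left_mono integral_subset_le) auto
    finally have kle: "integral {0..S} k \<le> 2 * V + \<Omega>" .
    have \<epsilon>0: "\<epsilon> S \<ge> 0" by (simp add: \<epsilon>_def max_def)
    have \<Omega>0: "\<Omega> \<ge> 0" unfolding \<Omega>_def using \<beta>(2) by (intro integral_nonneg set_lebesgue_integral_eq_integral(1)[OF \<beta>(1)]) auto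
    have "norm (e 0) \<le> norm (q 0) + norm (e 0 - q 0)"
      using norm_triangle_ineq[of "q 0" "e 0 - q 0"] by simp
    also have "\<dots> \<le> 2 * M 0" using qM[of 0] eM[of 0] S by simp
    also have "\<dots> \<le> 2 * ((\<epsilon> S + \<Omega> / 2) * exp (2 * V + \<Omega>))"
      using M0 kle \<epsilon>0 \<Omega>0 by (intro mult_left_mono order_trans[OF M0]) (auto intro!: mult_left_mono)
    finally show ?thesis by (simp add: algebra_simps)
  qed
  have "(\<epsilon> \<longlongrightarrow> max (norm (0::complex)) (norm (0 - 0 :: complex))) at_top"
    unfolding \<epsilon>_def by (intro tendsto_intros q0 e0)
  hence "((\<lambda>S. (2 * \<epsilon> S + \<Omega>) * exp (2 * V + \<Omega>)) \<longlongrightarrow> (2 * 0 + \<Omega>) * exp (2 * V + \<Omega>)) at_top"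
    by (intro tendsto_intros) simp
  moreover have "\<forall>\<^sub>F S in at_top. norm (e 0) \<le> (2 * \<epsilon> S + \<Omega>) * exp (2 * V + \<Omega>)"
    using eventually_gt_at_top[of 0] by eventually_elim (rule main)
  ultimately have "norm (e 0) \<le> (2 * 0 + \<Omega>) * exp (2 * V + \<Omega>)"
    by (rule tendsto_lowerbound) simp
  thus ?thesis by (simp add: V_def \<Omega>_def)
qed

section \<open>The variable \<open>\<xi>\<close> in the cut plane\<close>

definition cut_plane :: "complex set" where
  "cut_plane = {z. 1 + z^2 \<notin> \<real>\<^sub>\<le>\<^sub>0}"

lemma cut_plane_iff: "z \<in> cut_plane \<longleftrightarrow> Re z \<noteq> 0 \<or> \<bar>Im z\<bar> < 1"
proof -
  have "z \<notin> cut_plane \<longleftrightarrow> Re z * Im z = 0 \<and> 1 + (Re z)^2 - (Im z)^2 \<le> 0"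
    by (auto simp: cut_plane_def complex_nonpos_Reals_iff power2_eq_square)
  also have "\<dots> \<longleftrightarrow> Re z = 0 \<and> \<bar>Im z\<bar> \<ge> 1"
  proof (cases "Re z = 0")
    case True
    thus ?thesis using abs_le_square_iff[of 1 "Im z"] by simp
  next
    case False
    have "1 + (Re z)^2 > 0" by (rule add_pos_nonneg) auto
    thus ?thesis using False by auto
  qed
  finally show ?thesis by auto
qed

definition xsqrt :: "complex \<Rightarrow> complex" where "xsqrt z = csqrt (1 + z^2)"

lemma xsqrt_square: "xsqrt z ^ 2 = 1 + z^2" by (simp add: xsqrt_def)

lemma Re_xsqrt_nonneg: "Re (xsqrt z) \<ge> 0" unfolding xsqrt_def by (rule Re_csqrt)

lemma Re_xsqrt_pos:
  assumes "z \<in> cut_plane"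
  shows "Re (xsqrt z) > 0"
proof (rule ccontr)
  assume "\<not> Re (xsqrt z) > 0"
  hence "Re (xsqrt z) = 0" using Re_xsqrt_nonneg[of z] by simp
  hence "xsqrt z ^ 2 \<in> \<real>\<^sub>\<le>\<^sub>0" by (simp add: complex_nonpos_Reals_iff power2_eq_square)
  thus False using assms by (simp add: xsqrt_square cut_plane_def)
qed

text \<open>For z = sinh w with xsqrt z = cosh w the factors are exp w and exp(-w).\<close>

lemma xsqrt_mult: "(z + xsqrt z) * (xsqrt z - z) = 1"
  using xsqrt_square[of z] by (simp add: algebra_simps power2_eq_square)

lemma add_xsqrt_nonzero: "z + xsqrt z \<noteq> 0"
  using xsqrt_mult[of z] by auto

text \<open>If z + xsqrt z were a negative number r, its reciprocal would be xsqrt z - z, and half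
  their sum, which is xsqrt z, would have negative real part. Thus the logarithm in the closed form
  of \<xi> brings no cut of its own.\<close>

lemma add_xsqrt_notin: "z + xsqrt z \<notin> \<real>\<^sub>\<le>\<^sub>0"
proof
  assume "z + xsqrt z \<in> \<real>\<^sub>\<le>\<^sub>0"
  then obtain r where r: "z + xsqrt z = of_real r" "r \<le> 0"
    by (auto elim!: nonpos_Reals_cases)
  hence "r < 0" using add_xsqrt_nonzero[of z] by (cases "r = 0") auto
  have "xsqrt z - z = of_real (1 / r)"
    using xsqrt_mult[of z] r \<open>r < 0\<close> by (simp add: field_simps)
  hence "Re (xsqrt z) - Re z = 1 / r" by (metis Re_complex_of_real minus_complex.sel(1))
  moreover have "Re z + Re (xsqrt z) = r" using r by (metis Re_complex_of_real plus_complex.sel(1))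
  ultimately have "2 * Re (xsqrt z) = r + 1 / r" by linarith
  moreover have "r + 1 / r < 0" using \<open>r < 0\<close> by (simp add: add_neg_neg)
  ultimately show False using Re_xsqrt_nonneg[of z] by simp
qed

lemma xsqrt_has_field_derivative:
  assumes "z \<in> cut_plane"
  shows "(xsqrt has_field_derivative z / xsqrt z) (at z)"
proof -
  have "1 + z^2 \<notin> \<real>\<^sub>\<le>\<^sub>0" using assms by (simp add: cut_plane_def)
  moreover have "((\<lambda>z. 1 + z^2) has_field_derivative 2 * z) (at z)"
    by (auto intro!: derivative_eq_intros)
  ultimately have "((\<lambda>z. csqrt (1 + z^2)) has_field_derivative (2 * z) / (2 * csqrt (1 + z^2))) (at z)"
    by (intro has_field_derivative_csqrt')
  thus ?thesis by (simp add: xsqrt_def [abs_def])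
qed

definition xibar_closed :: "complex \<Rightarrow> complex" where
  "xibar_closed z = (z * xsqrt z + Ln (z + xsqrt z)) / 2"

lemma xibar_closed_has_field_derivative:
  assumes "z \<in> cut_plane"
  shows "(xibar_closed has_field_derivative xsqrt z) (at z)"
proof -
  have s0: "xsqrt z \<noteq> 0" using Re_xsqrt_pos[OF assms] by auto
  have 1: "((\<lambda>z. z + xsqrt z) has_field_derivative (1 + z / xsqrt z)) (at z)"
    by (auto intro!: derivative_eq_intros xsqrt_has_field_derivative assms)
  have "((\<lambda>z. Ln (z + xsqrt z)) has_field_derivative (inverse (z + xsqrt z) * (1 + z / xsqrt z))) (at z)"
    by (rule DERIV_chain2[OF has_field_derivative_Ln[OF add_xsqrt_notin] 1])
  moreover have "inverse (z + xsqrt z) * (1 + z / xsqrt z) = 1 / xsqrt z"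
    using s0 add_xsqrt_nonzero[of z] by (simp add: field_simps)
  ultimately have 2: "((\<lambda>z. Ln (z + xsqrt z)) has_field_derivative 1 / xsqrt z) (at z)" by simp
  have "(xibar_closed has_field_derivative (1 * xsqrt z + z / xsqrt z * z + 1 / xsqrt z) / 2) (at z)"
    unfolding xibar_closed_def
    by (intro DERIV_cdivide DERIV_add DERIV_mult xsqrt_has_field_derivative assms 2 DERIV_ident)
  moreover have "z / xsqrt z * z + 1 / xsqrt z = xsqrt z"
    using s0 xsqrt_square[of z] by (simp add: field_simps power2_eq_square)
  ultimately show ?thesis by (simp add: add.assoc)
qed

lemma xibar_eq:
  assumes "z \<in> cut_plane"
  shows "xibar z = xibar_closed z"
proof -
  have seg: "closed_segment 0 z \<subseteq> cut_plane"
  proof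
    fix w assume "w \<in> closed_segment 0 z"
    then obtain t where t: "0 \<le> t" "t \<le> 1" "w = of_real t * z"
      by (auto simp: closed_segment_def scaleR_conv_of_real)
    show "w \<in> cut_plane"
    proof (cases "Re z = 0")
      case True
      hence "\<bar>Im z\<bar> < 1" using assms by (simp add: cut_plane_iff)
      hence "t * \<bar>Im z\<bar> < 1" using t by (smt (verit) mult_left_le_one_le mult_nonneg_nonneg abs_ge_zero)
      thus ?thesis using t by (simp add: cut_plane_iff abs_mult)
    next
      case False
      show ?thesis using False t by (cases "t = 0") (auto simp: cut_plane_iff)
    qed
  qed
  have "((\<lambda>t. csqrt (t^2 + 1)) has_contour_integral (xibar_closed (pathfinish (linepath 0 z)) - xibar_closed (pathstart (linepath 0 z)))) (linepath 0 z)"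
  proof (rule contour_integral_primitive[where S = cut_plane])
    fix x assume "x \<in> cut_plane"
    thus "(xibar_closed has_field_derivative csqrt (x^2 + 1)) (at x within cut_plane)"
      using xibar_closed_has_field_derivative[of x] by (auto simp: xsqrt_def add.commute intro: has_field_derivative_at_within)
  qed (use seg in \<open>simp_all only: valid_path_linepath path_image_linepath\<close>)
  moreover have "xibar_closed 0 = 0" by (simp add: xibar_closed_def xsqrt_def)
  ultimately show ?thesis unfolding xibar_def by (simp add: contour_integral_unique)
qed

text \<open>The two points are the ends of the cuts and lie outside \<open>cut_plane\<close>; but on
  the segment from 0 the integrand is real and dz is imaginary.\<close>

lemma Re_xibar_branch_points: "Re (xibar \<i>) = 0" "Re (xibar (-\<i>)) = 0"
proof -
  have "Re (xibar (of_real c * \<i>)) = 0" if "\<bar>c\<bar> = 1" for c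
  proof -
    have eq: "xibar (of_real c * \<i>) = integral {0..1} (\<lambda>x. csqrt ((linepath 0 (of_real c * \<i>) x)^2 + 1) * (of_real c * \<i>))"
      by (simp add: xibar_def contour_integral_integral)
    have "csqrt ((linepath 0 (of_real c * \<i>) x)^2 + 1) * (of_real c * \<i>) = of_real (sqrt (1 - x^2) * c) * \<i>" if "x \<in> {0..1}" for x
    proof -
      have c2: "c^2 = 1" using \<open>\<bar>c\<bar> = 1\<close> by (metis one_power2 power2_abs)
      have 1: "(linepath 0 (of_real c * \<i>) x)^2 + 1 = of_real (1 - x^2)"
      proof -
        have "(linepath 0 (of_real c * \<i>) x)^2 = of_real (x^2 * c^2) * \<i>^2"
          unfolding linepath_def by (simp add: scaleR_conv_of_real power_mult_distrib)
        thus ?thesis unfolding c2 by simp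
      qed
      have "csqrt (of_real (1 - x^2)) = of_real (sqrt (1 - x^2))"
        using that by (intro of_real_sqrt [symmetric]) (simp add: power_le_one)
      thus ?thesis unfolding 1 by simp
    qed
    hence eq: "xibar (of_real c * \<i>) = integral {0..1} (\<lambda>x. of_real (sqrt (1 - x^2) * c) * \<i>)"
      unfolding eq by (intro integral_cong) auto
    have int: "(\<lambda>x. sqrt (1 - x^2) * c) integrable_on {0..1}"
      by (intro integrable_continuous_real continuous_intros)
    have "((\<lambda>x. of_real (sqrt (1 - x^2) * c) * \<i>) has_integral (of_real (integral {0..1} (\<lambda>x. sqrt (1 - x^2) * c)) * \<i>)) {0..1}"
      by (intro has_integral_mult_left has_integral_of_real integrable_integral int)
    from integral_unique[OF this] show ?thesis unfolding eq by (simp only:) simp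
  qed
  from this[of 1] this[of "-1"] show "Re (xibar \<i>) = 0" "Re (xibar (-\<i>)) = 0" by simp_all
qed

text \<open>The two numbers have product 1, and z + xsqrt z is the larger in modulus because the
  real parts of z and xsqrt z, and likewise their imaginary parts, have nonnegative product: Re
  (xsqrt z) Im (xsqrt z) = Re z Im z.\<close>

lemma xsqrt_bounds_right:
  assumes "Re z > 0"
  shows "norm (xsqrt z - z) \<le> 1" "norm (z + xsqrt z) \<ge> 1"
proof -
  have c: "z \<in> cut_plane" using assms by (simp add: cut_plane_iff)
  have "Im (xsqrt z ^ 2) = Im (z^2)" by (simp add: xsqrt_square)
  hence im: "Re (xsqrt z) * Im (xsqrt z) = Re z * Im z" by (simp add: power2_eq_square mult.commute)
  have "Im (xsqrt z) * Im z \<ge> 0"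
  proof -
    have "Re (xsqrt z) * (Im (xsqrt z) * Im z) = Re z * (Im z * Im z)" using im by (simp add: mult.assoc)
    moreover have "Re z * (Im z * Im z) \<ge> 0" using assms by simp
    ultimately show ?thesis using Re_xsqrt_pos[OF c] by (metis zero_le_mult_iff not_le)
  qed
  moreover have "Re (xsqrt z) * Re z \<ge> 0" using assms Re_xsqrt_nonneg[of z] by simp
  moreover have "norm (z + xsqrt z) ^ 2 - norm (xsqrt z - z) ^ 2 = 4 * (Re (xsqrt z) * Re z + Im (xsqrt z) * Im z)"
    unfolding cmod_power2 by (simp add: power2_eq_square algebra_simps)
  ultimately have "norm (z + xsqrt z) ^ 2 - norm (xsqrt z - z) ^ 2 \<ge> 0" by simp
  hence "norm (xsqrt z - z) ^ 2 \<le> norm (z + xsqrt z) ^ 2" by simp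
  hence le: "norm (xsqrt z - z) \<le> norm (z + xsqrt z)" by (rule power2_le_imp_le) simp
  have prod: "norm (z + xsqrt z) * norm (xsqrt z - z) = 1"
    using xsqrt_mult[of z] by (metis norm_mult norm_one)
  show "norm (xsqrt z - z) \<le> 1"
  proof (rule ccontr)
    assume "\<not> ?thesis"
    hence "norm (xsqrt z - z) > 1" by simp
    hence "norm (z + xsqrt z) * norm (xsqrt z - z) > 1 * 1" using le by (intro mult_strict_mono) auto
    thus False using prod by simp
  qed
  thus "norm (z + xsqrt z) \<ge> 1" using prod by (metis mult.commute mult_left_le_one_le norm_ge_zero mult_1 order_trans linear mult_left_mono)
qed

lemma Ln_diff_Re_pos:
  assumes "Re a > 0" "Re b > 0"
  shows "Ln a - Ln b = Ln (a / b)"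
proof -
  have ab: "a \<noteq> 0" "b \<noteq> 0" using assms by auto
  have "\<bar>Im (Ln a)\<bar> < pi / 2" "\<bar>Im (Ln b)\<bar> < pi / 2"
    using assms ab Re_Ln_pos_lt by blast+
  hence "- pi < Im (Ln a - Ln b)" "Im (Ln a - Ln b) \<le> pi"
    unfolding abs_less_iff minus_complex.sel by linarith+
  moreover have "exp (Ln a - Ln b) = a / b" using ab by (simp add: exp_diff)
  ultimately show ?thesis by (metis Ln_exp)
qed

text \<open>As Re (xsqrt z) > 0, twice its logarithm stays in the principal strip; hence the
  principal quartic root of 1 + z^2 is the principal square root of xsqrt z.\<close>

lemma principal_quartic_root:
  assumes "z \<in> cut_plane"
  shows "(1 + z^2) powr (1/4) = exp (Ln (xsqrt z) / 2)" "((1 + z^2) powr (1/4))^2 = xsqrt z"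
proof -
  have s: "Re (xsqrt z) > 0" "xsqrt z \<noteq> 0" using Re_xsqrt_pos[OF assms] by auto
  hence "\<bar>Im (Ln (xsqrt z))\<bar> < pi / 2" using Re_Ln_pos_lt by blast
  hence "- pi < Im (2 * Ln (xsqrt z))" "Im (2 * Ln (xsqrt z)) \<le> pi"
    unfolding abs_less_iff by auto
  moreover have "exp (2 * Ln (xsqrt z)) = 1 + z^2"
    using s by (simp add: exp_double xsqrt_square)
  ultimately have "Ln (1 + z^2) = 2 * Ln (xsqrt z)" by (metis Ln_exp)
  moreover have "1 + z^2 \<noteq> 0" using assms by (auto simp: cut_plane_def)
  ultimately show 1: "(1 + z^2) powr (1/4) = exp (Ln (xsqrt z) / 2)"
    by (simp add: powr_def)
  show "((1 + z^2) powr (1/4))^2 = xsqrt z"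
    unfolding 1 using s by (simp add: power2_eq_square flip: exp_add)
qed

section \<open>Chains of arcs\<close>

text \<open>Phrased with \<open>vector_derivative\<close>, as the admissibility condition is; for a
  chain it holds off the finitely many joints.\<close>

definition nice_at :: "(real \<Rightarrow> complex) \<Rightarrow> real \<Rightarrow> bool" where
  "nice_at \<gamma> t \<longleftrightarrow> (\<gamma> has_vector_derivative vector_derivative \<gamma> (at t)) (at t) \<and>
     isCont (\<lambda>s. vector_derivative \<gamma> (at s)) t \<and> vector_derivative \<gamma> (at t) \<noteq> 0"

lemma R2_arc_on_nice_at:
  assumes "R2_arc_on I \<gamma>" "t \<in> interior I"
  shows "nice_at \<gamma> t"
proof -
  obtain \<gamma>' \<gamma>'' where 
    d: "\<And>t. t \<in> I \<Longrightarrow> (\<gamma> has_vector_derivative \<gamma>' t) (at t within I)" "\<And>t. t \<in> I \<Longrightarrow> \<gamma>' t \<noteq> 0"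
       "\<And>t. t \<in> I \<Longrightarrow> (\<gamma>' has_vector_derivative \<gamma>'' t) (at t within I)"
    using assms(1) unfolding R2_arc_on_def by blast
  have int: "s \<in> I \<and> at s within I = at s" if "s \<in> interior I" for s
    using that at_within_interior interior_subset by blast
  have vd: "vector_derivative \<gamma> (at s) = \<gamma>' s" if "s \<in> interior I" for s
    using d(1)[of s] int[OF that] by (auto intro: vector_derivative_at)
  have "(\<gamma>' has_vector_derivative \<gamma>'' t) (at t)" using d(3)[of t] int[OF assms(2)] by auto
  hence "isCont \<gamma>' t" by (rule has_vector_derivative_continuous)
  have ev: "\<forall>\<^sub>F s in nhds t. \<gamma>' s = vector_derivative \<gamma> (at s)"
    using vd assms(2) eventually_nhds_in_open[of "interior I" t] by (auto elim!: eventually_mono)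
  have "isCont (\<lambda>s. vector_derivative \<gamma> (at s)) t"
    using isCont_cong[OF ev] \<open>isCont \<gamma>' t\<close> by simp
  thus ?thesis using vd[OF assms(2)] d(1,2)[of t] int[OF assms(2)] by (auto simp: nice_at_def)
qed

lemma R2_arc_on_continuous: "R2_arc_on I \<gamma> \<Longrightarrow> continuous_on I \<gamma>"
  unfolding R2_arc_on_def continuous_on_eq_continuous_within
  using has_vector_derivative_continuous by blast

lemma R2_chain_nice:
  assumes "R2_chain \<gamma>"
  shows "continuous_on {0..} \<gamma>" "\<exists>T. finite T \<and> (\<forall>t>0. t \<notin> T \<longrightarrow> nice_at \<gamma> t)"
proof -
  obtain m and \<tau> :: "nat \<Rightarrow> real" where \<tau>: "\<tau> 0 = 0" "\<And>i. i < m \<Longrightarrow> \<tau> i < \<tau> (Suc i)"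
    "\<And>i. i < m \<Longrightarrow> R2_arc_on {\<tau> i..\<tau> (Suc i)} \<gamma>" "R2_arc_on {\<tau> m..} \<gamma>"
    using assms unfolding R2_chain_def by blast
  have ge: "\<tau> i \<ge> 0" if "i \<le> m" for i
    using that
  proof (induction i)
    case (Suc i)
    thus ?case using \<tau>(2)[of i] by simp
  qed (use \<tau> in auto)
  have cov: "t \<ge> \<tau> i \<or> (\<exists>j<i. t \<in> {\<tau> j..<\<tau> (Suc j)})" if "t \<ge> 0" "i \<le> m" for t i
    using that(2)
  proof (induction i)
    case (Suc i)
    thus ?case by (cases "t < \<tau> (Suc i)") (auto simp: less_Suc_eq)
  qed (use \<tau> that in auto)
  have cont: "continuous_on {0..\<tau> i} \<gamma>" if "i \<le> m" for i
    using that
  proof (induction i)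
    case 0
    thus ?case using \<tau> by (simp add: continuous_on_sing)
  next
    case (Suc i)
    have "continuous_on ({0..\<tau> i} \<union> {\<tau> i..\<tau> (Suc i)}) \<gamma>"
      using Suc R2_arc_on_continuous[OF \<tau>(3)[of i]] by (intro continuous_on_closed_Un) auto
    moreover have "{0..\<tau> i} \<union> {\<tau> i..\<tau> (Suc i)} = {0..\<tau> (Suc i)}"
      using ge[of i] \<tau>(2)[of i] Suc.prems by auto
    ultimately show ?case by simp
  qed
  have "continuous_on ({0..\<tau> m} \<union> {\<tau> m..}) \<gamma>"
    using cont[of m] R2_arc_on_continuous[OF \<tau>(4)] by (intro continuous_on_closed_Un) auto
  moreover have "{0..\<tau> m} \<union> {\<tau> m..} = {0..}" using ge[of m] by auto
  ultimately show "continuous_on {0..} \<gamma>" by simp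
  show "\<exists>T. finite T \<and> (\<forall>t>0. t \<notin> T \<longrightarrow> nice_at \<gamma> t)"
  proof (intro exI[of _ "\<tau> ` {..m}"] conjI allI impI)
    fix t :: real assume t: "t > 0" "t \<notin> \<tau> ` {..m}"
    from cov[of t m] t consider "t \<ge> \<tau> m" | j where "j < m" "t \<in> {\<tau> j..<\<tau> (Suc j)}" by auto
    thus "nice_at \<gamma> t"
    proof cases
      case 1
      hence "t > \<tau> m" using t by (cases "t = \<tau> m") auto
      thus ?thesis by (intro R2_arc_on_nice_at[OF \<tau>(4)]) (simp add: interior_real_atLeast)
    next
      case 2
      hence "t > \<tau> j" using t by (cases "t = \<tau> j") auto
      thus ?thesis using 2 by (intro R2_arc_on_nice_at[OF \<tau>(3)[OF 2(1)]]) auto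
    qed
  qed auto
qed

lemma powr_quarter_power:
  fixes r :: complex
  assumes "r \<noteq> 0" "\<bar>Arg r\<bar> < pi / 4"
  shows "(r ^ 4) powr (1/4) = r"
proof -
  have "Ln (r ^ 4) = 4 * Ln r"
  proof -
    have "\<bar>Im (Ln r)\<bar> < pi / 4" using assms Arg_eq_Im_Ln by simp
    hence "- pi < Im (4 * Ln r)" "Im (4 * Ln r) \<le> pi" unfolding abs_less_iff by auto
    moreover have "exp (4 * Ln r) = r ^ 4"
      using assms by (simp add: exp_of_nat_mult[of 4, simplified])
    ultimately show ?thesis by (metis Ln_exp)
  qed
  thus ?thesis using assms by (simp add: powr_def)
qed

text \<open>Near t the quotient Q s / Q t is close to 1, so it is the principal quartic root of R s
  / R t, and that is differentiable.\<close>

lemma continuous_root4_has_vector_derivative: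
  fixes Q R :: "real \<Rightarrow> complex"
  assumes Q: "isCont Q t" "Q t \<noteq> 0" and R: "(R has_vector_derivative R') (at t)"
    and QR: "\<forall>\<^sub>F s in nhds t. Q s ^ 4 = R s"
  shows "(Q has_vector_derivative R' / (4 * Q t ^ 3)) (at t)"
proof -
  have Rt: "R t = Q t ^ 4" using eventually_nhds_x_imp_x[OF QR] by simp
  define r where "r s = Q s / Q t" for s
  have r: "isCont r t" "r t = 1" unfolding r_def using Q by (auto intro!: continuous_intros)
  have "isCont (\<lambda>s. Arg (r s)) t"
    using r by (intro isCont_o2[OF r(1)] continuous_at_Arg) auto
  hence "((\<lambda>s. Arg (r s)) \<longlongrightarrow> Arg (r t)) (nhds t)"
    unfolding isCont_def tendsto_at_iff_tendsto_nhds[of "\<lambda>s. Arg (r s)"] .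
  hence "((\<lambda>s. Arg (r s)) \<longlongrightarrow> 0) (nhds t)" using r(2) by simp
  from tendstoD[OF this, of "pi / 4"] have 1: "\<forall>\<^sub>F s in nhds t. \<bar>Arg (r s)\<bar> < pi / 4"
    by (simp add: dist_real_def)
  have "(r \<longlongrightarrow> r t) (nhds t)" using r(1) unfolding isCont_def tendsto_at_iff_tendsto_nhds[of r] .
  hence "(r \<longlongrightarrow> 1) (nhds t)" using r(2) by simp
  hence 2: "\<forall>\<^sub>F s in nhds t. r s \<noteq> 0" by (rule tendsto_imp_eventually_ne) simp
  have ev: "\<forall>\<^sub>F s in nhds t. Q t * (R s / R t) powr (1/4) = Q s"
    using 1 2 QR
  proof eventually_elim
    case (elim s)
    have "R s / R t = r s ^ 4" using elim Rt by (simp add: r_def power_divide)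
    hence "(R s / R t) powr (1/4) = r s" using powr_quarter_power[of "r s"] elim by simp
    thus ?case using Q by (simp add: r_def)
  qed
  have "((\<lambda>s. Q t * (R s / R t) powr (1/4)) has_vector_derivative (R' / R t) * (1/4) * Q t) (at t)"
  proof -
    have "((\<lambda>w. w powr (1/4)) has_field_derivative (1/4 :: complex)) (at (R t / R t))"
      using Q Rt has_field_derivative_powr[of "1::complex" "1/4"] by simp
    moreover have "((\<lambda>s. R s / R t) has_vector_derivative R' / R t) (at t)"
      using has_vector_derivative_divide[OF R] by simp
    ultimately have "((\<lambda>w. w powr (1/4)) \<circ> (\<lambda>s. R s / R t) has_vector_derivative (R' / R t) * (1/4)) (at t)"
      by (intro field_vector_diff_chain_at)
    from has_vector_derivative_mult_right[OF this, of "Q t"] show ?thesis by (simp add: o_def mult.commute)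
  qed
  moreover have "(R' / R t) * (1/4) * Q t = R' / (4 * Q t ^ 3)"
    using Q Rt by (simp add: field_simps power4_eq_xxxx power3_eq_cube)
  ultimately have "((\<lambda>s. Q t * (R s / R t) powr (1/4)) has_vector_derivative R' / (4 * Q t ^ 3)) (at t)" by simp
  moreover obtain S where S: "open S" "t \<in> S" "\<And>s. s \<in> S \<Longrightarrow> Q t * (R s / R t) powr (1/4) = Q s"
    using ev unfolding eventually_nhds by blast
  ultimately show ?thesis by (auto intro: has_vector_derivative_transform_within_open)
qed

section \<open>Asymptotics in the right half plane\<close>

text \<open>The bound |xsqrt z - z| \<le> 1 holds in the whole open half plane, so the limit is
  uniform up to the imaginary directions.\<close>

lemma xsqrt_div_tendsto_1:
  "((\<lambda>z. xsqrt z / z) \<longlongrightarrow> 1) (inf at_infinity (principal {z. Re z > 0}))"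
proof -
  let ?F = "inf at_infinity (principal {z::complex. Re z > 0})"
  have "((\<lambda>z. (xsqrt z - z) / z) \<longlongrightarrow> 0) ?F"
  proof (rule Lim_null_comparison)
    show "\<forall>\<^sub>F z in ?F. norm ((xsqrt z - z) / z) \<le> norm (inverse z)"
      unfolding eventually_inf_principal
      by (rule always_eventually) (auto simp: norm_divide norm_inverse divide_simps intro: xsqrt_bounds_right)
    show "((\<lambda>z. norm (inverse z :: complex)) \<longlongrightarrow> 0) ?F"
      by (rule filterlim_mono[OF tendsto_norm_zero[OF tendsto_inverse_0] order.refl]) simp
  qed
  hence "((\<lambda>z. 1 + (xsqrt z - z) / z) \<longlongrightarrow> 1 + 0) ?F" by (intro tendsto_intros)
  moreover have "\<forall>\<^sub>F z in ?F. 1 + (xsqrt z - z) / z = xsqrt z / z"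
    unfolding eventually_inf_principal by (rule always_eventually) (auto simp: diff_divide_distrib)
  ultimately show ?thesis by (simp add: Lim_transform_eventually)
qed

text \<open>Far out in the right half plane the leading term of \<open>U\<close> is the leading term of the
  exponential ansatz; the constant \<open>(2e/u)\<^bsup>u/4\<^esup>\<close> comes from \<open>\<xi> = z\<^sup>2/2 + ln(2z)/2 + 1/4 + o(1)\<close>.\<close>

definition LG_prefactor :: "real \<Rightarrow> complex" where
  "LG_prefactor u = of_real ((2 * u) powr (1/4) * (2 * exp 1 / u) powr (- (u / 4)))"

lemma leading_term_tendsto_1:
  fixes u :: real
  assumes u: "u > 0"
  shows "((\<lambda>z. LG_prefactor u * pcfU (of_real (u/2)) (of_real (sqrt (2*u)) * z) * (1 + z^2) powr (1/4) * exp (of_real u * xibar z))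
     \<longlongrightarrow> 1) (inf at_infinity (principal {z. Re z > 0}))"
proof -
  let ?F = "inf at_infinity (principal {z::complex. Re z > 0})"
  define k where "k = sqrt (2 * u)"
  have k: "k > 0" "k^2 = 2 * u" using u by (simp_all add: k_def)
  define D where "D z = z powr (- of_real (u/2) - 1/2) * exp (- (z^2) / 4)" for z :: complex
  have "((\<lambda>z. pcfU (of_real (u/2)) z / D z) \<longlongrightarrow> 1) ?F"
    unfolding D_def using pcfU_asymp_halfplane[of "u/2"] u by simp
  moreover have "filterlim (\<lambda>z. of_real k * z) ?F ?F"
  proof (subst filterlim_inf, intro conjI)
    have "filterlim (\<lambda>z::complex. of_real k * z) at_infinity at_infinity"
      using k by (intro tendsto_mult_filterlim_at_infinity[OF tendsto_const] filterlim_ident) auto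
    thus "filterlim (\<lambda>z::complex. of_real k * z) at_infinity ?F"
      by (rule filterlim_mono) auto
    show "filterlim (\<lambda>z::complex. of_real k * z) (principal {z. Re z > 0}) ?F"
      using k by (auto simp: filterlim_principal eventually_inf_principal)
  qed
  ultimately have 1: "((\<lambda>z. pcfU (of_real (u/2)) (of_real k * z) / D (of_real k * z)) \<longlongrightarrow> 1) ?F"
    by (rule filterlim_compose)
  define r where "r z = xsqrt z / z" for z
  have r: "(r \<longlongrightarrow> 1) ?F" unfolding r_def by (rule xsqrt_div_tendsto_1)
  \<comment> \<open>All dependence on z is through r, by the identity 1/(1 + r) = z xsqrt z - z^2;
    so the limit is found by putting r = 1.\<close>
  define G where "G z = LG_prefactor u * of_real ((2*u) powr (- (u/4) - 1/4)) * exp (of_real (u/2) * (1 / (1 + r z))) * exp (Ln (r z) / 2) *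
      exp (of_real (u/2) * Ln (1 + r z))" for z
  have "(G \<longlongrightarrow> LG_prefactor u * of_real ((2*u) powr (- (u/4) - 1/4)) * exp (of_real (u/2) * (1 / (1 + 1))) * exp (Ln 1 / 2) *
      exp (of_real (u/2) * Ln (1 + 1))) ?F"
    unfolding G_def by (intro tendsto_intros r) auto
  also have "LG_prefactor u * of_real ((2*u) powr (- (u/4) - 1/4)) * exp (of_real (u/2) * (1 / (1 + 1))) * exp (Ln 1 / 2) *
      exp (of_real (u/2) * Ln (1 + 1)) = 1"
  proof -
    have "Ln (1 + 1 :: complex) = of_real (ln 2)" using Ln_of_real[of 2] by simp
    hence "LG_prefactor u * of_real ((2*u) powr (- (u/4) - 1/4)) * exp (of_real (u/2) * (1 / (1 + 1))) * exp (Ln 1 / 2) *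
      exp (of_real (u/2) * Ln (1 + 1)) =
      of_real ((2 * u) powr (1/4) * (2 * exp 1 / u) powr (- (u / 4)) * (2*u) powr (- (u/4) - 1/4) * exp (u/4) * exp (u/2 * ln 2))"
      by (simp add: LG_prefactor_def flip: exp_of_real)
    also have "(2 * u) powr (1/4) * (2 * exp 1 / u) powr (- (u / 4)) * (2*u) powr (- (u/4) - 1/4) * exp (u/4) * exp (u/2 * ln 2) = 1"
      using u by (simp add: powr_def ln_mult ln_div field_simps flip: exp_add)
    finally show ?thesis by simp
  qed
  finally have G: "(G \<longlongrightarrow> 1) ?F" .
  have "((\<lambda>z. pcfU (of_real (u/2)) (of_real k * z) / D (of_real k * z) * G z) \<longlongrightarrow> 1 * 1) ?F"
    by (intro tendsto_mult 1 G)
  moreover have "\<forall>\<^sub>F z in ?F. pcfU (of_real (u/2)) (of_real k * z) / D (of_real k * z) * G z =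
     LG_prefactor u * pcfU (of_real (u/2)) (of_real (sqrt (2*u)) * z) * (1 + z^2) powr (1/4) * exp (of_real u * xibar z)"
    unfolding eventually_inf_principal
  proof (rule always_eventually, intro allI impI)
    fix z :: complex assume "z \<in> {z. Re z > 0}"
    hence z: "Re z > 0" by simp
    hence c: "z \<in> cut_plane" and z0: "z \<noteq> 0" by (auto simp: cut_plane_iff)
    let ?s = "xsqrt z"
    have s: "Re ?s > 0" "?s \<noteq> 0" using Re_xsqrt_pos[OF c] by auto
    have zs: "Re (z + ?s) > 0" using z s by simp
    have Lr: "Ln (r z) = Ln ?s - Ln z" unfolding r_def using Ln_diff_Re_pos[OF s(1) z] by simp
    have "1 + r z = (z + ?s) / z" using z0 by (simp add: r_def field_simps)
    hence L1r: "Ln (1 + r z) = Ln (z + ?s) - Ln z" using Ln_diff_Re_pos[OF zs z] by simp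
    have "1 / (1 + r z) = z / (z + ?s)" using z0 add_xsqrt_nonzero[of z] by (simp add: r_def field_simps)
    also have "\<dots> = z * (?s - z)" using xsqrt_mult[of z] add_xsqrt_nonzero[of z] by (simp add: field_simps)
    also have "\<dots> = z * ?s - z^2" by (simp add: power2_eq_square algebra_simps)
    finally have inv: "1 / (1 + r z) = z * ?s - z^2" .
    have kz: "Ln (of_real k * z) = of_real (ln k) + Ln z"
      using Ln_times_of_real[of k z] k z0 Ln_of_real[of k] by simp
    have D: "D (of_real k * z) = exp ((- of_real (u/2) - 1/2) * (of_real (ln k) + Ln z)) * exp (- of_real u * z^2 / 2)"
    proof -
      have "of_real k ^ 2 = (2 * of_real u :: complex)" using k by (metis of_real_power of_real_mult of_real_numeral)
      thus ?thesis unfolding D_def using k z0 kz by (simp add: powr_def power_mult_distrib)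
    qed
    have "(2*u) powr (- (u/4) - 1/4) = exp ((- (u/2) - 1/2) * ln k)"
      using u by (simp add: powr_def k_def ln_sqrt field_simps)
    hence p: "complex_of_real ((2*u) powr (- (u/4) - 1/4)) = exp (of_real ((- (u/2) - 1/2) * ln k))"
      by (simp only: exp_of_real)
    have xi: "xibar z = (z * ?s + Ln (z + ?s)) / 2" using xibar_eq[OF c] by (simp add: xibar_closed_def)
    have exps: "c * exp x1 * exp x2 * exp x3 * exp x4 / (exp x5 * exp x6) = c * exp y1 * exp y2"
      if "x1 + x2 + x3 + x4 - (x5 + x6) = y1 + y2" for c x1 x2 x3 x4 x5 x6 y1 y2 :: complex
    proof -
      have "c * exp x1 * exp x2 * exp x3 * exp x4 / (exp x5 * exp x6) = c * exp (x1 + x2 + x3 + x4 - (x5 + x6))"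
        by (simp add: exp_add exp_diff)
      thus ?thesis unfolding that by (simp add: exp_add)
    qed
    have "G z / D (of_real k * z) = LG_prefactor u * (1 + z^2) powr (1/4) * exp (of_real u * xibar z)"
      unfolding G_def D p inv principal_quartic_root(1)[OF c] xi
      by (rule exps) (simp add: Lr L1r field_simps)
    moreover have "pcfU (of_real (u/2)) (of_real k * z) / D (of_real k * z) * G z =
      pcfU (of_real (u/2)) (of_real k * z) * (G z / D (of_real k * z))" by simp
    ultimately show "pcfU (of_real (u/2)) (of_real k * z) / D (of_real k * z) * G z =
     LG_prefactor u * pcfU (of_real (u/2)) (of_real (sqrt (2*u)) * z) * (1 + z^2) powr (1/4) * exp (of_real u * xibar z)"
      by (simp only: k_def mult.assoc mult.left_commute)
  qed
  ultimately show ?thesis by (simp add: Lim_transform_eventually)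
qed

lemma Ebar_arg_tendsto:
  "((\<lambda>z. z / xsqrt z) \<longlongrightarrow> 1) (inf at_infinity (principal {z. Re z > 0}))"
  using tendsto_inverse[OF xsqrt_div_tendsto_1] by (simp add: inverse_eq_divide)

section \<open>The ratio of U to its approximation on the principal sheet\<close>

definition LG_correction :: "nat \<Rightarrow> real \<Rightarrow> complex \<Rightarrow> complex" where
  "LG_correction n u b = (\<Sum>s\<in>{1..<n}. (Ebar s b - Ebar s 1) / (- of_real u) ^ s)"

lemma LG_correction_alt:
  "LG_correction n u b = (\<Sum>s\<in>{1..<n}. (-1)^s * (Ebar s b - Ebar s 1) / of_real u ^ s)"
  unfolding LG_correction_def
proof (intro sum.cong refl)
  fix s
  have "(- complex_of_real u) ^ s = (-1) ^ s * of_real u ^ s" by (rule power_minus)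
  thus "(Ebar s b - Ebar s 1) / (- of_real u) ^ s = (-1)^s * (Ebar s b - Ebar s 1) / of_real u ^ s"
    by (cases "even s") (simp_all add: minus_divide_left)
qed

lemma LG_correction_holomorphic: "LG_correction n u holomorphic_on A"
  unfolding LG_correction_def by (intro holomorphic_intros Ebar_holomorphic) auto

text \<open>On the far part of a path this is 1 + e; elsewhere on the path the continued functions
  take the place of the principal ones.\<close>

definition LG_ratio :: "nat \<Rightarrow> real \<Rightarrow> complex \<Rightarrow> complex" where
  "LG_ratio n u z = LG_prefactor u * pcfU (of_real (u/2)) (of_real (sqrt (2*u)) * z) * (1 + z^2) powr (1/4) *
     exp (of_real u * xibar z - LG_correction n u (z / xsqrt z))"

lemma LG_ratio_tendsto_1:
  assumes u: "u > 0"
  shows "(LG_ratio n u \<longlongrightarrow> 1) (inf at_infinity (principal {z. Re z > 0}))"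
proof -
  let ?F = "inf at_infinity (principal {z::complex. Re z > 0})"
  have "isCont (LG_correction n u) 1"
    using holomorphic_on_imp_continuous_on[OF LG_correction_holomorphic[of n u UNIV]]
    by (simp add: continuous_on_eq_continuous_at)
  hence "((\<lambda>z. LG_correction n u (z / xsqrt z)) \<longlongrightarrow> LG_correction n u 1) ?F"
    by (rule isCont_tendsto_compose[OF _ Ebar_arg_tendsto])
  hence "((\<lambda>z. exp (- LG_correction n u (z / xsqrt z))) \<longlongrightarrow> exp (- LG_correction n u 1)) ?F"
    by (intro tendsto_intros)
  from tendsto_mult[OF leading_term_tendsto_1[OF u] this]
  have "((\<lambda>z. LG_prefactor u * pcfU (of_real (u/2)) (of_real (sqrt (2*u)) * z) * (1 + z^2) powr (1/4) * exp (of_real u * xibar z) *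
     exp (- LG_correction n u (z / xsqrt z))) \<longlongrightarrow> 1) ?F"
    by (simp add: LG_correction_def)
  moreover have "LG_prefactor u * pcfU (of_real (u/2)) (of_real (sqrt (2*u)) * z) * (1 + z^2) powr (1/4) * exp (of_real u * xibar z) *
     exp (- LG_correction n u (z / xsqrt z)) = LG_ratio n u z" for z
    by (simp only: LG_ratio_def mult.assoc diff_conv_add_uminus exp_add)
  ultimately show ?thesis by (simp only:)
qed

lemma pcfU_scaled_derivs:
  assumes u: "u > (0::real)"
  obtains f1 where "\<And>z. ((\<lambda>z. pcfU (of_real (u/2)) (of_real (sqrt (2*u)) * z)) has_field_derivative f1 z) (at z)"
    "\<And>z. (f1 has_field_derivative of_real u ^ 2 * (1 + z^2) * pcfU (of_real (u/2)) (of_real (sqrt (2*u)) * z)) (at z)"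
proof -
  define k where "k = complex_of_real (sqrt (2*u))"
  have k2: "k^2 = 2 * of_real u" using u by (simp add: k_def flip: of_real_power)
  obtain f' where f': "\<And>z. (pcfU (of_real (u/2)) has_field_derivative f' z) (at z)"
    "\<And>z. (f' has_field_derivative (z^2 / 4 + of_real (u/2)) * pcfU (of_real (u/2)) z) (at z)"
    using pcfU_derivs[of "u/2"] u by (metis half_gt_zero)
  have kz: "((\<lambda>z. k * z) has_field_derivative k) (at z)" for z by (auto intro!: derivative_eq_intros)
  show ?thesis
  proof
    fix z
    show "((\<lambda>z. pcfU (of_real (u/2)) (of_real (sqrt (2*u)) * z)) has_field_derivative f' (k * z) * k) (at z)"
      using DERIV_chain2[OF f'(1) kz] by (simp add: k_def)
    have "((\<lambda>z. f' (k * z) * k) has_field_derivative (((k*z)^2 / 4 + of_real (u/2)) * pcfU (of_real (u/2)) (k * z) * k) * k) (at z)"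
      by (intro DERIV_cmult_right DERIV_chain2[OF f'(2) kz])
    also have "(((k*z)^2 / 4 + of_real (u/2)) * pcfU (of_real (u/2)) (k * z) * k) * k =
       k^2 * (k^2 * z^2 / 4 + of_real (u/2)) * pcfU (of_real (u/2)) (k * z)"
      by (simp add: power2_eq_square algebra_simps)
    also have "k^2 * (k^2 * z^2 / 4 + of_real (u/2)) = of_real u ^ 2 * (1 + z^2)"
      unfolding k2 by (simp add: field_simps power2_eq_square)
    finally show "((\<lambda>z. f' (k * z) * k) has_field_derivative of_real u ^ 2 * (1 + z^2) * pcfU (of_real (u/2)) (of_real (sqrt (2*u)) * z)) (at z)"
      by (simp add: k_def)
  qed
qed

lemma LG_ratio_holomorphic:
  assumes u: "u > 0"
  shows "LG_ratio n u holomorphic_on {z. Re z > 0}"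
proof -
  let ?H = "{z::complex. Re z > 0}"
  have H: "?H \<subseteq> cut_plane" by (auto simp: cut_plane_iff)
  have o: "open ?H" by (rule open_halfspace_Re_gt)
  obtain f1 where f1: "\<And>z. ((\<lambda>z. pcfU (of_real (u/2)) (of_real (sqrt (2*u)) * z)) has_field_derivative f1 z) (at z)"
    "\<And>z. (f1 has_field_derivative of_real u ^ 2 * (1 + z^2) * pcfU (of_real (u/2)) (of_real (sqrt (2*u)) * z)) (at z)"
    using pcfU_scaled_derivs[OF u] by blast
  from f1(1) have 1: "(\<lambda>z. pcfU (of_real (u/2)) (of_real (sqrt (2*u)) * z)) holomorphic_on ?H"
    unfolding holomorphic_on_open[OF o] by blast
  have "xibar_closed holomorphic_on ?H"
    unfolding holomorphic_on_open[OF o] using H xibar_closed_has_field_derivative by blast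
  hence 2: "xibar holomorphic_on ?H"
  proof (rule holomorphic_transform)
    fix z :: complex assume "z \<in> ?H"
    hence "z \<in> cut_plane" using H by blast
    thus "xibar_closed z = xibar z" by (rule xibar_eq [symmetric])
  qed
  have 3: "xsqrt holomorphic_on ?H"
    unfolding holomorphic_on_open[OF o] using H xsqrt_has_field_derivative by blast
  have s0: "xsqrt z \<noteq> 0" if "z \<in> ?H" for z
  proof -
    have "Re (xsqrt z) > 0" using that H Re_xsqrt_pos by blast
    thus ?thesis by auto
  qed
  have "(LG_correction n u \<circ> (\<lambda>z. z / xsqrt z)) holomorphic_on ?H"
    by (rule holomorphic_on_compose_gen[OF _ LG_correction_holomorphic[of _ _ UNIV]])
       (use s0 in \<open>auto intro!: holomorphic_intros 3\<close>)
  hence 4: "(\<lambda>z. LG_correction n u (z / xsqrt z)) holomorphic_on ?H" by (simp add: o_def)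
  have 5: "(\<lambda>z. (1 + z^2) powr (1/4)) holomorphic_on ?H"
    using H by (intro holomorphic_intros) (auto simp: cut_plane_def)
  show ?thesis unfolding LG_ratio_def by (intro holomorphic_intros 1 2 4 5)
qed

text \<open>The ratio tends to 1 uniformly in the half plane, so Cauchy's estimate on discs of
  radius 1/2 makes its derivative small. This gives the vanishing of e' at the end of the
  path.\<close>

lemma deriv_LG_ratio_small:
  assumes u: "u > 0" and e: "e > 0"
  obtains b where "\<And>z. Re z > b \<Longrightarrow> norm (deriv (LG_ratio n u) z) \<le> e"
proof -
  have "\<forall>\<^sub>F z in inf at_infinity (principal {z. Re z > 0}). norm (LG_ratio n u z - 1) < e / 2"
    using tendstoD[OF LG_ratio_tendsto_1[OF u], of "e/2"] e by (simp add: dist_norm)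
  then obtain b where b: "\<And>z. norm z \<ge> b \<Longrightarrow> Re z > 0 \<Longrightarrow> norm (LG_ratio n u z - 1) < e / 2"
    unfolding eventually_inf_principal eventually_at_infinity by auto
  show ?thesis
  proof
    fix z :: complex assume z: "Re z > \<bar>b\<bar> + 1"
    have near: "Re w > 0 \<and> norm w \<ge> b" if "dist z w \<le> 1/2" for w
    proof -
      have "Re z - Re w \<le> 1/2" using that abs_Re_le_cmod[of "z - w"] by (simp add: dist_norm)
      hence "Re w > \<bar>b\<bar>" using z by linarith
      thus ?thesis using abs_Re_le_cmod[of w] by linarith
    qed
    have hol: "(\<lambda>z. LG_ratio n u z - 1) holomorphic_on {z. Re z > 0}"
      by (intro holomorphic_intros LG_ratio_holomorphic u)
    have "norm ((deriv ^^ 1) (\<lambda>z. LG_ratio n u z - 1) z) \<le> fact 1 * (e/2) / (1/2) ^ 1"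
    proof (rule Cauchy_inequality)
      show "(\<lambda>z. LG_ratio n u z - 1) holomorphic_on ball z (1/2)"
        by (rule holomorphic_on_subset[OF hol]) (use near in auto)
      show "continuous_on (cball z (1/2)) (\<lambda>z. LG_ratio n u z - 1)"
        by (rule continuous_on_subset[OF holomorphic_on_imp_continuous_on[OF hol]]) (use near in auto)
      fix w assume "norm (z - w) = 1/2"
      thus "norm (LG_ratio n u w - 1) \<le> e/2" using near[of w] b[of w] by (simp add: dist_norm)
    qed auto
    moreover have "deriv (\<lambda>z. LG_ratio n u z - 1) z = deriv (LG_ratio n u) z"
    proof -
      have "LG_ratio n u field_differentiable at z"
        using LG_ratio_holomorphic[OF u] z holomorphic_on_imp_differentiable_at[OF _ open_halfspace_Re_gt[of 0]] by auto
      thus ?thesis by (simp add: deriv_diff)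
    qed
    ultimately show "norm (deriv (LG_ratio n u) z) \<le> e" by simp
  qed
qed

section \<open>The error bound along an admissible path\<close>

locale admissible_right =
  fixes z :: complex and \<gamma> Q X :: "real \<Rightarrow> complex"
  assumes adm: "admissible_to 1 z \<gamma> Q X"
begin

definition B where "B = beta_along \<gamma> Q"

definition X' where "X' t = Q t ^ 2 * vector_derivative \<gamma> (at t)"

definition T where "T = (SOME T. finite T \<and> (\<forall>t>0. t \<notin> T \<longrightarrow> nice_at \<gamma> t))"

lemma T: "finite T" "t > 0 \<Longrightarrow> t \<notin> T \<Longrightarrow> nice_at \<gamma> t"
proof -
  have "\<exists>T. finite T \<and> (\<forall>t>0. t \<notin> T \<longrightarrow> nice_at \<gamma> t)"
    using adm R2_chain_nice(2) by (simp add: admissible_to_def)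
  from someI_ex[OF this] show "finite T" "t > 0 \<Longrightarrow> t \<notin> T \<Longrightarrow> nice_at \<gamma> t"
    unfolding T_def by blast+
qed

definition reg where "reg t \<longleftrightarrow> t > 0 \<and> t \<notin> T"

lemma reg_pos: "reg t \<Longrightarrow> t > 0" by (simp add: reg_def)

lemma open_reg: "open {t. reg t}"
proof -
  have "{t. reg t} = {0<..} - T" by (auto simp: reg_def)
  thus ?thesis using T(1) by (simp add: open_Diff finite_imp_closed)
qed

lemma eventually_reg: "reg t \<Longrightarrow> \<forall>\<^sub>F s in nhds t. reg s"
  using eventually_nhds_in_open[OF open_reg, of t] by simp

lemma eventually_reg_at_top: "\<forall>\<^sub>F t in at_top. reg t"
proof -
  have "\<forall>\<^sub>F t in at_top. t > Max (insert 0 T)" by (rule eventually_gt_at_top)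
  thus ?thesis
  proof eventually_elim
    case (elim t)
    thus ?case using T(1) by (auto simp: reg_def)
  qed
qed

lemma cont_\<gamma>: "continuous_on {0..} \<gamma>"
  using adm R2_chain_nice(1) by (simp add: admissible_to_def)

lemma cont_Q: "continuous_on {0..} Q"
  using adm by (simp add: admissible_to_def continued_along_def)

lemma Q4: "t \<ge> 0 \<Longrightarrow> Q t ^ 4 = 1 + \<gamma> t ^ 2"
  using adm by (simp add: admissible_to_def continued_along_def)

lemma Q_nonzero: "t \<ge> 0 \<Longrightarrow> Q t \<noteq> 0"
proof
  assume t: "t \<ge> 0" "Q t = 0"
  hence "(\<gamma> t - \<i>) * (\<gamma> t + \<i>) = 0" using Q4[OF t(1)] by (simp add: algebra_simps power2_eq_square)
  hence "\<gamma> t = \<i> \<or> \<gamma> t = - \<i>" by (simp add: eq_neg_iff_add_eq_0)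
  thus False using adm t(1) by (auto simp: admissible_to_def)
qed

lemma has_integral_X: "t \<ge> 0 \<Longrightarrow> (X' has_integral (X t - X 0)) {0..t}"
  using adm by (simp add: admissible_to_def continued_along_def X'_def [abs_def])

lemma X_eq: "t \<ge> 0 \<Longrightarrow> X t = X 0 + integral {0..t} X'"
  using integral_unique[OF has_integral_X] by simp

lemma cont_X: "continuous_on {0..} X"
proof -
  have "continuous_on {0..<n} X" if "n > 0" for n :: real
  proof -
    have "X' integrable_on {0..n}" using has_integral_X[of n] that by auto
    hence "continuous_on {0..n} (\<lambda>t. X 0 + integral {0..t} X')"
      by (intro continuous_intros indefinite_integral_continuous_1)
    hence "continuous_on {0..n} X" by (rule continuous_on_eq) (simp add: X_eq [symmetric])
    thus ?thesis by (rule continuous_on_subset) auto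
  qed
  note * = this
  show ?thesis unfolding continuous_on_eq_continuous_within
  proof
    fix t :: real assume "t \<in> {0..}"
    hence t: "t \<ge> 0" by simp
    have "continuous (at t within {0..<t+1}) X" using *[of "t+1"] t by (simp add: continuous_on_eq_continuous_within)
    moreover have "at t within {0..<t+1} = at t within {0..}"
      by (rule at_within_nhd[of _ "{..<t+1}"]) auto
    ultimately show "continuous (at t within {0..}) X" by simp
  qed
qed

lemma isCont_of: "continuous_on {0..} f \<Longrightarrow> t > 0 \<Longrightarrow> isCont f t" for f :: "real \<Rightarrow> complex"
  by (rule continuous_on_interior) (auto simp: interior_real_atLeast)

lemma deriv_\<gamma>: "reg t \<Longrightarrow> (\<gamma> has_vector_derivative vector_derivative \<gamma> (at t)) (at t)"
  "reg t \<Longrightarrow> vector_derivative \<gamma> (at t) \<noteq> 0"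
  "reg t \<Longrightarrow> isCont (\<lambda>t. vector_derivative \<gamma> (at t)) t"
  using T(2) by (auto simp: reg_def nice_at_def)

section \<open>Calculus with respect to the continued \<xi>\<close>

lemma isCont_X': "reg t \<Longrightarrow> isCont X' t"
  unfolding X'_def using deriv_\<gamma>(3) isCont_of[OF cont_Q, of t] by (auto simp: reg_def intro!: continuous_intros)

text \<open>\<open>xd f d t\<close> expresses df/d\<xi> = d at the parameter t, with the factor
  d\<xi>/dt kept on the right so that nothing is divided by it. The rules below reduce the
  differential equation to algebra in \<open>Q\<close> and \<open>\<gamma>\<close>.\<close>

definition xd :: "(real \<Rightarrow> complex) \<Rightarrow> complex \<Rightarrow> real \<Rightarrow> bool" where
  "xd f d t \<longleftrightarrow> (f has_vector_derivative X' t * d) (at t)"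

lemma xd_X: assumes "reg t" shows "xd X 1 t"
proof -
  have t: "t > 0" using assms by (rule reg_pos)
  have int: "X' integrable_on {0..t+1}" using has_integral_X[of "t+1"] t by auto
  have "((\<lambda>u. integral {0..u} X') has_vector_derivative X' t) (at t within {0..t+1} - {})"
    using isCont_X'[OF assms] t by (intro integral_has_vector_derivative_continuous_at int) (auto simp: continuous_at_imp_continuous_within)
  hence "((\<lambda>u. integral {0..u} X') has_vector_derivative X' t) (at t)"
    using t by (simp add: at_within_Icc_at)
  hence "((\<lambda>u. X 0 + integral {0..u} X') has_vector_derivative 0 + X' t) (at t)"
    by (intro has_vector_derivative_add has_vector_derivative_const)
  hence "(X has_vector_derivative 0 + X' t) (at t)"
  proof (rule has_vector_derivative_transform_within_open[of _ _ _ "{0<..}"])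
    fix y :: real assume "y \<in> {0<..}"
    thus "X 0 + integral {0..y} X' = X y" using X_eq[of y] by simp
  qed (use t in auto)
  thus ?thesis by (simp add: xd_def)
qed

lemma xd_\<gamma>: assumes "reg t" shows "xd \<gamma> (1 / Q t ^ 2) t"
  using deriv_\<gamma>(1)[OF assms] Q_nonzero[of t] reg_pos[OF assms] by (simp add: xd_def X'_def)

lemma xd_const: "xd (\<lambda>t. c) 0 t"
  by (simp add: xd_def has_vector_derivative_const)

lemma xd_add: "xd f a t \<Longrightarrow> xd g b t \<Longrightarrow> xd (\<lambda>t. f t + g t) (a + b) t"
  unfolding xd_def ring_distribs by (rule has_vector_derivative_add)

lemma xd_diff: "xd f a t \<Longrightarrow> xd g b t \<Longrightarrow> xd (\<lambda>t. f t - g t) (a - b) t"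
  unfolding xd_def ring_distribs by (rule has_vector_derivative_diff)

lemma xd_mult: "xd f a t \<Longrightarrow> xd g b t \<Longrightarrow> xd (\<lambda>t. f t * g t) (f t * b + a * g t) t"
  unfolding xd_def using has_vector_derivative_mult[of f "X' t * a" t UNIV g "X' t * b"] by (simp add: algebra_simps)

lemma xd_cmult: "xd f a t \<Longrightarrow> xd (\<lambda>t. c * f t) (c * a) t"
  using xd_mult[OF xd_const] by simp

lemma xd_sum: "(\<And>i. i \<in> A \<Longrightarrow> xd (f i) (d i) t) \<Longrightarrow> xd (\<lambda>t. \<Sum>i\<in>A. f i t) (\<Sum>i\<in>A. d i) t"
  unfolding xd_def sum_distrib_left by (rule has_vector_derivative_sum)

lemma xd_comp:
  assumes "xd f a t" "(h has_field_derivative h') (at (f t))"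
  shows "xd (\<lambda>t. h (f t)) (h' * a) t"
  using field_vector_diff_chain_at[of f "X' t * a" t h h'] assms by (simp add: xd_def o_def mult_ac)

lemma xd_eq: "xd f a t \<Longrightarrow> a = b \<Longrightarrow> xd f b t" by simp

lemma xd_Q: assumes "reg t" shows "xd Q (\<gamma> t / (2 * Q t ^ 5)) t"
proof -
  have t: "t > 0" using assms by (rule reg_pos)
  let ?g = "vector_derivative \<gamma> (at t)"
  have "((\<lambda>t. 1 + \<gamma> t ^ 2) has_vector_derivative 0 + 2 * \<gamma> t * ?g) (at t)"
  proof (intro has_vector_derivative_add has_vector_derivative_const)
    have "((\<lambda>t. \<gamma> t * \<gamma> t) has_vector_derivative \<gamma> t * ?g + ?g * \<gamma> t) (at t)"
      by (rule has_vector_derivative_mult[OF deriv_\<gamma>(1) deriv_\<gamma>(1), OF assms assms])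
    thus "((\<lambda>t. \<gamma> t ^ 2) has_vector_derivative 2 * \<gamma> t * ?g) (at t)"
      by (simp add: power2_eq_square algebra_simps)
  qed
  moreover have "\<forall>\<^sub>F s in nhds t. Q s ^ 4 = 1 + \<gamma> s ^ 2"
    using eventually_reg[OF assms] by eventually_elim (auto simp: reg_def intro: Q4)
  ultimately have "(Q has_vector_derivative (0 + 2 * \<gamma> t * ?g) / (4 * Q t ^ 3)) (at t)"
    using t by (intro continuous_root4_has_vector_derivative isCont_of[OF cont_Q] Q_nonzero) auto
  moreover have "(0 + 2 * \<gamma> t * ?g) / (4 * Q t ^ 3) = X' t * (\<gamma> t / (2 * Q t ^ 5))"
    using Q_nonzero[of t] t by (simp add: X'_def field_simps eval_nat_numeral)
  ultimately show ?thesis by (simp add: xd_def)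
qed

lemma xd_Q_inv_power: assumes "reg t" shows "xd (\<lambda>t. 1 / Q t ^ k) (- of_nat k * \<gamma> t / (2 * Q t ^ (k + 6))) t"
proof -
  have Q0: "Q t \<noteq> 0" using reg_pos[OF assms] Q_nonzero by simp
  have "((\<lambda>w. 1 / w ^ k) has_field_derivative (- of_nat k / Q t ^ (k + 1))) (at (Q t))"
  proof (cases k)
    case (Suc j)
    have "((\<lambda>w. w ^ Suc j) has_field_derivative of_nat (Suc j) * Q t ^ j) (at (Q t))"
      by (rule DERIV_cong[OF DERIV_power[OF DERIV_ident]]) simp
    thus ?thesis
      unfolding Suc by (rule DERIV_cong[OF DERIV_divide[OF DERIV_const]]) (use Q0 in \<open>simp_all add: field_simps\<close>)
  qed simp
  from xd_comp[OF xd_Q[OF assms] this] show ?thesis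
    by (rule xd_eq) (use Q0 in \<open>simp add: field_simps eval_nat_numeral power_add\<close>)
qed

lemma B_eq: "B t = \<gamma> t * (1 / Q t ^ 2)"
  by (simp add: B_def beta_along_def)

lemma one_minus_B2: assumes "t \<ge> 0" shows "1 - B t ^ 2 = 1 / Q t ^ 4"
proof -
  have "1 - B t ^ 2 = (Q t ^ 4 - \<gamma> t ^ 2) / Q t ^ 4"
    using Q_nonzero[OF assms] by (simp add: B_eq power_divide diff_divide_distrib flip: power_mult)
  moreover have "Q t ^ 4 - \<gamma> t ^ 2 = 1" using Q4[OF assms] by simp
  ultimately show ?thesis by (simp only:)
qed

lemma xd_B: assumes "reg t" shows "xd B ((1 - B t ^ 2)^2) t"
proof -
  have Q0: "Q t \<noteq> 0" "t \<ge> 0" using reg_pos[OF assms] Q_nonzero by auto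
  have Beq: "B = (\<lambda>t. \<gamma> t * (1 / Q t ^ 2))" by (simp add: fun_eq_iff B_eq)
  have "xd B (\<gamma> t * (- of_nat 2 * \<gamma> t / (2 * Q t ^ (2 + 6))) + 1 / Q t ^ 2 * (1 / Q t ^ 2)) t"
    unfolding Beq by (intro xd_mult xd_\<gamma> xd_Q_inv_power assms)
  moreover have "\<gamma> t * (- of_nat 2 * \<gamma> t / (2 * Q t ^ (2 + 6))) + 1 / Q t ^ 2 * (1 / Q t ^ 2) = (1 - B t ^ 2)^2"
  proof -
    have "\<gamma> t * (- of_nat 2 * \<gamma> t / (2 * Q t ^ (2 + 6))) + 1 / Q t ^ 2 * (1 / Q t ^ 2) = (Q t ^ 4 - \<gamma> t ^ 2) / Q t ^ 8"
      using Q0 by (simp add: field_simps eval_nat_numeral)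
    also have "Q t ^ 4 - \<gamma> t ^ 2 = 1" using Q4[OF Q0(2)] by simp
    also have "1 / Q t ^ 8 = (1 - B t ^ 2)^2" unfolding one_minus_B2[OF Q0(2)] by (simp add: power_divide flip: power_mult)
    finally show ?thesis .
  qed
  ultimately show ?thesis by simp
qed

lemma cont_B: "continuous_on {0..} B"
  unfolding B_def beta_along_def using Q_nonzero by (intro continuous_intros cont_\<gamma> cont_Q) auto

lemma vector_derivative_B: "reg t \<Longrightarrow> vector_derivative B (at t) = X' t * (1 - B t ^ 2)^2"
  using xd_B[of t] unfolding xd_def by (rule vector_derivative_at)

lemma isCont_vector_derivative_B: assumes "reg t" shows "isCont (\<lambda>t. vector_derivative B (at t)) t"
proof -
  have "isCont (\<lambda>t. X' t * (1 - B t ^ 2)^2) t"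
    using isCont_X'[OF assms] isCont_of[OF cont_B reg_pos[OF assms]] by (intro continuous_intros)
  moreover have ev: "\<forall>\<^sub>F s in nhds t. vector_derivative B (at s) = X' s * (1 - B s ^ 2)^2"
    using eventually_reg[OF assms] by eventually_elim (rule vector_derivative_B)
  ultimately show ?thesis using isCont_cong[OF ev] by simp
qed

lemma filterlim_Re: "filterlim (\<lambda>t. Re (\<gamma> t)) at_top at_top"
  using adm by (simp add: admissible_to_def)

lemma filterlim_\<gamma>: "filterlim \<gamma> (inf at_infinity (principal {z. Re z > 0})) at_top"
proof (subst filterlim_inf, intro conjI)
  have "filterlim (\<lambda>t. norm (\<gamma> t)) at_top at_top"
    by (rule filterlim_at_top_mono[OF filterlim_Re always_eventually]) (auto intro: complex_Re_le_cmod)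
  thus "filterlim \<gamma> at_infinity at_top" by (simp add: filterlim_at_infinity_conv_norm_at_top)
  show "filterlim \<gamma> (principal {z. Re z > 0}) at_top"
    using filterlim_Re by (auto simp: filterlim_principal filterlim_at_top_dense)
qed

lemma tail: "\<forall>\<^sub>F t in at_top. reg t \<and> Re (\<gamma> t) > 0 \<and> Q t = (1 + \<gamma> t ^ 2) powr (1/4) \<and> Q t ^ 2 = xsqrt (\<gamma> t) \<and> X t = xibar (\<gamma> t)"
proof -
  have "\<forall>\<^sub>F t in at_top. Re (\<gamma> t) > 0" using filterlim_Re by (auto simp: filterlim_at_top_dense)
  moreover have "\<forall>\<^sub>F t in at_top. Q t = (1 + \<gamma> t ^ 2) powr (1/4)" "\<forall>\<^sub>F t in at_top. X t = xibar (\<gamma> t)"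
    using adm by (simp_all add: admissible_to_def continued_along_def)
  ultimately show ?thesis using eventually_reg_at_top
    by eventually_elim (auto simp: cut_plane_iff principal_quartic_root(2))
qed

text \<open>Far out, where |z| > 2, the quotient |\<beta>|^2 = |z^2 / (1 + z^2)| is bounded; the
  rest of the path is compact.\<close>

lemma bounded_B: "bounded (B ` {0..})"
proof -
  have "\<forall>\<^sub>F t in at_top. t \<ge> 0 \<and> norm (\<gamma> t) > 2"
  proof -
    have "\<forall>\<^sub>F t in at_top. Re (\<gamma> t) > 2" using filterlim_Re by (auto simp: filterlim_at_top_dense)
    thus ?thesis using eventually_ge_at_top[of 0]
      by eventually_elim (auto intro: less_le_trans complex_Re_le_cmod)
  qed
  then obtain M where M: "\<And>t. t \<ge> M \<Longrightarrow> t \<ge> 0 \<and> norm (\<gamma> t) > 2" by (auto simp: eventually_at_top_linorder)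
  have "norm (B t) \<le> 2" if "t \<ge> M" for t
  proof -
    have t: "t \<ge> 0" "norm (\<gamma> t) > 2" using M[OF that] by auto
    have "norm (\<gamma> t ^ 2) \<le> norm (1 + \<gamma> t ^ 2) + 1"
      using norm_triangle_ineq4[of "1 + \<gamma> t ^ 2" 1] by simp
    moreover have "norm (\<gamma> t ^ 2) > 2" 
  proof -
      have "norm (\<gamma> t) * norm (\<gamma> t) > 2 * 1" using t(2) by (intro mult_strict_mono) auto
      thus ?thesis by (simp add: norm_mult power2_eq_square)
    qed
    ultimately have "norm (\<gamma> t ^ 2) \<le> 2 * norm (1 + \<gamma> t ^ 2)" by simp
    also have "\<dots> = 2 * norm (Q t) ^ 4" using Q4[OF t(1)] by (metis norm_power)
    also have "norm (Q t) ^ 4 = (norm (Q t) ^ 2)^2" by (simp flip: power_mult)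
    finally have "norm (\<gamma> t) ^ 2 \<le> 2 * (norm (Q t) ^ 2)^2" by (simp add: norm_power)
    moreover have "0 \<le> (norm (Q t) ^ 2)^2" by simp
    ultimately have "norm (\<gamma> t) ^ 2 \<le> 4 * (norm (Q t) ^ 2)^2" by linarith
    hence "norm (\<gamma> t) ^ 2 \<le> (2 * norm (Q t) ^ 2)^2" by (simp add: power_mult_distrib)
    hence "norm (\<gamma> t) \<le> 2 * norm (Q t) ^ 2" by (rule power2_le_imp_le) simp
    thus ?thesis using Q_nonzero[OF t(1)] by (simp add: B_eq norm_mult norm_divide norm_power field_simps)
  qed
  hence "B ` {M..} \<subseteq> cball 0 2" by auto
  moreover have "bounded (B ` {0..max 0 M})"
    by (intro compact_imp_bounded compact_continuous_image continuous_on_subset[OF cont_B]) auto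
  ultimately have "bounded (cball 0 2 \<union> B ` {0..max 0 M})" by simp
  moreover have "B ` {0..} \<subseteq> cball 0 2 \<union> B ` {0..max 0 M}"
  proof
    fix y assume "y \<in> B ` {0..}"
    then obtain t where t: "t \<ge> 0" "y = B t" by auto
    show "y \<in> cball 0 2 \<union> B ` {0..max 0 M}"
    proof (cases "t \<ge> M")
      case True
      thus ?thesis using \<open>B ` {M..} \<subseteq> cball 0 2\<close> t by blast
    next
      case False
      thus ?thesis using t by (intro UnI2 image_eqI[of _ _ t]) auto
    qed
  qed
  ultimately show ?thesis by (rule bounded_subset)
qed

text \<open>Boundedness of \<beta> turns the finite length of its image, which is part of
  admissibility, into convergence of each integral in \<omega> and \<varpi>.\<close>

lemma absolutely_integrable_along:
  assumes h: "continuous_on UNIV h"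
  shows "(\<lambda>t. norm (h (B t) * vector_derivative B (at t))) absolutely_integrable_on {0..}"
proof -
  have B': "(\<lambda>t. vector_derivative B (at t)) absolutely_integrable_on {0..}"
    using adm by (simp add: admissible_to_def B_def)
  have "compact (closure (B ` {0..}))" using bounded_B by (simp only: compact_closure)
  hence "compact (h ` closure (B ` {0..}))" by (intro compact_continuous_image continuous_on_subset[OF h]) auto
  hence bd: "bounded ((\<lambda>t. h (B t)) ` {0..})"
    by (rule bounded_subset[OF compact_imp_bounded]) (auto intro: closure_subset[THEN subsetD])
  have cont: "continuous_on {0..} (\<lambda>t. h (B t))"
    using continuous_on_compose2[OF h cont_B] by auto
  have "(\<lambda>t. h (B t) * vector_derivative B (at t)) absolutely_integrable_on {0..}"
  proof (rule absolutely_integrable_bounded_measurable_product[OF bilinear_times _ _ bd B'])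
    show "(\<lambda>t. h (B t)) \<in> borel_measurable (lebesgue_on {0..})"
      by (intro continuous_imp_measurable_on_sets_lebesgue cont) auto
  qed auto
  thus ?thesis by (rule set_integrable_norm)
qed

end

text \<open>To be read with x = d\<xi>/dt and v = -u: the residual has order v^(1-n), and the
  division by u yields the factor u^(-n) in front of the integrand of \<omega>.\<close>

lemma residual_norm_bound:
  fixes u :: real and x Fn e :: complex
  assumes u: "u > 0" and n: "n \<ge> 1" and Fn: "x * Fn = e" and S: "\<And>s. x * S s = R s"
  shows "norm (x * (2 * Fn / (- of_real u) ^ (n - 1) - (\<Sum>s\<in>{1..<n}. S s / (- of_real u) ^ (s + n - 1)))) / u
    \<le> 1 / u ^ n * (2 * norm e + (\<Sum>s\<in>{1..<n}. 1 / u ^ s * norm (R s)))"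
proof -
  define v where "v = - complex_of_real u"
  have nv: "norm v = u" using u by (simp add: v_def)
  obtain m where "n = Suc m" using n by (cases n) auto
  hence m: "n - 1 = m" "\<And>s. s + n - 1 = s + m" and un: "u ^ n = u * u ^ m" by auto
  have "x * (2 * Fn / v ^ (n - 1) - (\<Sum>s\<in>{1..<n}. S s / v ^ (s + n - 1))) = 2 * (x * Fn) / v ^ m - (\<Sum>s\<in>{1..<n}. x * S s / v ^ (s + m))"
    unfolding m right_diff_distrib sum_distrib_left by simp
  also have "norm \<dots> \<le> norm (2 * e / v ^ m) + (\<Sum>s\<in>{1..<n}. norm (R s / v ^ (s + m)))"
    unfolding Fn S by (rule order_trans[OF norm_triangle_ineq4 add_left_mono[OF norm_sum]])
  also have "\<dots> = 2 * norm e / u ^ m + (\<Sum>s\<in>{1..<n}. norm (R s) / u ^ (s + m))"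
    by (simp add: norm_divide norm_mult norm_power nv)
  also have "\<dots> = u * (1 / u ^ n * (2 * norm e + (\<Sum>s\<in>{1..<n}. 1 / u ^ s * norm (R s))))"
    using u by (simp add: un field_simps sum_distrib_left sum_divide_distrib power_add)
  finally show ?thesis using u by (simp add: v_def divide_le_eq mult.commute)
qed

section \<open>The equation for the relative error along the path\<close>

context admissible_right
begin

context
  fixes u :: real and n :: nat
  assumes u: "u > 0" and n: "n \<ge> 1"
begin

definition f where "f w = pcfU (of_real (u/2)) (of_real (sqrt (2*u)) * w)"

definition f1 where "f1 = deriv f"

lemma f_derivs: "(f has_field_derivative f1 w) (at w)"
  "(f1 has_field_derivative of_real u ^ 2 * (1 + w^2) * f w) (at w)"
proof -
  obtain g where g: "\<And>z. ((\<lambda>z. pcfU (of_real (u/2)) (of_real (sqrt (2*u)) * z)) has_field_derivative g z) (at z)"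
    "\<And>z. (g has_field_derivative of_real u ^ 2 * (1 + z^2) * pcfU (of_real (u/2)) (of_real (sqrt (2*u)) * z)) (at z)"
    using pcfU_scaled_derivs[OF u] by blast
  have fg: "(f has_field_derivative g w) (at w)" for w using g(1)[of w] by (simp add: f_def [abs_def])
  hence "f1 = g" unfolding f1_def by (auto intro!: DERIV_imp_deriv)
  thus "(f has_field_derivative f1 w) (at w)" "(f1 has_field_derivative of_real u ^ 2 * (1 + w^2) * f w) (at w)"
    using fg g(2)[of w] by (simp_all add: f_def)
qed

definition v where "v = - complex_of_real u"

lemma v_nonzero: "v \<noteq> 0" using u by (simp add: v_def)

definition p where "p t = (\<Sum>s\<in>{1..<n}. Fbar s (B t) / v ^ s)"

definition p2 where "p2 t = (\<Sum>s\<in>{1..<n}. (1 - B t ^ 2)^2 * deriv (Fbar s) (B t) / v ^ s)"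

text \<open>The reciprocal of the exponential approximation, so that
  \<open>A t * f (\<gamma> t)\<close> is 1 + e.\<close>

definition A where "A t = LG_prefactor u * (Q t * exp (of_real u * X t - LG_correction n u (B t)))"

text \<open>The logarithmic derivative of \<open>Q\<close> with respect to \<xi>; that of
  \<open>A\<close> is \<open>c\<close> below, and \<open>y1\<close> is df/d\<xi>.\<close>

definition \<kappa> where "\<kappa> t = \<gamma> t / 2 * (1 / Q t ^ 6)"

definition c where "c t = \<kappa> t + (of_real u - p t)"

definition y1 where "y1 t = f1 (\<gamma> t) * (1 / Q t ^ 2)"

definition e where "e t = A t * f (\<gamma> t) - 1"

text \<open>This is de/d\<xi> divided by 2u, written out with the logarithmic derivative
  \<open>c\<close> of \<open>A\<close>.\<close>

definition q where "q t = (1 / (2 * of_real u)) * (A t * (y1 t + c t * f (\<gamma> t)))"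

text \<open>The residual of the ansatz with S' = p - u, where p is the \<xi>-derivative of the
  correction; for v = -u it is the left-hand side of \<open>LG_residual\<close>.\<close>

definition g where "g t = of_real u ^ 2 + 2 * Fbar 1 (B t) - p2 t - (p t - of_real u)^2"

lemma xd_correction: assumes "reg t" shows "xd (\<lambda>t. LG_correction n u (B t)) (p t) t"
proof -
  have "(LG_correction n u has_field_derivative (\<Sum>s\<in>{1..<n}. (deriv (Ebar s) (B t) - 0) / v ^ s)) (at (B t))"
    unfolding LG_correction_def v_def
    by (intro DERIV_sum DERIV_cdivide DERIV_diff Ebar_has_field_derivative DERIV_const)
  from xd_comp[OF xd_B[OF assms] this] show ?thesis
    by (rule xd_eq) (unfold p_def Fbar_def sum_distrib_right, intro sum.cong refl, simp)
qed

lemma xd_p: assumes "reg t" shows "xd p (p2 t) t"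
proof -
  have "xd (\<lambda>t. \<Sum>s\<in>{1..<n}. Fbar s (B t) / v ^ s) (\<Sum>s\<in>{1..<n}. deriv (Fbar s) (B t) / v ^ s * (1 - B t ^ 2)^2) t"
  proof (intro xd_sum)
    fix s
    have "((\<lambda>b. Fbar s b / v ^ s) has_field_derivative deriv (Fbar s) (B t) / v ^ s) (at (B t))"
      by (intro DERIV_cdivide Fbar_has_field_derivative)
    from xd_comp[OF xd_B[OF assms] this]
    show "xd (\<lambda>t. Fbar s (B t) / v ^ s) (deriv (Fbar s) (B t) / v ^ s * (1 - B t ^ 2)^2) t" .
  qed
  thus ?thesis by (simp add: p_def [abs_def] p2_def mult.commute)
qed

text \<open>The sum \<kappa>' + \<kappa>^2 is Q''/Q in the variable \<xi>, the term \<psi> which the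
  Liouville transformation W = Q f adds to u^2, so that W'' = (u^2 + \<psi>) W. Its value 2 F_1 is
  what the recurrence starts from.\<close>

lemma xd_\<kappa>: assumes "reg t" shows "xd \<kappa> (2 * Fbar 1 (B t) - \<kappa> t ^ 2) t"
proof -
  have Q0: "Q t \<noteq> 0" "t \<ge> 0" using reg_pos[OF assms] Q_nonzero by auto
  have "xd (\<lambda>t. 1 / 2 * (\<gamma> t * (1 / Q t ^ 6))) (1 / 2 * (\<gamma> t * (- of_nat 6 * \<gamma> t / (2 * Q t ^ (6 + 6))) + 1 / Q t ^ 2 * (1 / Q t ^ 6))) t"
    by (intro xd_cmult xd_mult xd_\<gamma> xd_Q_inv_power assms)
  moreover have "(\<lambda>t. 1 / 2 * (\<gamma> t * (1 / Q t ^ 6))) = \<kappa>" by (simp add: \<kappa>_def fun_eq_iff)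
  ultimately have "xd \<kappa> (1 / 2 * (\<gamma> t * (- of_nat 6 * \<gamma> t / (2 * Q t ^ (6 + 6))) + 1 / Q t ^ 2 * (1 / Q t ^ 6))) t"
    by (simp only:)
  moreover have "1 / 2 * (\<gamma> t * (- of_nat 6 * \<gamma> t / (2 * Q t ^ (6 + 6))) + 1 / Q t ^ 2 * (1 / Q t ^ 6)) = 2 * Fbar 1 (B t) - \<kappa> t ^ 2"
  proof -
    have "Fbar 1 (B t) = (1 / Q t ^ 4) ^ 2 * (2 - 5 * B t ^ 2) / 8"
      using Fbar_1[of "B t"] one_minus_B2[OF Q0(2)] by simp
    also have "\<dots> = (2 * Q t ^ 4 - 5 * \<gamma> t ^ 2) / (8 * Q t ^ 12)"
      using Q0 by (simp add: B_eq field_simps eval_nat_numeral)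
    finally have F: "Fbar 1 (B t) = (2 * Q t ^ 4 - 5 * \<gamma> t ^ 2) / (8 * Q t ^ 12)" .
    show ?thesis unfolding F \<kappa>_def using Q0 by (simp add: field_simps eval_nat_numeral)
  qed
  ultimately show ?thesis by (simp only:)
qed

lemma xd_c: assumes "reg t" shows "xd c (2 * Fbar 1 (B t) - \<kappa> t ^ 2 + (0 - p2 t)) t"
  unfolding c_def [abs_def] by (intro xd_add xd_diff xd_const xd_\<kappa> xd_p assms)

lemma xd_A: assumes "reg t" shows "xd A (A t * c t) t"
proof -
  have Q0: "Q t \<noteq> 0" "t \<ge> 0" using reg_pos[OF assms] Q_nonzero by auto
  let ?E = "\<lambda>t. exp (of_real u * X t - LG_correction n u (B t))"
  have "xd ?E (?E t * (of_real u * 1 - p t)) t"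
    by (rule xd_comp[OF _ DERIV_exp]) (intro xd_diff xd_cmult xd_X xd_correction assms)
  hence "xd (\<lambda>t. LG_prefactor u * (Q t * ?E t)) (LG_prefactor u * (Q t * (?E t * (of_real u * 1 - p t)) + \<gamma> t / (2 * Q t ^ 5) * ?E t)) t"
    by (intro xd_cmult xd_mult xd_Q assms)
  moreover have "LG_prefactor u * (Q t * (?E t * (of_real u * 1 - p t)) + \<gamma> t / (2 * Q t ^ 5) * ?E t) = A t * c t"
  proof -
    have "\<gamma> t / (2 * Q t ^ 5) = Q t * \<kappa> t" using Q0 by (simp add: \<kappa>_def field_simps eval_nat_numeral)
    thus ?thesis by (simp add: A_def c_def algebra_simps)
  qed
  ultimately have "xd (\<lambda>t. LG_prefactor u * (Q t * ?E t)) (A t * c t) t" by (simp only:)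
  moreover have "(\<lambda>t. LG_prefactor u * (Q t * ?E t)) = A" by (simp add: A_def fun_eq_iff)
  ultimately show ?thesis by (simp only:)
qed

lemma xd_f\<gamma>: assumes "reg t" shows "xd (\<lambda>t. f (\<gamma> t)) (y1 t) t"
  using xd_comp[OF xd_\<gamma>[OF assms] f_derivs(1)] by (simp add: y1_def)

lemma xd_y1: assumes "reg t" shows "xd y1 (of_real u ^ 2 * f (\<gamma> t) - 2 * \<kappa> t * y1 t) t"
proof -
  have Q0: "Q t \<noteq> 0" "t \<ge> 0" using reg_pos[OF assms] Q_nonzero by auto
  have "xd y1 (f1 (\<gamma> t) * (- of_nat 2 * \<gamma> t / (2 * Q t ^ (2 + 6))) +
     of_real u ^ 2 * (1 + \<gamma> t ^ 2) * f (\<gamma> t) * (1 / Q t ^ 2) * (1 / Q t ^ 2)) t"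
    unfolding y1_def [abs_def]
    by (intro xd_mult xd_Q_inv_power assms xd_comp[OF xd_\<gamma>[OF assms] f_derivs(2)])
  moreover have "f1 (\<gamma> t) * (- of_nat 2 * \<gamma> t / (2 * Q t ^ (2 + 6))) +
     of_real u ^ 2 * (1 + \<gamma> t ^ 2) * f (\<gamma> t) * (1 / Q t ^ 2) * (1 / Q t ^ 2) = of_real u ^ 2 * f (\<gamma> t) - 2 * \<kappa> t * y1 t"
    unfolding Q4[OF Q0(2), symmetric] \<kappa>_def y1_def using Q0 by (simp add: field_simps eval_nat_numeral)
  ultimately show ?thesis by (simp only:)
qed

lemma xd_e: assumes "reg t" shows "xd e (2 * of_real u * q t) t"
proof -
  have "xd e (A t * y1 t + A t * c t * f (\<gamma> t) - 0) t"
    unfolding e_def [abs_def] by (intro xd_diff xd_const xd_mult xd_A xd_f\<gamma> assms)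
  moreover have "A t * y1 t + A t * c t * f (\<gamma> t) - 0 = 2 * of_real u * q t"
    using u by (simp add: q_def algebra_simps)
  ultimately show ?thesis by (simp only:)
qed

lemma xd_q: assumes "reg t" shows "xd q ((2 * of_real u - 2 * p t) * q t + g t * (1 + e t) / (2 * of_real u)) t"
proof -
  let ?c' = "2 * Fbar 1 (B t) - \<kappa> t ^ 2 + (0 - p2 t)"
  have "xd q (1 / (2 * of_real u) * (A t * (of_real u ^ 2 * f (\<gamma> t) - 2 * \<kappa> t * y1 t + (c t * y1 t + ?c' * f (\<gamma> t)))
       + A t * c t * (y1 t + c t * f (\<gamma> t)))) t"
    unfolding q_def [abs_def] by (intro xd_cmult xd_mult xd_add xd_A xd_f\<gamma> xd_y1 xd_c assms)
  moreover have "1 / (2 * of_real u) * (A t * (of_real u ^ 2 * f (\<gamma> t) - 2 * \<kappa> t * y1 t + (c t * y1 t + ?c' * f (\<gamma> t)))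
       + A t * c t * (y1 t + c t * f (\<gamma> t))) = (2 * of_real u - 2 * p t) * q t + g t * (1 + e t) / (2 * of_real u)"
  proof -
    \<comment> \<open>With A, f, df/d\<xi>, \<kappa>, p, dp/d\<xi>, F_1 and u as independent letters
      the claim becomes a polynomial identity.\<close>
    have alg: "a * (w ^ 2 * y - 2 * k * y' + ((k + (w - P)) * y' + (2 * F - k ^ 2 + (0 - P2)) * y))
       + a * (k + (w - P)) * (y' + (k + (w - P)) * y) =
       (2 * w - 2 * P) * (a * (y' + (k + (w - P)) * y)) + (w ^ 2 + 2 * F - P2 - (P - w)^2) * (1 + (a * y - 1))"
      for a w y k y' P F P2 :: complex
      by (simp add: power2_eq_square algebra_simps)
    have "1 / w * (r + s) = x * (1 / w * z) + h / w" if "r + s = x * z + h" for r s x w z h :: complex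
      unfolding that by (simp add: add_divide_distrib)
    thus ?thesis unfolding q_def g_def e_def c_def using alg by blast
  qed
  ultimately show ?thesis by (simp only:)
qed

text \<open>A majorant of |p d\<xi>/dt|; correspondingly \<open>\<beta>\<close> majorises |g
  d\<xi>/dt| / u. Both are written in d\<beta>, so that their integrals are those of \<varpi> and
  \<omega>.\<close>

definition \<alpha> where "\<alpha> t = (\<Sum>s\<in>{1..<n}. 1 / u ^ s * norm (deriv (Ebar s) (B t) * vector_derivative B (at t)))"

definition \<beta> where "\<beta> t = 1 / u ^ n * (2 * norm (deriv (Ebar n) (B t) * vector_derivative B (at t)) +
   (\<Sum>s\<in>{1..<n}. 1 / u ^ s * norm ((\<Sum>k\<in>{s..<n}. (1 - (B t)^2)^2 * deriv (Ebar k) (B t) * deriv (Ebar (s + n - k - 1)) (B t))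
      * vector_derivative B (at t))))"

lemma continuous_on_deriv_Ebar: "continuous_on UNIV (deriv (Ebar s))"
  by (intro holomorphic_on_imp_continuous_on deriv_Ebar_holomorphic)

lemma continuous_on_EE:
  "continuous_on UNIV (\<lambda>p. \<Sum>k\<in>{s..<n}. (1 - p^2)^2 * deriv (Ebar k) p * deriv (Ebar (s + n - k - 1)) p)"
  by (intro continuous_intros continuous_on_deriv_Ebar)

text \<open>Termwise integration gives \<varpi>/(4u), so the part of the Gronwall exponent due to
  \<alpha> is one half of \<varpi>/u.\<close>

lemma integral_\<alpha>: "\<alpha> absolutely_integrable_on {0..}" "2 * integral {0..} \<alpha> \<le> varpi n u B / u"
proof -
  note abs = absolutely_integrable_along[OF continuous_on_deriv_Ebar]
  have int: "(\<lambda>t. norm (deriv (Ebar s) (B t) * vector_derivative B (at t))) integrable_on {0..}" for s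
    using abs set_lebesgue_integral_eq_integral(1) by blast
  have int': "(\<lambda>t. 1 / u ^ s * norm (deriv (Ebar s) (B t) * vector_derivative B (at t))) integrable_on {0..}" for s
    by (intro integrable_on_mult_right int)
  show a: "\<alpha> absolutely_integrable_on {0..}"
    unfolding \<alpha>_def by (intro absolutely_integrable_sum set_integrable_mult_right abs) auto
  have "integral {0..} \<alpha> = (\<Sum>s\<in>{1..<n}. 1 / u ^ s * abs_path_integral B (deriv (Ebar s)))"
    unfolding \<alpha>_def [abs_def] abs_path_integral_def
    by (subst integral_sum) (use int' in \<open>simp_all only: integral_mult_right finite_atLeastLessThan\<close>)
  also have "\<dots> = (\<Sum>s<n - 1. 1 / u ^ (s + 1) * abs_path_integral B (deriv (Ebar (s + 1))))"
    by (rule sum.reindex_bij_witness[of _ "\<lambda>s. s + 1" "\<lambda>s. s - 1"]) auto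
  also have "\<dots> = varpi n u B / u / 4"
    unfolding varpi_def using u by (simp add: sum_divide_distrib sum_distrib_left mult.commute)
  finally have eq: "integral {0..} \<alpha> = varpi n u B / u / 4" .
  moreover have "integral {0..} \<alpha> \<ge> 0"
    using a u by (intro integral_nonneg set_lebesgue_integral_eq_integral(1)) (auto simp: \<alpha>_def intro!: sum_nonneg)
  ultimately show "2 * integral {0..} \<alpha> \<le> varpi n u B / u" by simp
qed

lemma integral_\<beta>: "\<beta> absolutely_integrable_on {0..}" "integral {0..} \<beta> = omega n u B / u ^ n"
proof -
  note abs = absolutely_integrable_along[OF continuous_on_deriv_Ebar] absolutely_integrable_along[OF continuous_on_EE]
  have int: "(\<lambda>t. norm (deriv (Ebar s) (B t) * vector_derivative B (at t))) integrable_on {0..}" for s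
    using abs set_lebesgue_integral_eq_integral(1) by blast
  have int2: "(\<lambda>t. norm ((\<Sum>k\<in>{s..<n}. (1 - (B t)^2)^2 * deriv (Ebar k) (B t) * deriv (Ebar (s + n - k - 1)) (B t))
      * vector_derivative B (at t))) integrable_on {0..}" for s
    using abs(2)[of s] set_lebesgue_integral_eq_integral(1) by blast
  have int2': "(\<lambda>t. 1 / u ^ s * norm ((\<Sum>k\<in>{s..<n}. (1 - (B t)^2)^2 * deriv (Ebar k) (B t) * deriv (Ebar (s + n - k - 1)) (B t))
      * vector_derivative B (at t))) integrable_on {0..}" for s
    by (intro integrable_on_mult_right int2)
  show "\<beta> absolutely_integrable_on {0..}"
    unfolding \<beta>_def by (intro set_integral_add(1) absolutely_integrable_sum set_integrable_mult_right abs) auto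
  have s: "integral {0..} (\<lambda>t. \<Sum>s\<in>{1..<n}. 1 / u ^ s * norm ((\<Sum>k\<in>{s..<n}. (1 - (B t)^2)^2 * deriv (Ebar k) (B t) * deriv (Ebar (s + n - k - 1)) (B t))
      * vector_derivative B (at t))) = (\<Sum>s\<in>{1..<n}. 1 / u^s * abs_path_integral B
        (\<lambda>p. \<Sum>k\<in>{s..<n}. (1 - p^2)^2 * deriv (Ebar k) p * deriv (Ebar (s + n - k - 1)) p))"
    unfolding abs_path_integral_def
    by (subst integral_sum) (use int2' in \<open>simp_all only: integral_mult_right finite_atLeastLessThan\<close>)
  have i1: "(\<lambda>t. 2 * norm (deriv (Ebar n) (B t) * vector_derivative B (at t))) integrable_on {0..}"
    by (intro integrable_on_mult_right int)
  have i2: "(\<lambda>t. \<Sum>s\<in>{1..<n}. 1 / u ^ s * norm ((\<Sum>k\<in>{s..<n}. (1 - (B t)^2)^2 * deriv (Ebar k) (B t) * deriv (Ebar (s + n - k - 1)) (B t))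
      * vector_derivative B (at t))) integrable_on {0..}"
    by (rule integrable_sum) (rule finite_atLeastLessThan, rule int2')
  have "integral {0..} \<beta> = 1 / u ^ n * (integral {0..} (\<lambda>t. 2 * norm (deriv (Ebar n) (B t) * vector_derivative B (at t))) +
     integral {0..} (\<lambda>t. \<Sum>s\<in>{1..<n}. 1 / u ^ s * norm ((\<Sum>k\<in>{s..<n}. (1 - (B t)^2)^2 * deriv (Ebar k) (B t) * deriv (Ebar (s + n - k - 1)) (B t))
      * vector_derivative B (at t))))"
    unfolding \<beta>_def [abs_def] integral_mult_right
    by (subst integral_add[OF i1 i2]) (simp only: integral_mult_right)
  thus "integral {0..} \<beta> = omega n u B / u ^ n"
    unfolding s omega_def integral_mult_right by (simp add: abs_path_integral_def)
qed

lemma \<alpha>\<beta>_nonneg: "\<alpha> t \<ge> 0" "\<beta> t \<ge> 0"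
  unfolding \<alpha>_def \<beta>_def by (intro mult_nonneg_nonneg add_nonneg_nonneg sum_nonneg; use u in simp)+

lemma \<alpha>\<beta>_cont: assumes "reg t" shows "isCont \<alpha> t" "isCont \<beta> t"
proof -
  have Bt: "isCont B t" using isCont_of[OF cont_B] reg_pos[OF assms] by blast
  have E: "isCont (\<lambda>t. deriv (Ebar s) (B t)) t" for s
  proof (rule isCont_o2[OF Bt])
    show "isCont (deriv (Ebar s)) (B t)"
      using continuous_on_deriv_Ebar[of s] by (simp add: continuous_on_eq_continuous_at)
  qed
  show "isCont \<alpha> t" "isCont \<beta> t"
    unfolding \<alpha>_def [abs_def] \<beta>_def [abs_def]
    by (intro continuous_intros E Bt isCont_vector_derivative_B assms)+
qed

lemma \<alpha>_bound: assumes "reg t" shows "norm (X' t * p t) \<le> \<alpha> t"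
proof -
  have "X' t * p t = (\<Sum>s\<in>{1..<n}. deriv (Ebar s) (B t) * vector_derivative B (at t) / v ^ s)"
    unfolding p_def sum_distrib_left vector_derivative_B[OF assms] Fbar_def
    by (intro sum.cong refl) (simp add: mult_ac)
  also have "norm \<dots> \<le> (\<Sum>s\<in>{1..<n}. norm (deriv (Ebar s) (B t) * vector_derivative B (at t) / v ^ s))"
    by (rule norm_sum)
  also have "\<dots> = \<alpha> t"
    unfolding \<alpha>_def using u by (intro sum.cong refl) (simp add: norm_divide norm_power v_def)
  finally show ?thesis .
qed

text \<open>The residual identity at v = -u, multiplied by d\<xi>/dt. Each product of two F carries
  (1 - \<beta>^2)^2 twice; one of these factors turns d\<xi> into d\<beta>, the other remains in the
  integrand of \<omega>.\<close>

lemma \<beta>_bound: assumes "reg t" shows "norm (X' t * g t) / u \<le> \<beta> t"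
proof -
  let ?B' = "vector_derivative B (at t)"
  let ?S = "\<lambda>s. \<Sum>k\<in>{s..<n}. (1 - (B t)^2)^2 * deriv (Ebar k) (B t) * deriv (Ebar (s + n - k - 1)) (B t)"
  have "v^2 + 2 * Fbar 1 (B t) - p2 t - (v + p t)^2
    = 2 * Fbar n (B t) / v ^ (n - 1) - (\<Sum>s\<in>{1..<n}. (\<Sum>k\<in>{s..<n}. Fbar k (B t) * Fbar (s + n - k - 1) (B t)) / v ^ (s + n - 1))"
    unfolding p_def p2_def
  proof (rule LG_residual[OF v_nonzero n, where F = "\<lambda>s. Fbar s (B t)" and DF = "\<lambda>s. (1 - (B t)^2)^2 * deriv (Fbar s) (B t)"])
    fix s :: nat assume "s \<ge> 1"
    from Fbar_rec[OF this, of "B t"]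
    show "2 * Fbar (Suc s) (B t) + (1 - (B t)^2)^2 * deriv (Fbar s) (B t) + (\<Sum>j\<in>{1..<s}. Fbar j (B t) * Fbar (s - j) (B t)) = 0" .
  qed
  moreover have "v^2 + 2 * Fbar 1 (B t) - p2 t - (v + p t)^2 = g t"
    by (simp add: g_def v_def)
  ultimately have g: "g t = 2 * Fbar n (B t) / v ^ (n - 1) - (\<Sum>s\<in>{1..<n}. (\<Sum>k\<in>{s..<n}. Fbar k (B t) * Fbar (s + n - k - 1) (B t)) / v ^ (s + n - 1))"
    by simp
  have FF: "X' t * (\<Sum>k\<in>{s..<n}. Fbar k (B t) * Fbar (s + n - k - 1) (B t)) = ?S s * ?B'" for s
  proof -
    have gen: "x * (w * a * (w * d)) = w * a * d * (x * w)" for x w a d :: complex by (simp add: mult_ac)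
    have "X' t * (\<Sum>k\<in>{s..<n}. Fbar k (B t) * Fbar (s + n - k - 1) (B t)) =
        (\<Sum>k\<in>{s..<n}. X' t * (Fbar k (B t) * Fbar (s + n - k - 1) (B t)))" by (rule sum_distrib_left)
    also have "\<dots> = (\<Sum>k\<in>{s..<n}. (1 - (B t)^2)^2 * deriv (Ebar k) (B t) * deriv (Ebar (s + n - k - 1)) (B t) * ?B')"
      unfolding Fbar_def vector_derivative_B[OF assms] by (rule sum.cong[OF refl]) (rule gen)
    also have "\<dots> = ?S s * ?B'" by (rule sum_distrib_right [symmetric])
    finally show ?thesis .
  qed
  have Fn: "X' t * Fbar n (B t) = deriv (Ebar n) (B t) * ?B'"
    unfolding Fbar_def vector_derivative_B[OF assms] by (simp only: mult_ac)
  show ?thesis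
    unfolding \<beta>_def g v_def by (rule residual_norm_bound[OF u n Fn FF])
qed

lemma e_tail: "\<forall>\<^sub>F t in at_top. e t = LG_ratio n u (\<gamma> t) - 1"
  using tail
proof eventually_elim
  case (elim t)
  hence "Q t ^ 2 = xsqrt (\<gamma> t)" by blast
  hence "B t = \<gamma> t / xsqrt (\<gamma> t)" by (simp add: B_eq)
  thus ?case using elim by (simp add: e_def A_def f_def LG_ratio_def mult_ac)
qed

lemma e_tendsto: "(e \<longlongrightarrow> 0) at_top"
proof -
  have "((\<lambda>t. LG_ratio n u (\<gamma> t)) \<longlongrightarrow> 1) at_top"
    by (rule filterlim_compose[OF LG_ratio_tendsto_1[OF u] filterlim_\<gamma>])
  hence "((\<lambda>t. LG_ratio n u (\<gamma> t) - 1) \<longlongrightarrow> 1 - 1) at_top" by (intro tendsto_intros)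
  moreover have "\<forall>\<^sub>F t in at_top. LG_ratio n u (\<gamma> t) - 1 = e t" using e_tail by eventually_elim simp
  ultimately show ?thesis by (simp add: Lim_transform_eventually)
qed

text \<open>Far out 2uq is the z-derivative of \<open>LG_ratio\<close> times dz/d\<xi>. The first
  factor is small, and |dz/d\<xi>| = 1/|Q|^2 \<le> 1 as soon as Re z > 2.\<close>

lemma q_tendsto: "(q \<longlongrightarrow> 0) at_top"
proof (rule tendstoI)
  fix \<epsilon> :: real assume \<epsilon>: "\<epsilon> > 0"
  define \<delta> where "\<delta> = \<epsilon> * u"
  have \<delta>: "\<delta> > 0" using \<epsilon> u by (simp add: \<delta>_def)
  obtain b where b: "\<And>z. Re z > b \<Longrightarrow> norm (deriv (LG_ratio n u) z) \<le> \<delta>"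
    using deriv_LG_ratio_small[OF u \<delta>] by metis
  have ev1: "\<forall>\<^sub>F t in at_top. Re (\<gamma> t) > max 2 b" using filterlim_Re unfolding filterlim_at_top_dense by blast
  obtain M where M: "\<And>t. t \<ge> M \<Longrightarrow> e t = LG_ratio n u (\<gamma> t) - 1" using e_tail by (auto simp: eventually_at_top_linorder)
  show "\<forall>\<^sub>F t in at_top. dist (q t) 0 < \<epsilon>"
    using ev1 eventually_reg_at_top eventually_gt_at_top[of M]
  proof eventually_elim
    case (elim t)
    have t0: "t \<ge> 0" using reg_pos[OF elim(2)] by simp
    have der: "(LG_ratio n u has_field_derivative deriv (LG_ratio n u) (\<gamma> t)) (at (\<gamma> t))"
      using LG_ratio_holomorphic[OF u] elim(1) by (intro holomorphic_derivI[OF _ open_halfspace_Re_gt[of 0]]) auto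
    have "xd (\<lambda>t. LG_ratio n u (\<gamma> t) - 1) (deriv (LG_ratio n u) (\<gamma> t) * (1 / Q t ^ 2) - 0) t"
      by (intro xd_diff xd_const xd_comp[OF xd_\<gamma>[OF elim(2)] der])
    hence "xd e (deriv (LG_ratio n u) (\<gamma> t) * (1 / Q t ^ 2) - 0) t"
      unfolding xd_def by (rule has_vector_derivative_transform_within_open[of _ _ _ "{M<..}"]) (use elim M in auto)
    moreover have "xd e (2 * of_real u * q t) t" by (rule xd_e[OF elim(2)])
    ultimately have "X' t * (deriv (LG_ratio n u) (\<gamma> t) * (1 / Q t ^ 2) - 0) = X' t * (2 * of_real u * q t)"
      unfolding xd_def by (rule vector_derivative_unique_at)
    \<comment> \<open>Two formulas for the derivative of e are compared; d\<xi>/dt can be cancelled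
      because the arcs have nonvanishing tangents and avoid the branch points.\<close>
    moreover have "X' t \<noteq> 0" using deriv_\<gamma>(2)[OF elim(2)] Q_nonzero[OF t0] by (simp add: X'_def)
    ultimately have "deriv (LG_ratio n u) (\<gamma> t) * (1 / Q t ^ 2) - 0 = 2 * of_real u * q t"
      by (simp only: mult_cancel_left) simp
    hence "2 * of_real u * q t = deriv (LG_ratio n u) (\<gamma> t) * (1 / Q t ^ 2)" by simp
    hence "norm (2 * of_real u * q t) = norm (deriv (LG_ratio n u) (\<gamma> t)) * (1 / norm (Q t) ^ 2)"
      by (simp add: norm_mult norm_divide norm_power)
    also have "\<dots> \<le> \<delta> * 1"
    proof (intro mult_mono)
      have "norm (\<gamma> t) > 2" using elim(1) complex_Re_le_cmod[of "\<gamma> t"] by simp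
      hence "norm (\<gamma> t) * norm (\<gamma> t) \<ge> 2 * 2" by (intro mult_mono) auto
      hence "norm (\<gamma> t ^ 2) \<ge> 2 * 2" by (simp add: norm_mult power2_eq_square)
      moreover have "norm (\<gamma> t ^ 2) \<le> norm (1 + \<gamma> t ^ 2) + 1"
        using norm_triangle_ineq4[of "1 + \<gamma> t ^ 2" 1] by simp
      ultimately have "1 \<le> norm (1 + \<gamma> t ^ 2)" by simp
      also have "\<dots> = (norm (Q t) ^ 2) ^ 2" using Q4[OF t0] by (metis norm_power numeral_Bit0_eq_double power_mult mult_2 mult.commute semiring_norm(2) numeral_times_numeral)
      finally have "1 \<le> norm (Q t) ^ 2" by (metis one_power2 power2_le_imp_le zero_le_power2)
      thus "1 / norm (Q t) ^ 2 \<le> 1" by (simp add: divide_le_eq)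
    qed (use b elim \<delta> in auto)
    finally have "2 * u * norm (q t) \<le> \<epsilon> * u" using u by (simp add: norm_mult \<delta>_def)
    hence "u * (2 * norm (q t)) \<le> u * \<epsilon>" by (simp add: mult_ac)
    hence "2 * norm (q t) \<le> \<epsilon>" using u by simp
    moreover have "norm (q t) \<ge> 0" by simp
    ultimately show ?case using \<epsilon> by (simp add: dist_norm) 
  qed
qed

lemma main_bound: "norm (e 0) \<le> error_bound n u B"
proof -
  have fc: "continuous_on UNIV h" if "\<And>z. (h has_field_derivative h' z) (at z)" for h h' :: "complex \<Rightarrow> complex"
    using that by (intro continuous_at_imp_continuous_on ballI DERIV_isCont) auto
  have cf: "continuous_on {0..} (\<lambda>t. h (\<gamma> t))" if "continuous_on UNIV h" for h :: "complex \<Rightarrow> complex"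
    by (rule continuous_on_compose2[OF that cont_\<gamma>]) auto
  have cLG: "continuous_on {0..} (\<lambda>t. LG_correction n u (B t))"
    by (rule continuous_on_compose2[OF holomorphic_on_imp_continuous_on[OF LG_correction_holomorphic] cont_B]) auto
  have cF: "continuous_on {0..} (\<lambda>t. Fbar s (B t))" for s
    by (rule continuous_on_compose2[OF fc[OF Fbar_has_field_derivative] cont_B]) auto
  have cf0: "continuous_on {0..} (\<lambda>t. f (\<gamma> t))" and cf1: "continuous_on {0..} (\<lambda>t. f1 (\<gamma> t))"
    by (rule cf[OF fc[OF f_derivs(1)]], rule cf[OF fc[OF f_derivs(2)]])
  have cA: "continuous_on {0..} A"
    unfolding A_def [abs_def]
    by (intro continuous_intros cont_Q cont_X cLG)
  have cc: "continuous_on {0..} c"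
    unfolding c_def [abs_def] \<kappa>_def p_def using Q_nonzero v_nonzero
    by (intro continuous_intros cont_\<gamma> cont_Q cF) auto
  have ce: "continuous_on {0..} e"
    unfolding e_def [abs_def] by (intro continuous_intros cA cf0)
  have cq: "continuous_on {0..} q"
    unfolding q_def [abs_def] y1_def using Q_nonzero
    by (intro continuous_intros cA cc cont_Q cf0 cf1) auto
  have "norm (e 0) \<le> integral {0..} \<beta> * exp (2 * integral {0..} \<alpha> + integral {0..} \<beta>)"
  proof (rule volterra_bound[where q = q and e = e and x = X and x' = X' and p = p and g = g and u = u and T = T])
    show "mono_on {0..} (\<lambda>t. Re (X t))" using adm by (simp add: admissible_to_def)
    show "0 \<le> \<alpha> t" "0 \<le> \<beta> t" for t by (rule \<alpha>\<beta>_nonneg)+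
    fix t assume "t > 0" "t \<notin> T"
    hence r: "reg t" by (simp add: reg_def)
    show "(X has_vector_derivative X' t) (at t)" using xd_X[OF r] by (simp add: xd_def)
    show "(q has_vector_derivative X' t * ((2 * of_real u - 2 * p t) * q t + g t * (1 + e t) / (2 * of_real u))) (at t)"
      using xd_q[OF r] by (simp add: xd_def)
    show "(e has_vector_derivative X' t * (2 * of_real u * q t)) (at t)" using xd_e[OF r] by (simp add: xd_def)
    show "isCont \<alpha> t" "isCont \<beta> t" by (rule \<alpha>\<beta>_cont[OF r])+
    show "norm (X' t * p t) \<le> \<alpha> t" by (rule \<alpha>_bound[OF r])
    show "norm (X' t * g t) / u \<le> \<beta> t" by (rule \<beta>_bound[OF r])
  qed (use u T(1) ce cq cont_X integral_\<alpha>(1) integral_\<beta>(1) e_tendsto q_tendsto in auto)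
  also have "\<dots> \<le> error_bound n u B"
    unfolding error_bound_def integral_\<beta>(2)
  proof (intro mult_left_mono)
    show "exp (2 * integral {0..} \<alpha> + omega n u B / u ^ n) \<le> exp (varpi n u B / u + omega n u B / u ^ n)"
      using integral_\<alpha>(2) by simp
    have "integral {0..} \<beta> \<ge> 0"
      by (intro integral_nonneg set_lebesgue_integral_eq_integral(1)[OF integral_\<beta>(1)] \<alpha>\<beta>_nonneg)
    thus "0 \<le> omega n u B / u ^ n" by (simp add: integral_\<beta>(2))
  qed
  finally show ?thesis .
qed

lemma pcfU_representation:
  shows "\<exists>\<eta>. pcfU (of_real (u / 2)) (of_real (sqrt (2 * u)) * z) =
            of_real ((2 * exp 1 / u) powr (u / 4)) * (1 / (of_real ((2 * u) powr (1/4)) * Q 0)) *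
            exp (- of_real u * X 0 +
                 (\<Sum>s\<in>{1..<n}. (-1)^s * (Ebar s (beta_along \<gamma> Q 0) - Ebar s 1) / of_real u ^ s)) *
            (1 + \<eta>) \<and>
          norm \<eta> \<le> error_bound n u (beta_along \<gamma> Q)"
proof -
  define P where "P = pcfU (of_real (u / 2)) (of_real (sqrt (2 * u)) * z)"
  define L where "L = LG_correction n u (B 0)"
  define a where "a = complex_of_real ((2 * u) powr (1/4))"
  define b where "b = complex_of_real ((2 * exp 1 / u) powr (u / 4))"
  define \<eta> where "\<eta> = a / b * (Q 0 * exp (of_real u * X 0 - L)) * P - 1"
  have \<gamma>0: "\<gamma> 0 = z" using adm by (simp add: admissible_to_def)
  have pre: "LG_prefactor u = a / b" 
    by (simp only: LG_prefactor_def a_def b_def powr_minus of_real_mult of_real_inverse divide_inverse)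
  have "e 0 = \<eta>"
    unfolding e_def A_def f_def \<gamma>0 \<eta>_def pre L_def P_def by simp
  hence "norm \<eta> \<le> error_bound n u (beta_along \<gamma> Q)" using main_bound by (simp add: B_def)
  moreover have "P = b * (1 / (a * Q 0)) * exp (- of_real u * X 0 + L) * (1 + \<eta>)"
  proof -
    have "a \<noteq> 0" "b \<noteq> 0" using u by (simp_all add: a_def b_def)
    moreover have "Q 0 \<noteq> 0" by (rule Q_nonzero) simp
    moreover have "exp (of_real u * X 0 - L) * exp (- of_real u * X 0 + L) = 1" by (simp flip: exp_add)
    hence "exp (- of_real u * X 0 + L) = 1 / exp (of_real u * X 0 - L)" by (simp add: field_simps)
    ultimately show ?thesis by (simp add: \<eta>_def)
  qed
  ultimately show ?thesis unfolding P_def a_def b_def L_def LG_correction_alt B_def by blast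
qed

end
end

section \<open>The exceptional set\<close>

text \<open>With \<open>v = z + (1 + z\<^sup>2)\<^bsup>1/2\<^esup> = exp w\<close>, where \<open>z = sinh w\<close>, the real part of \<open>\<xi>\<close> is a single-valued
  function of \<open>v\<close> on all sheets.\<close>

definition Re_xi :: "complex \<Rightarrow> real" where
  "Re_xi v = ln (norm v) / 2 + Re (v^2 - 1 / v^2) / 8"

text \<open>The real part of \<xi> = w/2 + sinh(2w)/4 in the coordinates w = p + iq.\<close>

definition hxi :: "real \<Rightarrow> real \<Rightarrow> real" where
  "hxi p q = p / 2 + sinh (2 * p) * cos (2 * q) / 4"

lemma sinh_gt_self: "sinh x > x" if "x > 0" for x :: real
proof -
  have "(\<lambda>x. sinh x - x) 0 < (\<lambda>x. sinh x - x) x"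
  proof (rule DERIV_pos_imp_increasing_open[OF that])
    fix y :: real assume "0 < y" "y < x"
    hence "((\<lambda>x. sinh x - x) has_real_derivative cosh y - 1) (at y)" "cosh y - 1 > 0"
      using cosh_real_strict_mono[of 0 y] by (auto intro!: derivative_eq_intros)
    thus "\<exists>d. ((\<lambda>x. sinh x - x) has_real_derivative d) (at y) \<and> d > 0" by blast
  qed (intro continuous_intros)
  thus ?thesis by simp
qed

lemma Re_xi_exp: "Re_xi (exp w) = hxi (Re w) (Im w)"
proof -
  have 1: "(exp w)^2 = exp (2 * w)" by (simp add: exp_double)
  have 2: "1 / exp (2 * w) = exp (- (2 * w))" by (simp add: exp_minus inverse_eq_divide)
  have "Re ((exp w)^2 - 1 / (exp w)^2) = (exp (2 * Re w) - exp (- (2 * Re w))) * cos (2 * Im w)"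
    unfolding 1 2 by (simp add: Re_exp algebra_simps)
  thus ?thesis by (simp add: Re_xi_def hxi_def sinh_def)
qed

text \<open>The derivative in p is (1 + cosh 2p cos 2q)/2. If it is positive at p it is positive all
  the way to p = 0, where \<open>hxi\<close> vanishes.\<close>

lemma hxi_neg_near:
  assumes "p < 0" "cosh (2 * p) * cos (2 * q) > -1"
  shows "hxi p q < 0"
proof -
  have "hxi p q < hxi 0 q"
  proof (rule DERIV_pos_imp_increasing_open[OF assms(1)])
    fix x assume x: "p < x" "x < 0"
    have "1 / 2 + cosh (2 * x) * cos (2 * q) / 2 > 0"
    proof (cases "cos (2 * q) \<ge> 0")
      case False
      have "cosh (2 * x) < cosh (2 * p)" using x by (simp add: cosh_real_nonpos_less_iff)
      hence "cosh (2 * x) * cos (2 * q) > cosh (2 * p) * cos (2 * q)"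
        using False by (intro mult_strict_right_mono_neg) auto
      thus ?thesis using assms(2) by simp
    qed (simp add: add_pos_nonneg)
    moreover have "((\<lambda>p. hxi p q) has_real_derivative 1 / 2 + cosh (2 * x) * cos (2 * q) / 2) (at x)"
      unfolding hxi_def by (auto intro!: derivative_eq_intros)
    ultimately show "\<exists>d. ((\<lambda>p. hxi p q) has_real_derivative d) (at x) \<and> d > 0" by blast
  qed (auto simp: hxi_def intro!: continuous_intros)
  thus ?thesis by (simp add: hxi_def)
qed

text \<open>At the point of the circle p = 0 and cos 2q > -1, so the criterion cosh 2p cos 2q > -1
  holds strictly there; by continuity it persists nearby, and inside the circle p < 0.\<close>

lemma Re_xi_neg_inside:
  assumes "norm v\<^sub>0 = 1" "Re v\<^sub>0 > 0"
  shows "\<forall>\<^sub>F v in nhds v\<^sub>0. norm v < 1 \<longrightarrow> Re_xi v < 0"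
proof -
  \<comment> \<open>The quantity cosh 2p cos 2q, written in v so that its continuity needs no
    logarithm.\<close>
  define F where "F v = (norm v ^ 2 + 1 / norm v ^ 2) / 2 * (Re (v^2) / norm v ^ 2)" for v :: complex
  have v0: "v\<^sub>0 \<noteq> 0" using assms by auto
  have "Re (v\<^sub>0^2) > -1"
  proof -
    have "Re v\<^sub>0 ^ 2 + Im v\<^sub>0 ^ 2 = 1" using assms(1) by (metis cmod_power2 one_power2)
    moreover have "Re v\<^sub>0 ^ 2 > 0" using assms(2) by simp
    ultimately show ?thesis by (simp add: power2_eq_square)
  qed
  hence "F v\<^sub>0 > -1" using assms by (simp add: F_def)
  moreover have "isCont F v\<^sub>0"
    unfolding F_def using v0 by (intro continuous_intros) auto
  hence "(F \<longlongrightarrow> F v\<^sub>0) (nhds v\<^sub>0)" unfolding isCont_def tendsto_at_iff_tendsto_nhds[of F] .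
  ultimately have "\<forall>\<^sub>F v in nhds v\<^sub>0. F v > -1" by (simp add: order_tendstoD)
  moreover have "\<forall>\<^sub>F v in nhds v\<^sub>0. v \<noteq> 0" using v0 by (simp add: t1_space_nhds)
  ultimately show ?thesis
  proof eventually_elim
    case (elim v)
    show ?case
    proof
      assume v: "norm v < 1"
      define w where "w = Ln v"
      have vw: "v = exp w" using elim by (simp add: w_def)
      have p: "Re w < 0" using v unfolding vw by simp
      have "norm v ^ 2 + 1 / norm v ^ 2 = 2 * cosh (2 * Re w)"
        unfolding vw by (simp add: cosh_def exp_minus exp_double inverse_eq_divide)
      moreover have "Re (v^2) / norm v ^ 2 = cos (2 * Im w)"
      proof -
        have "Re (v^2) = norm v ^ 2 * cos (2 * Im w)"
        proof -
          have "(exp w)^2 = exp (2 * w)" "norm (exp w)^2 = exp (2 * Re w)" by (simp_all add: exp_double)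
          thus ?thesis unfolding vw by (simp only: Re_exp) simp
        qed
        thus ?thesis using elim by simp
      qed
      ultimately have "cosh (2 * Re w) * cos (2 * Im w) > -1" using elim(1) by (simp add: F_def)
      from hxi_neg_near[OF p this] show "Re_xi v < 0" unfolding vw Re_xi_exp .
    qed
  qed
qed

text \<open>On the imaginary axis cos 2q = -1, and p > 0 gives 4 Re \<xi> = 2p - sinh 2p <
  0.\<close>

lemma Re_xi_imaginary:
  assumes "Re v = 0" "norm v > 1"
  shows "Re_xi v < 0"
proof -
  define w where "w = Ln v"
  have v0: "v \<noteq> 0" using assms by auto
  have vw: "v = exp w" using v0 by (simp add: w_def)
  have p: "Re w > 0" using assms(2) unfolding vw by simp
  have "cos (Im w) = 0" using assms(1) unfolding vw by (simp add: Re_exp)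
  hence "cos (2 * Im w) = -1" by (simp add: cos_double_cos)
  hence "Re_xi v = (2 * Re w - sinh (2 * Re w)) / 4" unfolding vw Re_xi_exp hxi_def by simp
  thus ?thesis using sinh_gt_self[of "2 * Re w"] p by simp
qed

text \<open>Since z + s and s - z are reciprocal, passing to the root -s replaces v by -1/v; that
  reverses the sign of ln |v| and of v^2 - 1/v^2.\<close>

lemma Re_xi_add:
  assumes "s^2 = 1 + z^2"
  shows "z + s \<noteq> 0" "Re_xi (z + s) = (ln (norm (z + s)) + Re (z * s)) / 2"
    "Re_xi (z - s) = - Re_xi (z + s)"
proof -
  have 1: "(z + s) * (s - z) = 1" using assms by (simp add: algebra_simps power2_eq_square)
  thus nz: "z + s \<noteq> 0" by auto
  have inv: "1 / (z + s) = s - z" using 1 nz by (simp add: field_simps)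
  have "(z + s)^2 - 1 / (z + s)^2 = (z + s)^2 - (1 / (z + s))^2" by (simp add: power_divide)
  also have "\<dots> = 4 * (z * s)" unfolding inv by (simp add: power2_eq_square algebra_simps)
  finally show a: "Re_xi (z + s) = (ln (norm (z + s)) + Re (z * s)) / 2" by (simp add: Re_xi_def)
  have nz2: "z - s \<noteq> 0" using 1 by auto
  have inv2: "1 / (z - s) = - (z + s)" using 1 nz2 by (simp add: field_simps)
  have "(z - s)^2 - 1 / (z - s)^2 = (z - s)^2 - (1 / (z - s))^2" by (simp add: power_divide)
  also have "\<dots> = - (4 * (z * s))" unfolding inv2 by (simp add: power2_eq_square algebra_simps)
  finally have b: "Re_xi (z - s) = (ln (norm (z - s)) - Re (z * s)) / 2" by (simp add: Re_xi_def)
  have "norm (z + s) * norm (z - s) = 1" using 1 by (metis norm_minus_commute norm_mult norm_one)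
  moreover have "ln (norm (z + s) * norm (z - s)) = ln (norm (z + s)) + ln (norm (z - s))"
    by (rule ln_mult_pos) (use nz nz2 in auto)
  ultimately have "ln (norm (z + s)) + ln (norm (z - s)) = 0" by simp
  hence "ln (norm (z - s)) = - ln (norm (z + s))" by simp
  thus "Re_xi (z - s) = - Re_xi (z + s)" unfolding a b by (simp only:) (simp only: minus_divide_left minus_add_distrib diff_conv_add_uminus)
qed

lemma Re_xibar_eq: "z \<in> cut_plane \<Longrightarrow> Re (xibar z) = Re_xi (z + xsqrt z)"
  using Re_xi_add[OF xsqrt_square[of z]] by (simp add: xibar_eq xibar_closed_def)

section \<open>Paths that start with Re \<xi> \<ge> 0\<close>

context admissible_right
begin

definition V where "V t = \<gamma> t + Q t ^ 2"

lemma V_sqrt: "t \<ge> 0 \<Longrightarrow> (Q t ^ 2)^2 = 1 + \<gamma> t ^ 2"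
  using Q4[of t] by (simp flip: power_mult)

lemma V_nonzero: "t \<ge> 0 \<Longrightarrow> V t \<noteq> 0"
  unfolding V_def by (rule Re_xi_add(1)[OF V_sqrt])

lemma cont_V: "continuous_on {0..} V"
  unfolding V_def by (intro continuous_intros cont_\<gamma> cont_Q)

text \<open>The relation 2\<xi> = zs + log v, exponentiated so that no branch of the logarithm has
  to be followed: the product has derivative 0 along the path and equals 1 far out.\<close>

lemma V_eq: assumes "t \<ge> 0" shows "V t * exp (\<gamma> t * Q t ^ 2 - 2 * X t) = 1"
proof -
  define E where "E t = V t * exp (\<gamma> t * Q t ^ 2 - 2 * X t)" for t
  have xdE: "xd E 0 t" if r: "reg t" for t
  proof -
    have Q0: "Q t \<noteq> 0" "t \<ge> 0" using reg_pos[OF r] Q_nonzero by auto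
    have Q2: "xd (\<lambda>t. Q t ^ 2) (\<gamma> t / Q t ^ 4) t"
    proof -
      have "((\<lambda>w. w ^ 2) has_field_derivative 2 * Q t) (at (Q t))" by (auto intro!: derivative_eq_intros)
      from xd_comp[OF xd_Q[OF r] this] show ?thesis
        by (rule xd_eq) (use Q0 in \<open>simp add: field_simps eval_nat_numeral\<close>)
    qed
    let ?F = "\<lambda>t. exp (\<gamma> t * Q t ^ 2 - 2 * X t)"
    have "xd (\<lambda>t. V t * ?F t) (V t * (?F t * (\<gamma> t * (\<gamma> t / Q t ^ 4) + 1 / Q t ^ 2 * Q t ^ 2 - 2 * 1)) + (1 / Q t ^ 2 + \<gamma> t / Q t ^ 4) * ?F t) t"
      unfolding V_def
      by (intro xd_mult xd_add xd_\<gamma> Q2 r xd_comp[OF _ DERIV_exp] xd_diff xd_cmult xd_X)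
    moreover have "V t * (?F t * (\<gamma> t * (\<gamma> t / Q t ^ 4) + 1 / Q t ^ 2 * Q t ^ 2 - 2 * 1)) + (1 / Q t ^ 2 + \<gamma> t / Q t ^ 4) * ?F t = 0"
    proof -
      have "1 / Q t ^ 2 + \<gamma> t / Q t ^ 4 = V t * (1 / Q t ^ 4)"
        using Q0 by (simp add: V_def field_simps eval_nat_numeral)
      moreover have "\<gamma> t * (\<gamma> t / Q t ^ 4) + 1 / Q t ^ 2 * Q t ^ 2 - 2 * 1 = - (1 / Q t ^ 4)"
      proof -
        have "\<gamma> t * (\<gamma> t / Q t ^ 4) = (Q t ^ 4 - 1) / Q t ^ 4" unfolding Q4[OF Q0(2)] by (simp add: power2_eq_square)
        also have "\<dots> = 1 - 1 / Q t ^ 4" using Q0 by (simp add: diff_divide_distrib)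
        finally show ?thesis using Q0 by simp
      qed
      ultimately show ?thesis by (simp only:) (simp add: algebra_simps)
    qed
    ultimately have "xd (\<lambda>t. V t * ?F t) 0 t" by (simp only:)
    moreover have "E = (\<lambda>t. V t * ?F t)" by (simp add: fun_eq_iff E_def)
    ultimately show ?thesis by (simp only:)
  qed
  have const: "E b = E 0" if "b \<ge> 0" for b
  proof -
    have "((\<lambda>_. 0) has_integral E b - E 0) {0..b}"
    proof (rule fundamental_theorem_of_calculus_interior_strong[OF T(1) that])
      show "continuous_on {0..b} E"
        unfolding E_def by (intro continuous_intros continuous_on_subset[OF cont_V] continuous_on_subset[OF cont_\<gamma>]
          continuous_on_subset[OF cont_Q] continuous_on_subset[OF cont_X]) auto
      fix t assume "t \<in> {0<..<b} - T"
      hence "reg t" by (simp add: reg_def)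
      from xdE[OF this] show "(E has_vector_derivative 0) (at t)" by (simp add: xd_def)
    qed
    thus ?thesis by (simp add: has_integral_0_eq)
  qed
  obtain b where b: "b \<ge> 0" "Re (\<gamma> b) > 0" "Q b ^ 2 = xsqrt (\<gamma> b)" "X b = xibar (\<gamma> b)"
  proof -
    have "\<forall>\<^sub>F t in at_top. t \<ge> 0 \<and> Re (\<gamma> t) > 0 \<and> Q t ^ 2 = xsqrt (\<gamma> t) \<and> X t = xibar (\<gamma> t)"
      using tail eventually_ge_at_top[of 0] by eventually_elim auto
    thus ?thesis using that by (auto simp: eventually_at_top_linorder)
  qed
  have "\<gamma> b \<in> cut_plane" using b(2) by (simp add: cut_plane_iff)
  hence "\<gamma> b * Q b ^ 2 - 2 * X b = - Ln (V b)"
  proof -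
    have half: "2 * (w / 2) = w" for w :: complex by simp
    show ?thesis unfolding V_def b(3) b(4) xibar_eq[OF \<open>\<gamma> b \<in> cut_plane\<close>] xibar_closed_def half by simp
  qed
  hence "E b = 1" using V_nonzero[OF b(1)] by (simp add: E_def exp_minus)
  hence "E t = 1" using const[OF b(1)] const[OF assms] by simp
  thus ?thesis by (simp add: E_def)
qed

lemma Re_X_eq: assumes "t \<ge> 0" shows "Re (X t) = Re_xi (V t)"
proof -
  have "norm (V t) * exp (Re (\<gamma> t * Q t ^ 2 - 2 * X t)) = 1"
    using V_eq[OF assms] by (metis norm_exp_eq_Re norm_mult norm_one)
  hence "ln (norm (V t)) + Re (\<gamma> t * Q t ^ 2 - 2 * X t) = 0"
    using V_nonzero[OF assms] by (metis ln_exp ln_mult_pos ln_one exp_gt_zero zero_less_norm_iff)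
  thus ?thesis using Re_xi_add(2)[OF V_sqrt[OF assms]] by (simp add: V_def)
qed

lemma V_not_branch: assumes "t \<ge> 0" shows "V t \<noteq> \<i>" "V t \<noteq> - \<i>"
proof -
  have g: "\<gamma> t \<noteq> \<i>" "\<gamma> t \<noteq> - \<i>" using adm assms by (auto simp: admissible_to_def)
  have eq: "V t * (Q t ^ 2 - \<gamma> t) = 1"
    using V_sqrt[OF assms] by (simp add: V_def algebra_simps power2_eq_square)
  show "V t \<noteq> \<i>"
  proof
    assume v: "V t = \<i>"
    hence Q2: "Q t ^ 2 = \<i> - \<gamma> t" by (simp add: V_def algebra_simps)
    have "\<gamma> t = \<i>" using eq unfolding v Q2 by (auto simp: complex_eq_iff)
    thus False using g by simp
  qed
  show "V t \<noteq> - \<i>"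
  proof
    assume v: "V t = - \<i>"
    hence Q2: "Q t ^ 2 = - \<i> - \<gamma> t" by (simp add: V_def algebra_simps)
    have "\<gamma> t = - \<i>" using eq unfolding v Q2 by (auto simp: complex_eq_iff)
    thus False using g by simp
  qed
qed

text \<open>If \<open>Re \<xi> \<ge> 0\<close> at the start, then going backwards from \<open>Re z = +\<infinity>\<close> the path stays on the sheet of
  the right half plane: it could leave it only across the imaginary \<open>v\<close>-axis or inwards across the right half of
  the unit circle, and \<open>Re \<xi> < 0\<close> just beyond both.\<close>

lemma stays_right:
  assumes X0: "Re (X 0) \<ge> 0" and b: "b \<ge> 0"
  shows "norm (V b) \<ge> 1 \<and> Re (V b) > 0"
proof -
  \<comment> \<open>In the variable v = exp w this is the sheet Re w \<ge> 0, |Im w| < \<pi>/2.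
    Membership is shown to be locally constant along the half line, which is connected, and it holds
    far out.\<close>
  define P where "P t \<longleftrightarrow> norm (V t) \<ge> 1 \<and> Re (V t) > 0" for t
  have H: "Re_xi (V t) \<ge> 0" if "t \<ge> 0" for t
  proof -
    have "mono_on {0..} (\<lambda>t. Re (X t))" using adm by (simp add: admissible_to_def)
    hence "Re (X 0) \<le> Re (X t)" using that by (auto simp: mono_on_def)
    thus ?thesis using X0 Re_X_eq[OF that] by simp
  qed
  have loc: "\<forall>\<^sub>F s in at t within {0..}. P t = P s" if "t \<in> {0..}" for t
  proof -
    let ?N = "at t within {0..}"
    have t: "t \<ge> 0" using that by simp
    have lim: "(V \<longlongrightarrow> V t) ?N" using cont_V that by (simp add: continuous_on)
    have evn: "\<forall>\<^sub>F s in ?N. Q (V s)" if "\<forall>\<^sub>F v in nhds (V t). Q v" for Q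
      using lim that by (auto simp: filterlim_iff)
    have limn: "((\<lambda>s. norm (V s)) \<longlongrightarrow> norm (V t)) ?N" and limr: "((\<lambda>s. Re (V s)) \<longlongrightarrow> Re (V t)) ?N"
      using lim by (auto intro: tendsto_intros)
    have inN: "\<forall>\<^sub>F s in ?N. s \<in> {0..}" by (simp add: eventually_at_filter)
    consider "norm (V t) > 1" "Re (V t) > 0" | "norm (V t) = 1" "Re (V t) > 0" | "norm (V t) < 1" | "Re (V t) < 0"
      | "norm (V t) \<ge> 1" "Re (V t) = 0" by linarith
    thus ?thesis
    proof cases
      case 1
      from order_tendstoD(1)[OF limn 1(1)] order_tendstoD(1)[OF limr 1(2)] show ?thesis
        by eventually_elim (use 1 in \<open>auto simp: P_def\<close>)
    next
      case 2
      from order_tendstoD(1)[OF limr 2(2)] evn[OF Re_xi_neg_inside[OF 2]] inN show ?thesis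
      proof eventually_elim
        case (elim s)
        hence "\<not> norm (V s) < 1" using H[of s] by auto
        thus ?case using elim 2 by (auto simp: P_def)
      qed
    next
      case 3
      from order_tendstoD(2)[OF limn 3] show ?thesis by eventually_elim (use 3 in \<open>auto simp: P_def\<close>)
    next
      case 4
      from order_tendstoD(2)[OF limr 4] show ?thesis by eventually_elim (use 4 in \<open>auto simp: P_def\<close>)
    next
      case 5
      \<comment> \<open>On the imaginary axis Re \<xi> \<ge> 0 leaves only v = i and v = -i, the
        branch points, which the path avoids.\<close>
      have "\<not> norm (V t) > 1" using Re_xi_imaginary[OF 5(2)] H[OF t] by auto
      hence "norm (V t) = 1" using 5 by simp
      hence "\<bar>Im (V t)\<bar> = 1" using 5(2) by (simp add: cmod_def)
      hence "V t = \<i> \<or> V t = - \<i>" using 5(2) by (auto simp: complex_eq_iff)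
      thus ?thesis using V_not_branch[OF t] by blast
    qed
  qed
  have "\<forall>\<^sub>F t in at_top. t \<ge> 0 \<and> P t"
    using tail eventually_ge_at_top[of 0]
  proof eventually_elim
    case (elim t)
    hence "Re (xsqrt (\<gamma> t)) > 0" by (intro Re_xsqrt_pos) (simp add: cut_plane_iff)
    moreover have q2: "Q t ^ 2 = xsqrt (\<gamma> t)" using elim by blast
    ultimately show ?case unfolding P_def V_def q2 using elim xsqrt_bounds_right(2)[of "\<gamma> t"] by simp
  qed
  then obtain a where a: "a \<ge> 0" "P a" by (auto simp: eventually_at_top_linorder)
  have "P a = P b"
    by (rule connected_local_const[of "{0..}"]) (use a b loc in auto)
  thus ?thesis using a by (simp add: P_def)
qed

text \<open>Where Re \<xi> = 0 it vanishes on both sheets, so whichever root the path starts with,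
  Re (X 0) \<ge> 0, and v starts in |v| \<ge> 1, Re v > 0. But there 2z = v - 1/v has nonnegative
  real part.\<close>

lemma start_not_on_left_level_curve:
  assumes "Re z < 0"
  shows "Re (xibar z) \<noteq> 0"
proof
  assume 0: "Re (xibar z) = 0"
  have z: "\<gamma> 0 = z" using adm by (simp add: admissible_to_def)
  have c: "z \<in> cut_plane" using assms by (simp add: cut_plane_iff)
  have xi0: "Re_xi (z + xsqrt z) = 0" using 0 Re_xibar_eq[OF c] by simp
  have "(Q 0 ^ 2)^2 = (xsqrt z)^2" using V_sqrt[of 0] by (simp add: z xsqrt_square)
  hence "Q 0 ^ 2 = xsqrt z \<or> Q 0 ^ 2 = - xsqrt z" by (simp only: power2_eq_iff)
  hence "Re_xi (V 0) = 0" using xi0 Re_xi_add(3)[OF xsqrt_square[of z]] by (auto simp: V_def z)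
  hence "Re (X 0) \<ge> 0" using Re_X_eq[of 0] by simp
  from stays_right[OF this, of 0] have V: "norm (V 0) \<ge> 1" "Re (V 0) > 0" by auto
  have "(\<gamma> 0 + Q 0 ^ 2) * (Q 0 ^ 2 - \<gamma> 0) = 1"
    using V_sqrt[of 0] by (simp add: algebra_simps power2_eq_square)
  hence "1 / V 0 = Q 0 ^ 2 - \<gamma> 0" using V_nonzero[of 0] by (simp add: V_def field_simps)
  hence "2 * z = V 0 - 1 / V 0" by (simp add: V_def z)
  hence zV: "2 * Re z = Re (V 0) - Re (1 / V 0)" by (metis Re_divide_numeral minus_complex.sel(1) mult_2 plus_complex.sel(1))
  have "Re (1 / V 0) = Re (V 0) / norm (V 0) ^ 2" by (simp add: Re_divide cmod_power2)
  also have "\<dots> \<le> Re (V 0)" using V by (simp add: divide_le_eq)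
  finally show False using zV assms by simp
qed

end

section \<open>The coordinates z = sinh w and the level curves\<close>

lemma Re_Im_sinh_cosh:
  fixes w :: complex
  shows "Re (cosh w) = cosh (Re w) * cos (Im w)" "Im (cosh w) = sinh (Re w) * sin (Im w)"
    "Re (sinh w) = sinh (Re w) * cos (Im w)" "Im (sinh w) = cosh (Re w) * sin (Im w)"
  by (simp_all add: cosh_def sinh_def Re_exp Im_exp scaleR_conv_of_real field_simps)

lemma xsqrt_sinh:
  assumes "Re (cosh w) > 0"
  shows "xsqrt (sinh w) = cosh w" "sinh w \<in> cut_plane"
proof -
  have eq: "1 + sinh w ^ 2 = cosh w ^ 2" by (simp add: cosh_square_eq add.commute)
  show "xsqrt (sinh w) = cosh w" unfolding xsqrt_def eq using assms by (intro csqrt_square) auto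
  have "cosh w ^ 2 \<notin> \<real>\<^sub>\<le>\<^sub>0"
  proof
    assume "cosh w ^ 2 \<in> \<real>\<^sub>\<le>\<^sub>0"
    hence 1: "Re (cosh w ^ 2) \<le> 0" "Im (cosh w ^ 2) = 0" by (auto simp: complex_nonpos_Reals_iff)
    hence "Im (cosh w) = 0" using assms by (simp add: power2_eq_square)
    hence "Re (cosh w ^ 2) = Re (cosh w) ^ 2" by (simp add: power2_eq_square)
    thus False using 1 assms by simp
  qed
  thus "sinh w \<in> cut_plane" by (simp add: cut_plane_def eq)
qed

lemma Re_xibar_sinh:
  assumes "Re (cosh w) > 0"
  shows "Re (xibar (sinh w)) = hxi (Re w) (Im w)"
proof -
  have "sinh w + cosh w = exp w" by (simp add: sinh_plus_cosh)
  thus ?thesis using Re_xibar_eq[OF xsqrt_sinh(2)[OF assms]] xsqrt_sinh(1)[OF assms] by (simp add: Re_xi_exp)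
qed

lemma cosh_pos_if: "\<bar>q\<bar> < pi / 2 \<Longrightarrow> Re (cosh (Complex p q)) > 0"
  by (simp add: Re_Im_sinh_cosh cos_gt_zero_pi)

text \<open>On the lines |Im w| = \<pi>/2 the points w and -cnj w give the same z, which lies on a
  cut. The one with Re w \<ge> 0 is taken, since from there Re \<xi> does not decrease on a vertical
  segment into the strip.\<close>

lemma sinh_coordinates:
  obtains w where "z = sinh w" "\<bar>Im w\<bar> \<le> pi / 2" "\<bar>Im w\<bar> = pi / 2 \<longrightarrow> Re w \<ge> 0"
proof -
  define w where "w = Ln (z + xsqrt z)"
  have ew: "exp w = z + xsqrt z" using add_xsqrt_nonzero[of z] by (simp add: w_def)
  have emw: "exp (- w) = xsqrt z - z"
    unfolding exp_minus ew using xsqrt_mult[of z] add_xsqrt_nonzero[of z] by (simp add: field_simps)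
  have s: "sinh w = z" and c: "cosh w = xsqrt z"
    by (simp_all add: sinh_def cosh_def ew emw)
  have "cosh (Re w) * cos (Im w) \<ge> 0" using Re_xsqrt_nonneg[of z] Re_Im_sinh_cosh(1)[of w] c by simp
  hence cos: "cos (Im w) \<ge> 0" using cosh_real_pos[of "Re w"] by (simp add: zero_le_mult_iff)
  have im: "- pi < Im w" "Im w \<le> pi" unfolding w_def using add_xsqrt_nonzero[of z] mpi_less_Im_Ln Im_Ln_le_pi by auto
  have le: "\<bar>Im w\<bar> \<le> pi / 2"
  proof (rule ccontr)
    assume "\<not> ?thesis"
    hence "cos \<bar>Im w\<bar> < cos (pi / 2)" using im by (intro cos_monotone_0_pi) auto
    thus False using cos by simp
  qed
  show ?thesis
  proof (cases "\<bar>Im w\<bar> = pi / 2 \<and> Re w < 0")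
    case False
    thus ?thesis using that[of w] s le by auto
  next
    case True
    define w' where "w' = - cnj w"
    have im': "Im w' = Im w" "Re w' = - Re w" by (simp_all add: w'_def)
    have "cos \<bar>Im w\<bar> = cos (pi / 2)" using True by (simp only:)
    hence "cos (Im w) = 0" by simp
    hence "sinh w' = sinh w" using im' by (simp add: complex_eq_iff Re_Im_sinh_cosh)
    thus ?thesis using that[of w'] s le True im' by auto
  qed
qed

text \<open>The singularity at 0 is removable. The value a = 0 corresponds to the branch point, from
  which the level curve has to start continuously.\<close>

lemma div_sinh_continuous: "continuous_on UNIV (\<lambda>a::real. if a = 0 then 1 else a / sinh a)"
proof -
  have "isCont (\<lambda>a::real. if a = 0 then 1 else a / sinh a) x" for x
  proof (cases "x = 0")
    case True
    have "((\<lambda>a::real. a / sinh a) \<longlongrightarrow> 1) (at 0)" by real_asymp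
    hence "((\<lambda>a::real. if a = 0 then 1 else a / sinh a) \<longlongrightarrow> 1) (at 0)"
      by (rule Lim_transform_eventually) (auto simp: eventually_at_filter)
    thus ?thesis using True by (simp add: isCont_def)
  next
    case False
    have "isCont (\<lambda>a::real. a / sinh a) x" using False by (intro continuous_intros) auto
    moreover have ev: "\<forall>\<^sub>F a in nhds x. a / sinh a = (if a = 0 then 1 else a / sinh a)"
      using t1_space_nhds[OF False] by (rule eventually_mono) auto
    ultimately show ?thesis using isCont_cong[OF ev] by simp
  qed
  thus ?thesis by (simp add: continuous_on_eq_continuous_at)
qed

text \<open>On the level curves through \<open>\<plusminus>i\<close> one has \<open>cos 2q = - 2p / sinh 2p\<close> in the coordinates
  \<open>z = sinh (p + iq)\<close>, so they are graphs over \<open>p\<close>.\<close>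

lemma left_level_curves_eq:
  "left_level_curves = {\<i>, -\<i>} \<union> {z. Re z < 0 \<and> Re (xibar z) = 0}"
proof
  show "left_level_curves \<subseteq> {\<i>, -\<i>} \<union> {z. Re z < 0 \<and> Re (xibar z) = 0}"
  proof
    fix z assume "z \<in> left_level_curves"
    then consider "z \<in> {\<i>, -\<i>}" | c where "pathstart c \<in> {\<i>, -\<i>}" "pathfinish c = z"
      "\<forall>t\<in>{0<..1}. Re (c t) < 0 \<and> Re (xibar (c t)) = Re (xibar (pathstart c))"
      by (auto simp: left_level_curves_def)
    thus "z \<in> {\<i>, -\<i>} \<union> {z. Re z < 0 \<and> Re (xibar z) = 0}"
    proof cases
      case 2
      have "Re (xibar (pathstart c)) = 0" using 2(1) Re_xibar_branch_points by auto
      moreover have "c 1 = z" using 2(2) by (simp add: pathfinish_def)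
      moreover have "(1::real) \<in> {0<..1}" by simp
      ultimately show ?thesis using 2(3) by fastforce
    qed auto
  qed
  show "{\<i>, -\<i>} \<union> {z. Re z < 0 \<and> Re (xibar z) = 0} \<subseteq> left_level_curves"
  proof
    fix z assume z: "z \<in> {\<i>, -\<i>} \<union> {z. Re z < 0 \<and> Re (xibar z) = 0}"
    show "z \<in> left_level_curves"
    proof (cases "z \<in> {\<i>, -\<i>}")
      case False
      hence rz: "Re z < 0" and xz: "Re (xibar z) = 0" using z by auto
      obtain w where w: "z = sinh w" "\<bar>Im w\<bar> \<le> pi / 2" "\<bar>Im w\<bar> = pi / 2 \<longrightarrow> Re w \<ge> 0"
        by (rule sinh_coordinates)
      have q2: "\<bar>Im w\<bar> < pi / 2"
      proof (rule ccontr)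
        assume "\<not> ?thesis"
        hence "\<bar>Im w\<bar> = pi / 2" using w(2) by simp
        hence "cos \<bar>Im w\<bar> = cos (pi / 2)" by (simp only:)
        hence "cos (Im w) = 0" by simp
        thus False using rz unfolding w(1) Re_Im_sinh_cosh by simp
      qed
      have cosp: "cos (Im w) > 0" using q2 by (intro cos_gt_zero_pi) auto
      have p: "Re w < 0" using rz cosp unfolding w(1) Re_Im_sinh_cosh by (simp add: mult_less_0_iff)
      have "Re (cosh w) > 0" using cosp by (simp add: Re_Im_sinh_cosh)
      hence h0: "hxi (Re w) (Im w) = 0" using Re_xibar_sinh xz w(1) by simp
      define a where "a = - 2 * Re w"
      have a: "a > 0" using p by (simp add: a_def)
      define \<kappa> where "\<kappa> = (\<lambda>a::real. if a = 0 then 1 else a / sinh a)"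
      have \<kappa>b: "0 < \<kappa> x \<and> \<kappa> x < 1" if "x > 0" for x
        using that sinh_gt_self[OF that] by (simp add: \<kappa>_def)
      have cos2q: "cos (2 * Im w) = - \<kappa> a"
      proof -
        have "sinh (2 * Re w) * cos (2 * Im w) = - (2 * Re w)" using h0 by (simp add: hxi_def)
        moreover have "2 * Re w = - a" by (simp add: a_def)
        ultimately have "sinh a * cos (2 * Im w) = - a" by simp
        thus ?thesis using a by (simp add: \<kappa>_def field_simps)
      qed
      define \<sigma> :: real where "\<sigma> = (if Im w \<ge> 0 then 1 else -1)"
      have sq: "Im w = \<sigma> * \<bar>Im w\<bar>" "\<bar>\<sigma>\<bar> = 1" by (auto simp: \<sigma>_def)
      \<comment> \<open>Scaling p from 0 to Re w and solving cos 2q = -ta / sinh(ta) for q gives a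
        curve from a branch point to z; \<sigma> selects the upper or lower half plane.\<close>
      define \<theta> where "\<theta> t = arccos (- \<kappa> (t * a)) / 2" for t
      define c where "c t = sinh (Complex (t * Re w) (\<sigma> * \<theta> t))" for t
      have \<kappa>r: "- 1 \<le> - \<kappa> (t * a) \<and> - \<kappa> (t * a) \<le> 1" if "t \<ge> 0" for t
      proof (cases "t = 0")
        case False
        hence "t * a > 0" using that a by simp
        from \<kappa>b[OF this] show ?thesis by simp
      qed (simp add: \<kappa>_def)
      have cont\<theta>: "continuous_on {0..1} \<theta>"
      proof -
        have "continuous_on {0..1} (\<lambda>t. \<kappa> (t * a))"
          by (rule continuous_on_compose2[OF div_sinh_continuous[folded \<kappa>_def]]) (auto intro!: continuous_intros)
        thus ?thesis unfolding \<theta>_def using \<kappa>r by (intro continuous_intros) auto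
      qed
      have "path c"
        unfolding path_def c_def sinh_def by (intro continuous_intros continuous_on_Complex cont\<theta>)
      moreover have "pathstart c \<in> {\<i>, -\<i>}"
      proof -
        have \<theta>0: "\<theta> 0 = pi / 2" by (simp add: \<theta>_def \<kappa>_def)
        have "c 0 = of_real \<sigma> * \<i>" unfolding c_def \<theta>0 \<sigma>_def by (auto simp: complex_eq_iff Re_Im_sinh_cosh)
        thus ?thesis by (auto simp: pathstart_def \<sigma>_def)
      qed
      moreover have "pathfinish c = z"
      proof -
        have "arccos (cos (2 * \<bar>Im w\<bar>)) = 2 * \<bar>Im w\<bar>" using q2 by (intro arccos_cos) auto
        moreover have "cos (2 * \<bar>Im w\<bar>) = - \<kappa> a" using cos2q by (cases "Im w \<ge> 0") auto
        ultimately have "\<theta> 1 = \<bar>Im w\<bar>" by (simp add: \<theta>_def)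
        hence "c 1 = sinh (Complex (Re w) (\<sigma> * \<bar>Im w\<bar>))" by (simp add: c_def)
        thus ?thesis using sq(1) w(1) by (simp add: pathfinish_def)
      qed
      moreover have "Re (c t) < 0 \<and> Re (xibar (c t)) = Re (xibar (pathstart c))" if t: "t \<in> {0<..1}" for t
      proof -
        have ta: "t * a > 0" using t a by simp
        have \<theta>: "0 < \<theta> t" "\<theta> t < pi / 2" "cos (2 * \<theta> t) = - \<kappa> (t * a)"
        proof -
          have "- 1 < - \<kappa> (t * a)" "- \<kappa> (t * a) < 1" using \<kappa>b[OF ta] by auto
          hence "0 < arccos (- \<kappa> (t * a))" "arccos (- \<kappa> (t * a)) < pi" using arccos_lt_bounded[of "- \<kappa> (t * a)"] by blast+
          thus "0 < \<theta> t" "\<theta> t < pi / 2" by (auto simp: \<theta>_def)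
          show "cos (2 * \<theta> t) = - \<kappa> (t * a)" using \<kappa>b[OF ta] by (simp add: \<theta>_def)
        qed
        have abs: "\<bar>\<sigma> * \<theta> t\<bar> < pi / 2" using \<theta> sq(2) by (simp add: abs_mult)
        have cp: "cos (\<sigma> * \<theta> t) > 0" using abs by (intro cos_gt_zero_pi) auto
        have "Re (c t) < 0" unfolding c_def Re_Im_sinh_cosh using cp t p by (simp add: mult_neg_pos mult_pos_neg)
        moreover have "Re (xibar (c t)) = hxi (t * Re w) (\<sigma> * \<theta> t)"
          unfolding c_def using Re_xibar_sinh[OF cosh_pos_if[OF abs]] by simp
        moreover have "hxi (t * Re w) (\<sigma> * \<theta> t) = 0"
        proof -
          have "cos (2 * (\<sigma> * \<theta> t)) = cos (2 * \<theta> t)" by (simp add: \<sigma>_def)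
          also have "\<dots> = - (t * a / sinh (t * a))" using \<theta>(3) t a by (simp add: \<kappa>_def)
          finally have c: "cos (2 * (\<sigma> * \<theta> t)) = - (t * a / sinh (t * a))" .
          have e: "t * Re w = - (t * a) / 2" by (simp add: a_def)
          show ?thesis unfolding hxi_def c unfolding e using t a by simp
        qed
        moreover have "Re (xibar (pathstart c)) = 0" using \<open>pathstart c \<in> {\<i>, -\<i>}\<close> Re_xibar_branch_points by auto
        ultimately show ?thesis by simp
      qed
      ultimately show ?thesis unfolding left_level_curves_def by blast
    qed (auto simp: left_level_curves_def)
  qed
qed

lemma not_admissible_on_left_level_curves:
  assumes "admissible_to 1 z \<gamma> Q X"
  shows "z \<notin> left_level_curves"
proof -
  interpret admissible_right z \<gamma> Q X by unfold_locales (rule assms)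
  have "\<gamma> 0 = z" "\<gamma> 0 \<noteq> \<i>" "\<gamma> 0 \<noteq> -\<i>" using assms by (auto simp: admissible_to_def)
  thus ?thesis using start_not_on_left_level_curve by (auto simp: left_level_curves_eq)
qed

section \<open>Construction of admissible paths\<close>

lemma R2_arc_on_cong:
  assumes "R2_arc_on I f" "\<And>t. t \<in> I \<Longrightarrow> f t = g t"
  shows "R2_arc_on I g"
proof -
  obtain f' f'' where *: "\<And>t. t \<in> I \<Longrightarrow> (f has_vector_derivative f' t) (at t within I) \<and> f' t \<noteq> 0 \<and>
            (f' has_vector_derivative f'' t) (at t within I)" "continuous_on I f''"
    using assms(1) unfolding R2_arc_on_def by blast
  have "(g has_vector_derivative f' t) (at t within I)" if "t \<in> I" for t
    by (rule has_vector_derivative_transform[of t I g f]) (use * that assms(2) in auto)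
  thus ?thesis using * unfolding R2_arc_on_def by blast
qed

lemma R2_arc_on_shift:
  assumes "R2_arc_on ((\<lambda>t. t - c) ` I) f"
  shows "R2_arc_on I (\<lambda>t. f (t - c))"
proof -
  let ?J = "(\<lambda>t. t - c) ` I"
  obtain f' f'' where *: "\<And>t. t \<in> ?J \<Longrightarrow> (f has_vector_derivative f' t) (at t within ?J) \<and> f' t \<noteq> 0 \<and>
            (f' has_vector_derivative f'' t) (at t within ?J)" "continuous_on ?J f''"
    using assms(1) unfolding R2_arc_on_def by blast
  have sh: "((\<lambda>t. h (t - c)) has_vector_derivative h') (at t within I)"
    if "(h has_vector_derivative h') (at (t - c) within ?J)" for h :: "real \<Rightarrow> complex" and h' t
  proof -
    have "((\<lambda>t. t - c) has_vector_derivative 1) (at t within I)"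
      by (auto intro!: derivative_eq_intros)
    from vector_diff_chain_within[OF this that] show ?thesis by (simp add: o_def)
  qed
  show ?thesis unfolding R2_arc_on_def
  proof (rule exI[of _ "\<lambda>t. f' (t - c)"], rule exI[of _ "\<lambda>t. f'' (t - c)"], intro conjI ballI)
    fix t assume "t \<in> I"
    hence "t - c \<in> ?J" by blast
    from *(1)[OF this]
    show "((\<lambda>t. f (t - c)) has_vector_derivative f' (t - c)) (at t within I)" "f' (t - c) \<noteq> 0"
      "((\<lambda>t. f' (t - c)) has_vector_derivative f'' (t - c)) (at t within I)"
      using sh by auto
  next
    show "continuous_on I (\<lambda>t. f'' (t - c))"
      by (rule continuous_on_compose2[OF *(2)]) (auto intro!: continuous_intros)
  qed
qed

lemma R2_arc_on_cnj:
  assumes "R2_arc_on I f"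
  shows "R2_arc_on I (\<lambda>t. cnj (f t))"
proof -
  obtain f' f'' where *: "\<And>t. t \<in> I \<Longrightarrow> (f has_vector_derivative f' t) (at t within I) \<and> f' t \<noteq> 0 \<and>
            (f' has_vector_derivative f'' t) (at t within I)" "continuous_on I f''"
    using assms(1) unfolding R2_arc_on_def by blast
  show ?thesis unfolding R2_arc_on_def
    by (rule exI[of _ "\<lambda>t. cnj (f' t)"], rule exI[of _ "\<lambda>t. cnj (f'' t)"])
       (use * in \<open>auto intro!: has_vector_derivative_cnj continuous_intros\<close>)
qed

text \<open>The chain rule, applied twice, gives the continuous second derivative w'^2 F'' + w'' F';
  the tangent stays nonzero because F' does not vanish on the arc.\<close>

lemma R2_arc_on_compose:
  assumes w: "R2_arc_on I w" and S: "open S" "w ` I \<subseteq> S"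
    and F: "F holomorphic_on S" and F0: "\<And>t. t \<in> I \<Longrightarrow> deriv F (w t) \<noteq> 0"
  shows "R2_arc_on I (\<lambda>t. F (w t))"
proof -
  obtain w' w'' where *: "\<And>t. t \<in> I \<Longrightarrow> (w has_vector_derivative w' t) (at t within I) \<and> w' t \<noteq> 0 \<and>
            (w' has_vector_derivative w'' t) (at t within I)" "continuous_on I w''"
    using w unfolding R2_arc_on_def by blast
  have contw: "continuous_on I w" by (rule R2_arc_on_continuous[OF w])
  have contw': "continuous_on I w'"
    unfolding continuous_on_eq_continuous_within using * has_vector_derivative_continuous by blast
  have hol1: "deriv F holomorphic_on S" using F S(1) by (rule holomorphic_deriv)
  have hol2: "deriv (deriv F) holomorphic_on S" using hol1 S(1) by (rule holomorphic_deriv)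
  have comp: "((\<lambda>t. G (w t)) has_vector_derivative w' t * deriv G (w t)) (at t within I)"
    if "G holomorphic_on S" "t \<in> I" for G t
  proof -
    have "(G has_field_derivative deriv G (w t)) (at (w t))"
      using that S by (intro holomorphic_derivI[OF that(1) S(1)]) auto
    hence "(G has_field_derivative deriv G (w t)) (at (w t) within w ` I)" by (rule has_field_derivative_at_within)
    moreover have "(w has_vector_derivative w' t) (at t within I)" using * that by blast
    ultimately have "(G \<circ> w has_vector_derivative w' t * deriv G (w t)) (at t within I)"
      by (intro field_vector_diff_chain_within)
    thus ?thesis by (simp add: o_def)
  qed
  have contc: "continuous_on I (\<lambda>t. G (w t))" if "G holomorphic_on S" for G
    using continuous_on_compose2[OF holomorphic_on_imp_continuous_on[OF that] contw] S by blast
  show ?thesis unfolding R2_arc_on_def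
  proof (rule exI[of _ "\<lambda>t. w' t * deriv F (w t)"],
      rule exI[of _ "\<lambda>t. w' t * (w' t * deriv (deriv F) (w t)) + w'' t * deriv F (w t)"], intro conjI ballI)
    fix t assume t: "t \<in> I"
    show "((\<lambda>t. F (w t)) has_vector_derivative w' t * deriv F (w t)) (at t within I)" by (rule comp[OF F t])
    show "w' t * deriv F (w t) \<noteq> 0" using * F0 t by auto
    show "((\<lambda>t. w' t * deriv F (w t)) has_vector_derivative w' t * (w' t * deriv (deriv F) (w t)) + w'' t * deriv F (w t)) (at t within I)"
      using * t by (intro has_vector_derivative_mult comp[OF hol1 t]) auto
  next
    show "continuous_on I (\<lambda>t. w' t * (w' t * deriv (deriv F) (w t)) + w'' t * deriv F (w t))"
      by (intro continuous_intros contw' *(2) contc hol1 hol2)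
  qed
qed

lemma R2_chain_compose:
  assumes w: "R2_chain w" and S: "open S" "\<And>t. t \<ge> 0 \<Longrightarrow> w t \<in> S"
    and F: "F holomorphic_on S" and F0: "\<And>t. t \<ge> 0 \<Longrightarrow> deriv F (w t) \<noteq> 0"
  shows "R2_chain (\<lambda>t. F (w t))"
proof -
  obtain m and \<tau> :: "nat \<Rightarrow> real" where \<tau>: "\<tau> 0 = 0" "\<And>i. i < m \<Longrightarrow> \<tau> i < \<tau> (Suc i)"
    "\<And>i. i < m \<Longrightarrow> R2_arc_on {\<tau> i..\<tau> (Suc i)} w" "R2_arc_on {\<tau> m..} w"
    using w unfolding R2_chain_def by blast
  have ge: "\<tau> i \<ge> 0" if "i \<le> m" for i
    using that
  proof (induction i)
    case (Suc i)
    thus ?case using \<tau>(2)[of i] by simp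
  qed (use \<tau> in auto)
  show ?thesis unfolding R2_chain_def
  proof (intro exI[of _ m] exI[of _ \<tau>] conjI allI impI)
    fix i assume i: "i < m"
    have "0 \<le> \<tau> i" using ge[of i] i by simp
    hence pos: "t \<ge> 0" if "t \<in> {\<tau> i..\<tau> (Suc i)}" for t using that by simp
    show "R2_arc_on {\<tau> i..\<tau> (Suc i)} (\<lambda>t. F (w t))"
    proof (rule R2_arc_on_compose[OF \<tau>(3)[OF i] S(1) _ F])
      show "w ` {\<tau> i..\<tau> (Suc i)} \<subseteq> S" using S(2) pos by blast
    qed (rule F0[OF pos])
  next
    have pos: "t \<ge> 0" if "t \<in> {\<tau> m..}" for t using that ge[of m] by simp
    show "R2_arc_on {\<tau> m..} (\<lambda>t. F (w t))"
    proof (rule R2_arc_on_compose[OF \<tau>(4) S(1) _ F])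
      show "w ` {\<tau> m..} \<subseteq> S" using S(2) pos by blast
    qed (rule F0[OF pos])
  qed (rule \<tau>(1), rule \<tau>(2))
qed

lemma R2_arc_on_vector_derivative_integrable:
  assumes "R2_arc_on I f" "{a..b} \<subseteq> I"
  shows "(\<lambda>t. vector_derivative f (at t)) absolutely_integrable_on {a..b}"
proof -
  obtain f' f'' where *: "\<And>t. t \<in> I \<Longrightarrow> (f has_vector_derivative f' t) (at t within I) \<and>
            (f' has_vector_derivative f'' t) (at t within I)"
    using assms(1) unfolding R2_arc_on_def by blast
  have "continuous_on I f'"
    unfolding continuous_on_eq_continuous_within using * has_vector_derivative_continuous by blast
  hence "continuous_on {a..b} f'" using assms(2) continuous_on_subset by blast
  hence int: "f' absolutely_integrable_on {a..b}" by (rule absolutely_integrable_continuous_real)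
  have vd: "vector_derivative f (at t) = f' t" if t: "t \<in> {a..b} - {a, b}" for t
  proof -
    have "t \<in> interior {a..b}" using t by auto
    hence "t \<in> interior I" using interior_mono[OF assms(2)] by blast
    hence "at t within I = at t" by (rule at_within_interior)
    moreover have "t \<in> I" using t assms(2) by auto
    ultimately have "(f has_vector_derivative f' t) (at t)" using *[of t] by simp
    thus ?thesis by (rule vector_derivative_at)
  qed
  show ?thesis
    by (rule absolutely_integrable_spike[OF int negligible_finite[of "{a, b}"]]) (simp, rule vd)
qed

text \<open>Each arc has a continuous tangent up to its end points, and the joints form a null set.
  Applied to the \<beta> image this gives finite length for the initial piece of a path.\<close>

lemma R2_chain_vector_derivative_integrable:
  assumes "R2_chain f"
  shows "(\<lambda>t. vector_derivative f (at t)) absolutely_integrable_on {0..b}"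
proof -
  let ?d = "\<lambda>t. vector_derivative f (at t)"
  obtain m and \<tau> :: "nat \<Rightarrow> real" where \<tau>: "\<tau> 0 = 0" "\<And>i. i < m \<Longrightarrow> \<tau> i < \<tau> (Suc i)"
    "\<And>i. i < m \<Longrightarrow> R2_arc_on {\<tau> i..\<tau> (Suc i)} f" "R2_arc_on {\<tau> m..} f"
    using assms unfolding R2_chain_def by blast
  have int: "0 \<le> \<tau> i \<and> ?d absolutely_integrable_on {0..\<tau> i}" if "i \<le> m" for i
    using that
  proof (induction i)
    case 0
    have "?d absolutely_integrable_on cbox 0 0" by (rule absolutely_integrable_on_null) simp
    thus ?case using \<tau>(1) by simp
  next
    case (Suc i)
    hence i: "i < m" by simp
    have "?d absolutely_integrable_on {\<tau> i..\<tau> (Suc i)}"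
      by (rule R2_arc_on_vector_derivative_integrable[OF \<tau>(3)[OF i]]) simp
    hence "?d absolutely_integrable_on {0..\<tau> (Suc i)}"
      by (rule absolutely_integrable_on_combine[where c = "\<tau> i", rotated]) (use Suc \<tau>(2)[OF i] in auto)
    thus ?case using Suc \<tau>(2)[OF i] by simp
  qed
  have "?d absolutely_integrable_on {\<tau> m..max b (\<tau> m)}"
    by (rule R2_arc_on_vector_derivative_integrable[OF \<tau>(4)]) auto
  hence "?d absolutely_integrable_on {0..max b (\<tau> m)}"
    by (rule absolutely_integrable_on_combine[where c = "\<tau> m", rotated]) (use int[of m] in auto)
  thus ?thesis by (rule set_integrable_subset) auto
qed

text \<open>Starting points, in the \<open>w\<close> plane with \<open>z = sinh w\<close>, of suitable paths. Keeping \<open>cosh w\<close> off the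
  slit makes \<open>(cosh w)\<^bsup>1/2\<^esup>\<close> a continuation of the quartic root.\<close>

definition liftable :: "complex \<Rightarrow> bool" where
  "liftable w\<^sub>0 \<longleftrightarrow> (\<exists>w. R2_chain w \<and> w 0 = w\<^sub>0 \<and> (\<forall>t\<ge>0. cosh (w t) \<notin> \<real>\<^sub>\<le>\<^sub>0) \<and>
     mono_on {0..} (\<lambda>t. hxi (Re (w t)) (Im (w t))) \<and>
     (\<exists>T a q. \<bar>q\<bar> \<le> pi / 4 \<and> (\<forall>t\<ge>T. w t = Complex (t + a) q)))"

text \<open>The coordinate map gives all continued functions in closed form: z = sinh w, Q^2 = cosh
  w, 2\<xi> = w + sinh w cosh w and \<beta> = tanh w. On the final ray \<beta>' decays like
  exp(-2t), so the image has finite length.\<close>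

lemma liftable_imp_admissible:
  assumes "liftable w\<^sub>0"
  shows "\<exists>\<gamma> Q X. admissible_to 1 (sinh w\<^sub>0) \<gamma> Q X"
proof -
  obtain w T a q where w: "R2_chain w" "w 0 = w\<^sub>0" "\<And>t. t \<ge> 0 \<Longrightarrow> cosh (w t) \<notin> \<real>\<^sub>\<le>\<^sub>0"
     "mono_on {0..} (\<lambda>t. hxi (Re (w t)) (Im (w t)))" and q: "\<bar>q\<bar> \<le> pi / 4"
     and tl: "\<And>t. t \<ge> T \<Longrightarrow> w t = Complex (t + a) q"
    using assms unfolding liftable_def by blast
  define \<gamma> where "\<gamma> = (\<lambda>t. sinh (w t))"
  define Q where "Q t = csqrt (cosh (w t))" for t
  define X where "X t = (w t + sinh (w t) * cosh (w t)) / 2" for t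
  have c0: "cosh (w t) \<noteq> 0" if "t \<ge> 0" for t using w(3)[OF that] by auto
  have Q2: "Q t ^ 2 = cosh (w t)" for t by (simp add: Q_def)
  have cs: "cosh (w t) ^ 2 = 1 + sinh (w t) ^ 2" for t by (simp add: cosh_square_eq add.commute)
  have q2: "\<bar>q\<bar> < pi / 2" using q pi_gt_zero by linarith
  have cosq: "cos q > 0" using q2 by (intro cos_gt_zero_pi) auto
  have contw: "continuous_on {0..} w" using R2_chain_nice(1)[OF w(1)] .
  obtain N where N: "finite N" "\<And>t. t > 0 \<Longrightarrow> t \<notin> N \<Longrightarrow> nice_at w t"
    using R2_chain_nice(2)[OF w(1)] by blast
  have dsinh: "(sinh has_field_derivative cosh z) (at z)" for z :: complex
    by (auto intro!: derivative_eq_intros)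
  have chain\<gamma>: "R2_chain \<gamma>"
    unfolding \<gamma>_def
  proof (rule R2_chain_compose[OF w(1), of UNIV])
    show "deriv sinh (w t) \<noteq> 0" if "t \<ge> 0" for t using DERIV_imp_deriv[OF dsinh] c0[OF that] by simp
    show "sinh holomorphic_on (UNIV :: complex set)"
      unfolding holomorphic_on_open[OF open_UNIV] using dsinh by blast
  qed auto
  have d\<gamma>: "(\<gamma> has_vector_derivative vector_derivative w (at t) * cosh (w t)) (at t)" if "nice_at w t" for t
    unfolding \<gamma>_def using that field_vector_diff_chain_at[of w _ t sinh "cosh (w t)"] dsinh
    by (auto simp: nice_at_def o_def)
  have tlc: "Re (cosh (w t)) > 0 \<and> xsqrt (\<gamma> t) = cosh (w t) \<and> \<gamma> t \<in> cut_plane" if "t \<ge> T" for t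
  proof -
    have "Re (cosh (w t)) > 0" unfolding tl[OF that] using q2 by (rule cosh_pos_if)
    thus ?thesis using xsqrt_sinh[of "w t"] by (simp add: \<gamma>_def)
  qed
  have filt: "filterlim (\<lambda>t. Re (\<gamma> t)) at_top at_top"
  proof -
    have "filterlim (\<lambda>t. sinh (t + a) * cos q) at_top at_top" using cosq by real_asymp
    moreover have "\<forall>\<^sub>F t in at_top. sinh (t + a) * cos q = Re (\<gamma> t)"
      using eventually_ge_at_top[of T] by eventually_elim (simp add: \<gamma>_def tl Re_Im_sinh_cosh)
    ultimately show ?thesis by (rule filterlim_cong[OF refl refl, THEN iffD1, rotated])
  qed
  have contQ: "continuous_on {0..} Q"
  proof -
    have "continuous_on {0..} (\<lambda>t. cosh (w t))" unfolding cosh_def by (intro continuous_intros contw)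
    thus ?thesis unfolding Q_def
      by (rule continuous_on_compose2[OF holomorphic_on_imp_continuous_on[OF holomorphic_on_csqrt]]) (use w(3) in auto)
  qed
  have evQ: "\<forall>\<^sub>F t in at_top. Q t = (1 + (\<gamma> t)^2) powr (1/4)"
    using eventually_ge_at_top[of T] eventually_ge_at_top[of 0]
  proof eventually_elim
    case (elim t)
    have "(1 + (\<gamma> t)^2) powr (1/4) = exp (Ln (cosh (w t)) / 2)"
      using principal_quartic_root(1)[of "\<gamma> t"] tlc[OF elim(1)] by simp
    also have "\<dots> = Q t" using c0[OF elim(2)] by (simp add: Q_def csqrt_exp_Ln)
    finally show ?case by simp
  qed
  have contX: "continuous_on {0..} X"
    unfolding X_def sinh_def cosh_def by (intro continuous_intros contw) auto
  have hasX: "((\<lambda>s. (Q s)^2 * vector_derivative \<gamma> (at s)) has_integral (X t - X 0)) {0..t}" if t: "t \<ge> 0" for t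
  proof (rule fundamental_theorem_of_calculus_interior_strong[OF N(1) t])
    show "continuous_on {0..t} X" using contX by (rule continuous_on_subset) auto
    fix s assume s: "s \<in> {0<..<t} - N"
    hence ns: "nice_at w s" using N(2) by auto
    let ?w' = "vector_derivative w (at s)"
    have nw: "(w has_vector_derivative ?w') (at s)" using ns by (simp add: nice_at_def)
    have "((\<lambda>z. (z + sinh z * cosh z) / 2) has_field_derivative (1 + (sinh (w s) * sinh (w s) + cosh (w s) * cosh (w s))) / 2) (at (w s))"
      by (auto intro!: derivative_eq_intros simp: mult.commute)
    from field_vector_diff_chain_at[OF nw this]
    have "((\<lambda>t. (w t + sinh (w t) * cosh (w t)) / 2) has_vector_derivative ?w' * ((1 + (sinh (w s) * sinh (w s) + cosh (w s) * cosh (w s))) / 2)) (at s)"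
      by (simp only: o_def)
    moreover have "(1 + (sinh (w s) * sinh (w s) + cosh (w s) * cosh (w s))) / 2 = cosh (w s) ^ 2"
      using cs[of s] by (simp add: power2_eq_square)
    moreover have "vector_derivative \<gamma> (at s) = ?w' * cosh (w s)" by (rule vector_derivative_at[OF d\<gamma>[OF ns]])
    ultimately show "(X has_vector_derivative (Q s)^2 * vector_derivative \<gamma> (at s)) (at s)"
      unfolding X_def Q2 by (simp add: power2_eq_square mult_ac)
  qed
  have evX: "\<forall>\<^sub>F t in at_top. X t = xibar (\<gamma> t)"
    using eventually_ge_at_top[of T]
  proof eventually_elim
    case (elim t)
    have "sinh (w t) + cosh (w t) = exp (w t)" by (rule sinh_plus_cosh)
    moreover have "- pi < Im (w t) \<and> Im (w t) \<le> pi" using tl[OF elim] q2 pi_gt_zero by auto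
    hence "Ln (exp (w t)) = w t" by (intro Ln_exp) auto
    ultimately have "xibar_closed (\<gamma> t) = X t"
      using tlc[OF elim] by (simp add: xibar_closed_def X_def \<gamma>_def add.commute)
    thus ?case using tlc[OF elim] xibar_eq by simp
  qed
  have ReX: "Re (X t) = hxi (Re (w t)) (Im (w t))" for t
  proof -
    have "X t = w t / 2 + sinh (2 * w t) / 4" by (simp add: X_def sinh_double add_divide_distrib)
    hence "Re (X t) = Re (w t / 2 + sinh (2 * w t) / 4)" by (rule arg_cong)
    thus ?thesis by (simp add: hxi_def Re_Im_sinh_cosh)
  qed
  have int\<beta>: "(\<lambda>t. vector_derivative (beta_along \<gamma> Q) (at t)) absolutely_integrable_on {0..}"
  proof -
    define \<beta> where "\<beta> = (\<lambda>t. tanh (w t))"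
    have b: "beta_along \<gamma> Q = \<beta>" by (simp add: fun_eq_iff beta_along_def \<gamma>_def Q2 \<beta>_def tanh_def)
    have dtanh: "(tanh has_field_derivative 1 / cosh z ^ 2) (at z)" if "cosh z \<noteq> 0" for z :: complex
    proof -
      have "(tanh has_field_derivative 1 - tanh z ^ 2) (at z)" using that by (auto intro!: derivative_eq_intros)
      moreover have "1 - tanh z ^ 2 = (cosh z ^ 2 - sinh z ^ 2) / cosh z ^ 2"
        using that by (simp add: tanh_def power_divide diff_divide_distrib)
      moreover have "cosh z ^ 2 - sinh z ^ 2 = 1" by (simp add: cosh_square_eq)
      ultimately show ?thesis by simp
    qed
    let ?S = "{z::complex. cosh z \<noteq> 0}"
    have oS: "open ?S" unfolding cosh_def by (intro open_Collect_neq continuous_intros)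
    have "R2_chain \<beta>" unfolding \<beta>_def
    proof (rule R2_chain_compose[OF w(1) oS])
      show "tanh holomorphic_on ?S" unfolding holomorphic_on_open[OF oS] using dtanh by blast
      show "deriv tanh (w t) \<noteq> 0" if "t \<ge> 0" for t using DERIV_imp_deriv[OF dtanh[OF c0[OF that]]] c0[OF that] by simp
    qed (use c0 in auto)
    define M where "M = max T 0"
    have 1: "(\<lambda>t. vector_derivative \<beta> (at t)) absolutely_integrable_on {0..M}"
      by (rule R2_chain_vector_derivative_integrable) fact
    define g where "g t = 1 / cosh (Complex (t + a) q) ^ 2" for t
    have gc: "cosh (Complex (t + a) q) \<noteq> 0" for t
    proof -
      have "Re (cosh (Complex (t + a) q)) > 0" by (rule cosh_pos_if[OF q2])
      thus ?thesis by auto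
    qed
    have vd: "vector_derivative \<beta> (at t) = g t" if "t > M" for t
    proof -
      have "((\<lambda>t. Complex (t + a) q) has_vector_derivative 1) (at t)"
        unfolding Complex_eq by (auto intro!: derivative_eq_intros has_vector_derivative_of_real simp: has_real_derivative_iff_has_vector_derivative[symmetric])
      hence "((\<lambda>t. tanh (Complex (t + a) q)) has_vector_derivative g t) (at t)"
        using field_vector_diff_chain_at[of "\<lambda>t. Complex (t + a) q" 1 t, OF _ dtanh[OF gc]] by (simp add: o_def g_def)
      hence "(\<beta> has_vector_derivative g t) (at t)"
        by (rule has_vector_derivative_transform_within_open[of _ _ _ "{M<..}"]) (use that tl in \<open>auto simp: \<beta>_def M_def\<close>)
      thus ?thesis by (rule vector_derivative_at)
    qed
    have gint: "g absolutely_integrable_on {M..}"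
    proof (rule measurable_bounded_by_integrable_imp_absolutely_integrable)
      show "g \<in> borel_measurable (lebesgue_on {M..})"
      proof (intro continuous_imp_measurable_on_sets_lebesgue)
        show "continuous_on {M..} g"
          unfolding g_def using gc by (intro continuous_intros continuous_on_cosh continuous_on_Complex) auto
      qed auto
      show "(\<lambda>t. 4 * exp (- 2 * a) * exp (- 2 * t)) integrable_on {M..}"
        using integrable_on_exp_minus_to_infinity[of 2 M] by (intro integrable_on_mult_right) auto
      fix t assume "t \<in> {M..}"
      let ?p = "t + a"
      \<comment> \<open>The outcome is |cosh w|^2 = (cosh 2p + cos 2q)/2, whose second term is
        nonnegative for |q| \<le> \<pi>/4.\<close>
      have "norm (cosh (Complex ?p q)) ^ 2 = cosh ?p ^ 2 * cos q ^ 2 + sinh ?p ^ 2 * sin q ^ 2"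
        by (simp add: cmod_power2 Re_Im_sinh_cosh power_mult_distrib)
      also have "\<dots> = (2 * cosh ?p ^ 2 - 1) / 2 + (2 * cos q ^ 2 - 1) / 2"
      proof -
        have s: "sinh ?p ^ 2 = cosh ?p ^ 2 - 1" "sin q ^ 2 = 1 - cos q ^ 2" by (simp_all add: sinh_square_eq sin_squared_eq)
        show ?thesis unfolding s by (simp add: field_simps)
      qed
      also have "\<dots> = cosh (2 * ?p) / 2 + cos (2 * q) / 2" by (simp only: cosh_double_cosh cos_double_cos)
      finally have "norm (cosh (Complex ?p q)) ^ 2 = cosh (2 * ?p) / 2 + cos (2 * q) / 2" .
      moreover have "cos (2 * q) \<ge> 0" using q by (intro cos_ge_zero) auto
      moreover have "cosh (2 * ?p) \<ge> exp (2 * ?p) / 2" by (simp add: cosh_def)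
      ultimately have "norm (cosh (Complex ?p q)) ^ 2 \<ge> exp (2 * ?p) / 4" by simp
      hence "1 / norm (cosh (Complex ?p q)) ^ 2 \<le> 1 / (exp (2 * ?p) / 4)" by (intro frac_le) auto
      also have "\<dots> = 4 * exp (- 2 * a) * exp (- 2 * t)"
        by (simp add: exp_minus field_simps exp_add [symmetric])
      finally show "norm (g t) \<le> 4 * exp (- 2 * a) * exp (- 2 * t)" by (simp add: g_def norm_divide norm_power)
    qed auto
    have 2: "(\<lambda>t. vector_derivative \<beta> (at t)) absolutely_integrable_on {M..}"
      by (rule absolutely_integrable_spike[OF gint negligible_sing[of M]]) (rule vd, auto)
    have "(\<lambda>t. vector_derivative \<beta> (at t)) absolutely_integrable_on ({0..M} \<union> {M..})"
      using 1 2 by (rule absolutely_integrable_Un)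
    moreover have "{0..M} \<union> {M..} = {0..}" by (auto simp: M_def)
    ultimately show ?thesis unfolding b by simp
  qed
  have "admissible_to 1 (sinh w\<^sub>0) \<gamma> Q X"
    unfolding admissible_to_def continued_along_def
  proof (intro conjI allI impI)
    show "\<gamma> 0 = sinh w\<^sub>0" by (simp add: \<gamma>_def w(2))
    fix t :: real assume t: "t \<ge> 0"
    have "cosh (w t) ^ 2 \<noteq> 0" using c0[OF t] by simp
    hence ne: "1 + \<gamma> t ^ 2 \<noteq> 0" by (simp only: cs \<gamma>_def not_False_eq_True)
    show "\<gamma> t \<noteq> \<i>" "\<gamma> t \<noteq> - \<i>" using ne by auto
    show "Q t ^ 4 = 1 + \<gamma> t ^ 2"
    proof -
      have "Q t ^ 4 = (Q t ^ 2)^2" by (simp flip: power_mult)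
      thus ?thesis unfolding Q2 cs by (simp add: \<gamma>_def)
    qed
    show "((\<lambda>s. (Q s)^2 * vector_derivative \<gamma> (at s)) has_integral (X t - X 0)) {0..t}" by (rule hasX[OF t])
  qed (use chain\<gamma> filt contQ evQ evX w(4) ReX int\<beta> in simp_all)
  thus ?thesis by blast
qed

section \<open>Joining arcs in the w plane\<close>

lemma image_diff_const_intervals:
  "(\<lambda>t. t - c) ` {a + c..b + c} = {a..b}" "(\<lambda>t. t - c) ` {a + c..} = {a..}" for a b c :: real
proof -
  show "(\<lambda>t. t - c) ` {a + c..b + c} = {a..b}" by (simp add: image_minus_const_atLeastAtMost')
  have "x \<in> (\<lambda>t. t - c) ` {a + c..}" if "x \<ge> a" for x
    using that by (intro image_eqI[of _ _ "x + c"]) auto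
  thus "(\<lambda>t. t - c) ` {a + c..} = {a..}" by auto
qed

lemma R2_chain_prepend:
  assumes T: "T > 0" and \<alpha>: "R2_arc_on {0..T} \<alpha>" and w: "R2_chain w" and eq: "\<alpha> T = w 0"
  shows "R2_chain (\<lambda>t. if t \<le> T then \<alpha> t else w (t - T))"
proof -
  let ?w = "\<lambda>t. if t \<le> T then \<alpha> t else w (t - T)"
  obtain m and \<tau> :: "nat \<Rightarrow> real" where \<tau>: "\<tau> 0 = 0" "\<And>i. i < m \<Longrightarrow> \<tau> i < \<tau> (Suc i)"
    "\<And>i. i < m \<Longrightarrow> R2_arc_on {\<tau> i..\<tau> (Suc i)} w" "R2_arc_on {\<tau> m..} w"
    using w unfolding R2_chain_def by blast
  have ge: "\<tau> i \<ge> 0" if "i \<le> m" for i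
    using that
  proof (induction i)
    case (Suc i)
    thus ?case using \<tau>(2)[of i] by simp
  qed (use \<tau> in auto)
  \<comment> \<open>The chain gains one arc at the front: old joints move by T, their indices by
    one.\<close>
  define \<sigma> where "\<sigma> = (\<lambda>i. case i of 0 \<Rightarrow> 0 | Suc j \<Rightarrow> \<tau> j + T)"
  have \<sigma>: "\<sigma> 0 = 0" "\<And>j. \<sigma> (Suc j) = \<tau> j + T" by (simp_all add: \<sigma>_def)
  have late: "w (t - T) = ?w t" if "t \<ge> T" for t using that eq by (cases "t = T") auto
  show ?thesis unfolding R2_chain_def
  proof (intro exI[of _ "Suc m"] exI[of _ \<sigma>] conjI allI impI)
    show "\<sigma> 0 = 0" by (rule \<sigma>)
    show "\<sigma> i < \<sigma> (Suc i)" if "i < Suc m" for i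
      using that \<tau>(1,2) T by (cases i) (auto simp: \<sigma>)
    show "R2_arc_on {\<sigma> i..\<sigma> (Suc i)} ?w" if i: "i < Suc m" for i
    proof (cases i)
      case 0
      have "R2_arc_on {0..T} ?w" by (rule R2_arc_on_cong[OF \<alpha>]) simp
      thus ?thesis using 0 by (simp add: \<sigma> \<tau>(1))
    next
      case (Suc j)
      hence j: "j < m" using i by simp
      have "R2_arc_on {\<tau> j + T..\<tau> (Suc j) + T} (\<lambda>t. w (t - T))"
        using \<tau>(3)[OF j] by (intro R2_arc_on_shift) (simp only: image_diff_const_intervals)
      hence "R2_arc_on {\<tau> j + T..\<tau> (Suc j) + T} ?w"
        by (rule R2_arc_on_cong) (rule late, use ge[of j] j in auto)
      thus ?thesis using Suc by (simp add: \<sigma>)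
    qed
    have "R2_arc_on {\<tau> m + T..} (\<lambda>t. w (t - T))"
      using \<tau>(4) by (intro R2_arc_on_shift) (simp only: image_diff_const_intervals)
    hence "R2_arc_on {\<tau> m + T..} ?w"
      by (rule R2_arc_on_cong) (rule late, use ge[of m] in auto)
    thus "R2_arc_on {\<sigma> (Suc m)..} ?w" by (simp add: \<sigma>)
  qed
qed

lemma liftable_prepend:
  assumes T: "T > 0" and \<alpha>: "R2_arc_on {0..T} \<alpha>"
    and slit: "\<And>t. t \<in> {0..T} \<Longrightarrow> cosh (\<alpha> t) \<notin> \<real>\<^sub>\<le>\<^sub>0"
    and mono: "\<And>s t. 0 \<le> s \<Longrightarrow> s \<le> t \<Longrightarrow> t \<le> T \<Longrightarrow> hxi (Re (\<alpha> s)) (Im (\<alpha> s)) \<le> hxi (Re (\<alpha> t)) (Im (\<alpha> t))"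
    and lift: "liftable (\<alpha> T)"
  shows "liftable (\<alpha> 0)"
proof -
  obtain w S a q where w: "R2_chain w" "w 0 = \<alpha> T" "\<And>t. t \<ge> 0 \<Longrightarrow> cosh (w t) \<notin> \<real>\<^sub>\<le>\<^sub>0"
     "mono_on {0..} (\<lambda>t. hxi (Re (w t)) (Im (w t)))" and q: "\<bar>q\<bar> \<le> pi / 4"
     and tl: "\<And>t. t \<ge> S \<Longrightarrow> w t = Complex (t + a) q"
    using lift unfolding liftable_def by blast
  let ?w = "\<lambda>t. if t \<le> T then \<alpha> t else w (t - T)"
  show ?thesis unfolding liftable_def
  proof (intro exI[of _ ?w] conjI)
    show "R2_chain ?w" by (rule R2_chain_prepend[OF T \<alpha> w(1) w(2)[symmetric]])
    show "?w 0 = \<alpha> 0" using T by simp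
    show "\<forall>t\<ge>0. cosh (?w t) \<notin> \<real>\<^sub>\<le>\<^sub>0" using slit w(3) by simp
    show "mono_on {0..} (\<lambda>t. hxi (Re (?w t)) (Im (?w t)))"
    proof (rule mono_onI)
      fix s t :: real assume st: "s \<in> {0..}" "t \<in> {0..}" "s \<le> t"
      have wm: "hxi (Re (w x)) (Im (w x)) \<le> hxi (Re (w y)) (Im (w y))" if "0 \<le> x" "x \<le> y" for x y
        using w(4) that by (auto simp: mono_on_def)
      consider "t \<le> T" | "s \<le> T" "t > T" | "s > T" using st by linarith
      thus "hxi (Re (?w s)) (Im (?w s)) \<le> hxi (Re (?w t)) (Im (?w t))"
      proof cases
        case 2
        have "hxi (Re (\<alpha> s)) (Im (\<alpha> s)) \<le> hxi (Re (\<alpha> T)) (Im (\<alpha> T))" using 2 st by (intro mono) auto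
        also have "\<dots> \<le> hxi (Re (w (t - T))) (Im (w (t - T)))" using wm[of 0 "t - T"] 2 w(2) by simp
        finally show ?thesis using 2 by simp
      qed (use mono wm st in auto)
    qed
    show "\<exists>T a q. \<bar>q\<bar> \<le> pi / 4 \<and> (\<forall>t\<ge>T. ?w t = Complex (t + a) q)"
    proof (rule exI[of _ "max (S + T) (T + 1)"], rule exI[of _ "a - T"], rule exI[of _ q], intro conjI allI impI q)
      fix t assume "max (S + T) (T + 1) \<le> t"
      thus "?w t = Complex (t + (a - T)) q" using tl[of "t - T"] by simp
    qed
  qed
qed

text \<open>The first criterion is for the principal sheet, where Re (cosh w) > 0; the second, Im
  (cosh w) \<noteq> 0, is for points on or beyond the lines |Im w| = \<pi>/2.\<close>

lemma slit_if:
  "\<bar>q\<bar> < pi / 2 \<Longrightarrow> cosh (Complex p q) \<notin> \<real>\<^sub>\<le>\<^sub>0"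
  "sinh p * sin q \<noteq> 0 \<Longrightarrow> cosh (Complex p q) \<notin> \<real>\<^sub>\<le>\<^sub>0"
  using cosh_pos_if[of q p] by (auto simp: complex_nonpos_Reals_iff Re_Im_sinh_cosh)

lemma Complex_line_has_vector_derivative:
  "((\<lambda>t. Complex (a + b * t) (c + d * t)) has_vector_derivative Complex b d) (at t within S)"
proof -
  have "((\<lambda>t. of_real (a + b * t) + \<i> * of_real (c + d * t)) has_vector_derivative of_real b + \<i> * of_real d) (at t within S)"
    by (intro has_vector_derivative_add has_vector_derivative_mult_right has_vector_derivative_of_real)
       (auto intro!: derivative_eq_intros simp: has_real_derivative_iff_has_vector_derivative[symmetric])
  thus ?thesis by (simp add: Complex_eq)
qed

lemma R2_arc_on_line:
  assumes "Complex b d \<noteq> 0"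
  shows "R2_arc_on I (\<lambda>t. Complex (a + b * t) (c + d * t))"
  unfolding R2_arc_on_def
  by (rule exI[of _ "\<lambda>_. Complex b d"], rule exI[of _ "\<lambda>_. 0"])
     (use assms in \<open>auto intro!: Complex_line_has_vector_derivative continuous_intros has_vector_derivative_const\<close>)

text \<open>For |q| \<le> \<pi>/4 the factor cos 2q is nonnegative, so Re \<xi> increases along a
  horizontal ray to the right. Such a ray ends every path constructed here.\<close>

lemma liftable_ray:
  assumes q: "\<bar>q\<bar> \<le> pi / 4"
  shows "liftable (Complex p q)"
proof -
  have q2: "\<bar>q\<bar> < pi / 2" using q pi_gt_zero by linarith
  have c: "cos (2 * q) \<ge> 0" using q by (intro cos_ge_zero) auto
  let ?w = "\<lambda>t. Complex (p + 1 * t) (q + 0 * t)"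
  show ?thesis unfolding liftable_def
  proof (intro exI[of _ ?w] conjI)
    show "R2_chain ?w" unfolding R2_chain_def
      by (rule exI[of _ 0], rule exI[of _ "\<lambda>_. 0"]) (use R2_arc_on_line[of 1 0] in \<open>simp add: complex_eq_iff\<close>)
    show "\<forall>t\<ge>0. cosh (?w t) \<notin> \<real>\<^sub>\<le>\<^sub>0" using slit_if(1)[OF q2] by simp
    show "mono_on {0..} (\<lambda>t. hxi (Re (?w t)) (Im (?w t)))"
      using c by (auto simp: mono_on_def hxi_def intro!: add_mono divide_right_mono mult_right_mono)
    show "\<exists>T a q. \<bar>q\<bar> \<le> pi / 4 \<and> (\<forall>t\<ge>T. ?w t = Complex (t + a) q)"
      by (rule exI[of _ 0], rule exI[of _ p], rule exI[of _ q]) (use q in \<open>simp add: add.commute\<close>)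
  qed simp
qed

lemma liftable_cnj: assumes "liftable w\<^sub>0" shows "liftable (cnj w\<^sub>0)"
proof -
  obtain w T a q where w: "R2_chain w" "w 0 = w\<^sub>0" "\<And>t. t \<ge> 0 \<Longrightarrow> cosh (w t) \<notin> \<real>\<^sub>\<le>\<^sub>0"
     "mono_on {0..} (\<lambda>t. hxi (Re (w t)) (Im (w t)))" and q: "\<bar>q\<bar> \<le> pi / 4"
     and tl: "\<And>t. t \<ge> T \<Longrightarrow> w t = Complex (t + a) q"
    using assms unfolding liftable_def by blast
  show ?thesis unfolding liftable_def
  proof (intro exI[of _ "\<lambda>t. cnj (w t)"] conjI)
    obtain m and \<tau> :: "nat \<Rightarrow> real" where \<tau>: "\<tau> 0 = 0" "\<And>i. i < m \<Longrightarrow> \<tau> i < \<tau> (Suc i)"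
      "\<And>i. i < m \<Longrightarrow> R2_arc_on {\<tau> i..\<tau> (Suc i)} w" "R2_arc_on {\<tau> m..} w"
      using w(1) unfolding R2_chain_def by blast
    thus "R2_chain (\<lambda>t. cnj (w t))" unfolding R2_chain_def using R2_arc_on_cnj by blast
    have c: "cosh (cnj z) = cnj (cosh z)" for z by (simp add: complex_eq_iff Re_Im_sinh_cosh)
    show "\<forall>t\<ge>0. cosh (cnj (w t)) \<notin> \<real>\<^sub>\<le>\<^sub>0" using w(3) unfolding c by (auto simp: complex_nonpos_Reals_iff)
    show "mono_on {0..} (\<lambda>t. hxi (Re (cnj (w t))) (Im (cnj (w t))))" using w(4) by (simp add: hxi_def)
    show "\<exists>T a q. \<bar>q\<bar> \<le> pi / 4 \<and> (\<forall>t\<ge>T. cnj (w t) = Complex (t + a) q)"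
      by (rule exI[of _ T], rule exI[of _ a], rule exI[of _ "- q"]) (use q tl in \<open>simp add: complex_eq_iff\<close>)
  qed (use w in simp)
qed

text \<open>For p \<ge> 0, lowering q to \<pi>/4 raises cos 2q and does not lower Re \<xi>; a ray
  follows. On q = \<pi>/2 itself cosh w is imaginary and, when p > 0, not zero, so the slit is
  avoided.\<close>

lemma liftable_vertical:
  assumes p: "p \<ge> 0" and q: "pi / 4 < q" "q \<le> pi / 2" and not_branch: "p = 0 \<Longrightarrow> q < pi / 2"
  shows "liftable (Complex p q)"
proof -
  let ?\<alpha> = "\<lambda>t. Complex (p + 0 * t) (q + (-1) * t)"
  have "liftable (?\<alpha> 0)"
  proof (rule liftable_prepend[where \<alpha> = ?\<alpha> and T = "q - pi / 4"])
    show "R2_arc_on {0..q - pi / 4} ?\<alpha>" by (rule R2_arc_on_line) (simp add: complex_eq_iff)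
    show "cosh (?\<alpha> t) \<notin> \<real>\<^sub>\<le>\<^sub>0" if t: "t \<in> {0..q - pi / 4}" for t
    proof (cases "q - t < pi / 2")
      case True
      hence "\<bar>q - t\<bar> < pi / 2" using t pi_gt_zero by auto
      thus ?thesis using slit_if(1)[of "q - t" p] by simp
    next
      case False
      hence "q - t = pi / 2" "p > 0" using t q not_branch p by (auto simp: less_le)
      hence "sinh p \<noteq> 0" by simp
      moreover have "sin (q - t) = 1" unfolding \<open>q - t = pi / 2\<close> by simp
      ultimately have "sinh p * sin (q - t) \<noteq> 0" by simp
      from slit_if(2)[OF this] show ?thesis by simp
    qed
    show "hxi (Re (?\<alpha> s)) (Im (?\<alpha> s)) \<le> hxi (Re (?\<alpha> t)) (Im (?\<alpha> t))" if "0 \<le> s" "s \<le> t" "t \<le> q - pi / 4" for s t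
    proof -
      have "cos (2 * (q - s)) \<le> cos (2 * (q - t))" using that q pi_gt_zero by (intro cos_monotone_0_pi_le) auto
      thus ?thesis using p by (simp add: hxi_def mult_left_mono)
    qed
    show "liftable (?\<alpha> (q - pi / 4))" using liftable_ray[of "pi / 4" p] by simp
  qed (use q in simp)
  thus ?thesis by simp
qed

section \<open>Arcs on or near level curves of Re \<xi>\<close>

text \<open>Smoothness is inherited from a holomorphic extension G of g: the arc is the image of a
  real interval under p + cz + iG(z). As G is real on the interval, the derivative has real part c
  there and does not vanish.\<close>

lemma R2_arc_on_graph:
  fixes g :: "real \<Rightarrow> real" and G :: "complex \<Rightarrow> complex"
  assumes ab: "a < b" and G: "G analytic_on (of_real ` {a..b})"
    and real: "\<And>t. t \<in> {a..b} \<Longrightarrow> G (of_real t) = of_real (g t)" and c: "c \<noteq> 0"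
  shows "R2_arc_on {a..b} (\<lambda>t. Complex (p + c * t) (g t))"
proof -
  obtain S where S: "open S" "of_real ` {a..b} \<subseteq> S" "G holomorphic_on S"
    using G unfolding analytic_on_holomorphic by blast
  define F where "F z = of_real p + of_real c * z + \<i> * G z" for z
  have F: "F holomorphic_on S" unfolding F_def by (intro holomorphic_intros S)
  have of: "R2_arc_on {a..b} complex_of_real"
    unfolding R2_arc_on_def
    by (rule exI[of _ "\<lambda>_. 1"], rule exI[of _ "\<lambda>_. 0"])
       (auto intro!: continuous_intros has_vector_derivative_const has_vector_derivative_of_real[of "\<lambda>x. x" 1, simplified] has_vector_derivative_id[unfolded id_def])
  have "R2_arc_on {a..b} (\<lambda>t. F (of_real t))"
  proof (rule R2_arc_on_compose[OF of S(1) S(2) F])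
    fix t assume t: "t \<in> {a..b}"
    have dG: "(G has_field_derivative deriv G (of_real t)) (at (of_real t))"
      using S t by (intro holomorphic_derivI[OF S(3) S(1)]) auto
    hence "(F has_field_derivative 0 + of_real c * 1 + \<i> * deriv G (of_real t)) (at (of_real t))"
      unfolding F_def by (intro DERIV_add DERIV_cmult DERIV_const DERIV_ident)
    hence dF: "deriv F (of_real t) = of_real c + \<i> * deriv G (of_real t)" by (simp add: DERIV_imp_deriv)
    have "((\<lambda>t. complex_of_real t) has_vector_derivative 1) (at t within {a..b})"
      using of t unfolding R2_arc_on_def
      by (auto intro!: has_vector_derivative_of_real[of "\<lambda>x. x" 1, simplified] has_vector_derivative_id[unfolded id_def])
    from field_vector_diff_chain_within[OF this has_field_derivative_at_within[OF dG]]
    have "((\<lambda>t. G (of_real t)) has_vector_derivative deriv G (of_real t)) (at t within {a..b})" by (simp add: o_def)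
    hence 1: "((\<lambda>t. Im (G (of_real t))) has_vector_derivative Im (deriv G (of_real t))) (at t within {a..b})"
      by (rule bounded_linear.has_vector_derivative[OF bounded_linear_Im])
    have "((\<lambda>t. Im (G (of_real t))) has_vector_derivative 0) (at t within {a..b})"
      by (rule has_vector_derivative_transform[of t "{a..b}" _ "\<lambda>_. 0"]) (use t real in \<open>auto intro: has_vector_derivative_const\<close>)
    hence "Im (deriv G (of_real t)) = 0"
      using vector_derivative_unique_within_closed_interval[OF ab _ _ , of t] 1 t by (metis cbox_interval)
    hence "Re (deriv F (of_real t)) = c" by (simp add: dF)
    thus "deriv F (of_real t) \<noteq> 0" using c by auto
  qed
  thus ?thesis by (rule R2_arc_on_cong) (simp add: F_def real complex_eq_iff)
qed

lemma open_slit_plane: "open {z. Im z = 0 \<longrightarrow> \<bar>Re z\<bar> < 1}"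
proof -
  have "{z. Im z = 0 \<longrightarrow> \<bar>Re z\<bar> < 1} = {z. Im z \<noteq> 0} \<union> {z. \<bar>Re z\<bar> < 1}" by auto
  thus ?thesis by (auto intro!: open_Un open_Collect_neq open_Collect_less continuous_intros)
qed

lemma analytic_on_Arccos_Arcsin:
  assumes "f analytic_on A" "\<And>z. z \<in> A \<Longrightarrow> Im (f z) = 0 \<longrightarrow> \<bar>Re (f z)\<bar> < 1"
  shows "(\<lambda>z. Arccos (f z)) analytic_on A" "(\<lambda>z. Arcsin (f z)) analytic_on A"
proof -
  let ?S = "{z. Im z = 0 \<longrightarrow> \<bar>Re z\<bar> < 1}"
  have "Arccos analytic_on ?S" "Arcsin analytic_on ?S"
    unfolding analytic_on_open[OF open_slit_plane] by (auto intro!: holomorphic_on_Arccos holomorphic_on_Arcsin)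
  from analytic_on_compose_gen[OF assms(1) this(1)] analytic_on_compose_gen[OF assms(1) this(2)] assms(2)
  show "(\<lambda>z. Arccos (f z)) analytic_on A" "(\<lambda>z. Arcsin (f z)) analytic_on A" by (auto simp: o_def)
qed

lemma sinh_complex_of_real: "sinh (complex_of_real x) = of_real (sinh x)"
  by (simp add: complex_eq_iff Re_Im_sinh_cosh)

text \<open>The path follows the level curve 4 Re \<xi> = -\<eta>, on which cos 2q = -(\<eta> +
  2x)/sinh 2x with x = Re w. It moves right until cos 2q = 0, that is q = \<pi>/4, where a ray takes
  over.\<close>

lemma liftable_left_sheet:
  assumes p: "p < 0" and q: "pi / 4 < q" "q < pi / 2" and h: "hxi p q < 0"
  shows "liftable (Complex p q)"
proof -
  define \<eta> where "\<eta> = - (2 * p + sinh (2 * p) * cos (2 * q))"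
  have \<eta>: "\<eta> > 0" using h by (simp add: hxi_def \<eta>_def)
  define C where "C x = - (\<eta> + 2 * x) / sinh (2 * x)" for x
  have s2p: "sinh (2 * p) < 0" using p by simp
  have Cp: "cos (2 * q) = C p" using s2p by (simp add: C_def \<eta>_def)
  have "cos (2 * q) < 0" using cos_monotone_0_pi[of "pi/2" "2 * q"] q by simp
  hence "\<eta> + 2 * p < 0" using s2p unfolding Cp C_def by (simp add: divide_less_0_iff zero_less_divide_iff)
  \<comment> \<open>The arc ends at x = p + T = -\<eta>/2, the zero of \<eta> + 2x.\<close>
  define T where "T = - \<eta> / 2 - p"
  have T: "T > 0" using \<open>\<eta> + 2 * p < 0\<close> by (simp add: T_def)
  have C: "- 1 < C (p + t)" "C (p + t) \<le> 0" "sinh (2 * (p + t)) < 0" if "t \<in> {0..T}" for t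
  proof -
    \<comment> \<open>In terms of y the bound C > -1 reads y - \<eta> < sinh y, and C \<le> 0 reads
      y \<ge> \<eta>.\<close>
    define y where "y = - 2 * (p + t)"
    have y: "y \<ge> \<eta>" using that by (simp add: y_def T_def)
    have sy: "sinh y > y" using y \<eta> by (intro sinh_gt_self) simp
    have eq: "2 * (p + t) = - y" by (simp add: y_def)
    have Cy: "C (p + t) = (\<eta> - y) / sinh y" unfolding C_def eq by (simp add: minus_divide_left)
    show "C (p + t) \<le> 0" unfolding Cy using y \<eta> sy by (intro divide_nonpos_nonneg) auto
    show "- 1 < C (p + t)" unfolding Cy using y \<eta> sy by (simp add: less_divide_eq)
    show "sinh (2 * (p + t)) < 0" unfolding eq using y \<eta> by simp
  qed
  let ?\<alpha> = "\<lambda>t. Complex (p + 1 * t) (arccos (C (p + t)) / 2)"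
  have "liftable (?\<alpha> 0)"
  proof (rule liftable_prepend[where \<alpha> = ?\<alpha>, OF T])
    let ?G = "\<lambda>z. Arccos (- (of_real \<eta> + 2 * (of_real p + z)) / sinh (2 * (of_real p + z))) / 2"
    have inner: "- (of_real \<eta> + 2 * (of_real p + of_real t)) / sinh (2 * (of_real p + of_real t)) = complex_of_real (C (p + t))" for t
      using sinh_complex_of_real[of "2 * (p + t)"] by (simp add: C_def)
    show "R2_arc_on {0..T} ?\<alpha>"
    proof (rule R2_arc_on_graph[OF T, where G = ?G])
      show "?G analytic_on of_real ` {0..T}"
      proof (intro analytic_on_divide analytic_on_Arccos_Arcsin(1) analytic_intros)
        fix z :: complex assume "z \<in> of_real ` {0..T}"
        then obtain t where t: "t \<in> {0..T}" "z = of_real t" by auto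
        show "sinh (2 * (of_real p + z)) \<noteq> 0"
          using sinh_complex_of_real[of "2 * (p + t)"] C(3)[OF t(1)] t(2) by simp
        show "Im (- (of_real \<eta> + 2 * (of_real p + z)) / sinh (2 * (of_real p + z))) = 0 \<longrightarrow>
           \<bar>Re (- (of_real \<eta> + 2 * (of_real p + z)) / sinh (2 * (of_real p + z)))\<bar> < 1"
          unfolding t(2) inner using C[OF t(1)] by simp
      qed auto
      fix t assume t: "t \<in> {0..T}"
      show "?G (of_real t) = of_real (arccos (C (p + t)) / 2)"
        unfolding inner using C[OF t] by (simp add: of_real_arccos)
    qed simp
    have im: "pi / 4 \<le> arccos (C (p + t)) / 2" "arccos (C (p + t)) / 2 < pi / 2" if "t \<in> {0..T}" for t
    proof -
      have "arccos (C (p + t)) \<ge> arccos 0" using C[OF that] by (intro arccos_le_arccos) auto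
      thus "pi / 4 \<le> arccos (C (p + t)) / 2" by simp
      have "arccos (C (p + t)) < pi" using C[OF that] arccos_lt_bounded[of "C (p + t)"] by linarith
      thus "arccos (C (p + t)) / 2 < pi / 2" by simp
    qed
    show "cosh (?\<alpha> t) \<notin> \<real>\<^sub>\<le>\<^sub>0" if "t \<in> {0..T}" for t
      using im[OF that] pi_gt_zero by (intro slit_if(1)) simp
    have hx: "hxi (Re (?\<alpha> t)) (Im (?\<alpha> t)) = - \<eta> / 4" if "t \<in> {0..T}" for t
    proof -
      have "cos (2 * (arccos (C (p + t)) / 2)) = C (p + t)" using C[OF that] by simp
      hence "hxi (Re (?\<alpha> t)) (Im (?\<alpha> t)) = (p + t) / 2 + sinh (2 * (p + t)) * C (p + t) / 4"
        by (simp add: hxi_def)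
      also have "sinh (2 * (p + t)) * C (p + t) = - (\<eta> + 2 * (p + t))" using C(3)[OF that] by (simp add: C_def)
      finally show ?thesis by (simp add: field_simps)
    qed
    show "hxi (Re (?\<alpha> s)) (Im (?\<alpha> s)) \<le> hxi (Re (?\<alpha> t)) (Im (?\<alpha> t))" if "0 \<le> s" "s \<le> t" "t \<le> T" for s t
      using hx[of s] hx[of t] that by simp
    have "C (p + T) = 0" by (simp add: C_def T_def)
    thus "liftable (?\<alpha> T)" using liftable_ray[of "pi / 4" "p + T"] by simp
  qed
  moreover have "arccos (C (p + 0)) / 2 = q" using q Cp arccos_cos[of "2 * q"] by simp
  ultimately show ?thesis by simp
qed

text \<open>In this region the level curve of \<open>Re \<xi>\<close> meets \<open>Im w = \<pi>/2\<close> at a right angle, so it is not a smooth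
  graph over \<open>Re w\<close> there. Replacing \<open>\<phi> - const\<close> by \<open>(\<phi> - c)\<^sup>2/\<phi> = \<phi> - 2c + c\<^sup>2/\<phi>\<close>, where \<open>\<phi> = sinh 2p - 2p\<close>,
  gives a nearby curve that is smooth up to \<open>Im w = \<pi>/2\<close> and along which \<open>-4 Re \<xi> = 2c - c\<^sup>2/\<phi>\<close> decreases with \<open>p\<close>.\<close>

lemma liftable_tongue:
  assumes p: "p > 0" and q: "pi / 2 < q" "q < pi" and h: "hxi p q < 0"
  shows "liftable (Complex p q)"
proof -
  define \<phi> where "\<phi> y = sinh y - y" for y :: real
  have \<phi>pos: "\<phi> y > 0" if "y > 0" for y using sinh_gt_self[OF that] by (simp add: \<phi>_def)
  have \<phi>mono: "\<phi> x \<le> \<phi> y" if "0 \<le> x" "x \<le> y" for x y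
  proof (rule DERIV_nonneg_imp_nondecreasing[OF that(2)])
    fix z assume "x \<le> z" "z \<le> y"
    have "(\<phi> has_real_derivative cosh z - 1) (at z)" unfolding \<phi>_def by (auto intro!: derivative_eq_intros)
    thus "\<exists>d. (\<phi> has_real_derivative d) (at z) \<and> d \<ge> 0" using cosh_real_ge_1[of z] by auto
  qed
  define \<phi>0 where "\<phi>0 = \<phi> (2 * p)"
  have \<phi>0: "\<phi>0 > 0" using p \<phi>pos by (simp add: \<phi>0_def)
  have s0: "sinh (2 * p) > 0" using p by simp
  \<comment> \<open>At the start 4 Re \<xi> = D - \<phi>0, so the assumption on \<open>hxi\<close>
    means D < \<phi>0.\<close>
  define D where "D = sinh (2 * p) * (1 + cos (2 * q))"
  have cosq: "cos q < 0" using q cos_monotone_0_pi[of "pi/2" q] by simp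
  have D2: "D = sinh (2 * p) * (2 * cos q ^ 2)" by (simp add: D_def cos_double_cos)
  have D: "D > 0" unfolding D2 using s0 cosq by simp
  have D\<phi>: "D < \<phi>0" using h by (simp add: D_def \<phi>0_def \<phi>_def hxi_def algebra_simps)
  \<comment> \<open>Chosen so that (\<phi>0 - c)^2 / \<phi>0 = D, which makes the modified curve
    start at the given q.\<close>
  define c where "c = \<phi>0 - sqrt (D * \<phi>0)"
  have "sqrt (D * \<phi>0) < sqrt (\<phi>0 * \<phi>0)" using D\<phi> \<phi>0 by (intro real_sqrt_less_mono mult_strict_right_mono)
  hence c: "0 < c" "c < \<phi>0" using D \<phi>0 by (auto simp: c_def)
  \<comment> \<open>The curve meets Im w = \<pi>/2 where \<phi> = c, at Re w = a/2; from there a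
    vertical segment continues.\<close>
  have "\<exists>a. 0 \<le> a \<and> a \<le> 2 * p \<and> \<phi> a = c"
    by (rule IVT') (use c p in \<open>auto simp: \<phi>0_def \<phi>_def intro!: continuous_intros\<close>)
  then obtain a where a: "0 \<le> a" "a \<le> 2 * p" "\<phi> a = c" by blast
  have a0: "0 < a" using a c by (cases "a = 0") (auto simp: \<phi>_def)
  have a2: "a < 2 * p" using a c by (cases "a = 2 * p") (auto simp: \<phi>0_def)
  define T where "T = p - a / 2"
  have T: "T > 0" using a2 by (simp add: T_def)
  \<comment> \<open>On the curve sin (q - \<pi>/2) = R. Because of the square in (\<phi> - c)^2 the
    root is analytic through its zero, whereas the level curve itself would have a square root
    singularity there.\<close>
  define R where "R y = (\<phi> y - c) / sqrt (2 * \<phi> y * sinh y)" for y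
  have y: "0 < 2 * (p - t) \<and> c \<le> \<phi> (2 * (p - t)) \<and> 0 < sinh (2 * (p - t))" if "t \<in> {0..T}" for t
  proof -
    have "a \<le> 2 * (p - t)" using that by (simp add: T_def)
    thus ?thesis using \<phi>mono[of a "2 * (p - t)"] a0 a(3) by simp
  qed
  have R2: "R y ^ 2 = (\<phi> y - c)^2 / (2 * \<phi> y * sinh y)" if "0 < \<phi> y" "0 < sinh y" for y
    using that by (simp add: R_def power_divide)
  have R: "0 \<le> R (2 * (p - t))" "R (2 * (p - t)) < 1" if t: "t \<in> {0..T}" for t
  proof -
    let ?y = "2 * (p - t)"
    note yt = y[OF t]
    have ph: "0 < \<phi> ?y" using yt \<phi>pos by blast
    show "0 \<le> R ?y" unfolding R_def using yt ph by simp
    have "(\<phi> ?y - c)^2 \<le> \<phi> ?y ^ 2" using yt c by (intro power_mono) auto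
    also have "\<dots> < 2 * \<phi> ?y * sinh ?y"
    proof -
      have "- ?y < sinh ?y" using yt by linarith
      hence "\<phi> ?y < 2 * sinh ?y" by (simp add: \<phi>_def)
      hence "\<phi> ?y * \<phi> ?y < \<phi> ?y * (2 * sinh ?y)" using ph by (rule mult_strict_left_mono)
      thus ?thesis by (simp add: power2_eq_square mult_ac)
    qed
    finally have "R ?y ^ 2 < 1" using R2[OF ph] yt ph by (simp add: divide_less_eq)
    thus "R ?y < 1" using abs_square_less_1[of "R ?y"] by simp
  qed
  let ?\<alpha> = "\<lambda>t. Complex (p + (-1) * t) (pi / 2 + arcsin (R (2 * (p - t))))"
  have "liftable (?\<alpha> 0)"
  proof (rule liftable_prepend[where \<alpha> = ?\<alpha>, OF T])
    let ?y = "\<lambda>z. 2 * (of_real p - z) :: complex"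
    let ?r = "\<lambda>z. (sinh (?y z) - ?y z - of_real c) / csqrt (2 * (sinh (?y z) - ?y z) * sinh (?y z))"
    let ?G = "\<lambda>z. of_real (pi / 2) + Arcsin (?r z)"
    have rad: "2 * (sinh (?y (of_real t)) - ?y (of_real t)) * sinh (?y (of_real t)) =
       complex_of_real (2 * \<phi> (2 * (p - t)) * sinh (2 * (p - t)))" for t
      using sinh_complex_of_real[of "2 * (p - t)"] by (simp add: \<phi>_def)
    have radpos: "2 * \<phi> (2 * (p - t)) * sinh (2 * (p - t)) > 0" if "t \<in> {0..T}" for t
      using y[OF that] \<phi>pos by simp
    have inner: "?r (of_real t) = complex_of_real (R (2 * (p - t)))" if "t \<in> {0..T}" for t
      unfolding rad using radpos[OF that] sinh_complex_of_real[of "2 * (p - t)"]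
      by (simp add: R_def \<phi>_def of_real_sqrt [symmetric])
    show "R2_arc_on {0..T} ?\<alpha>"
    proof (rule R2_arc_on_graph[OF T, where G = ?G])
      show "?G analytic_on of_real ` {0..T}"
      proof (intro analytic_on_add analytic_on_const analytic_on_Arccos_Arcsin(2) analytic_on_divide analytic_on_csqrt' analytic_intros)
        fix z :: complex assume "z \<in> of_real ` {0..T}"
        then obtain t where t: "t \<in> {0..T}" "z = of_real t" by auto
        show "2 * (sinh (?y z) - ?y z) * sinh (?y z) \<notin> \<real>\<^sub>\<le>\<^sub>0"
          unfolding t(2) rad using radpos[OF t(1)] by (simp only: complex_nonpos_Reals_iff) simp
        show "csqrt (2 * (sinh (?y z) - ?y z) * sinh (?y z)) \<noteq> 0"
          unfolding t(2) rad using radpos[OF t(1)] by (simp only: csqrt_eq_0 of_real_eq_0_iff)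
        show "Im (?r z) = 0 \<longrightarrow> \<bar>Re (?r z)\<bar> < 1"
          unfolding t(2) inner[OF t(1)] using R[OF t(1)] by simp
      qed
      fix t assume t: "t \<in> {0..T}"
      show "?G (of_real t) = of_real (pi / 2 + arcsin (R (2 * (p - t))))"
        unfolding inner[OF t] using R[OF t] by (simp add: of_real_arcsin)
    qed simp
    show "cosh (?\<alpha> t) \<notin> \<real>\<^sub>\<le>\<^sub>0" if t: "t \<in> {0..T}" for t
    proof (rule slit_if(2))
      have "sin (pi / 2 + arcsin (R (2 * (p - t)))) = sqrt (1 - R (2 * (p - t)) ^ 2)"
        using R[OF t] by (simp add: sin_add cos_arcsin)
      moreover have "R (2 * (p - t)) ^ 2 < 1" using R[OF t] by (simp add: abs_square_less_1)
      moreover have "sinh (p - t) > 0" using y[OF t] by simp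
      ultimately show "sinh (p + (-1) * t) * sin (pi / 2 + arcsin (R (2 * (p - t)))) \<noteq> 0" by simp
    qed
    have hx: "hxi (Re (?\<alpha> t)) (Im (?\<alpha> t)) = - (2 * c - c^2 / \<phi> (2 * (p - t))) / 4" if t: "t \<in> {0..T}" for t
    proof -
      let ?z = "2 * (p - t)"
      have ph: "0 < \<phi> ?z" "0 < sinh ?z" using y[OF t] \<phi>pos by blast+
      have "cos (2 * (pi / 2 + arcsin (R ?z))) = - cos (2 * arcsin (R ?z))" by (simp add: distrib_left cos_add)
      also have "\<dots> = - (1 - 2 * R ?z ^ 2)" using R[OF t] by (simp add: cos_double_sin)
      finally have "hxi (Re (?\<alpha> t)) (Im (?\<alpha> t)) = ?z / 4 + sinh ?z * - (1 - 2 * R ?z ^ 2) / 4"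
        by (simp add: hxi_def)
      also have "\<dots> = - (\<phi> ?z - 2 * (sinh ?z * R ?z ^ 2)) / 4"
        unfolding \<phi>_def by (simp only: distrib_left right_diff_distrib diff_divide_distrib add_divide_distrib) (simp add: field_simps)
      also have "2 * (sinh ?z * R ?z ^ 2) = (\<phi> ?z - c)^2 / \<phi> ?z" unfolding R2[OF ph] using ph by simp
      also have "\<phi> ?z - (\<phi> ?z - c)^2 / \<phi> ?z = 2 * c - c^2 / \<phi> ?z" using ph by (simp add: field_simps power2_eq_square)
      finally show ?thesis .
    qed
    show "hxi (Re (?\<alpha> s)) (Im (?\<alpha> s)) \<le> hxi (Re (?\<alpha> t)) (Im (?\<alpha> t))" if st: "0 \<le> s" "s \<le> t" "t \<le> T" for s t
    proof -
      have ph: "0 < \<phi> (2 * (p - t))" using y[of t] \<phi>pos st by auto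
      moreover have "\<phi> (2 * (p - t)) \<le> \<phi> (2 * (p - s))" using \<phi>mono y[of t] st by auto
      ultimately have "c^2 / \<phi> (2 * (p - s)) \<le> c^2 / \<phi> (2 * (p - t))" by (intro divide_left_mono) auto
      thus ?thesis using hx[of s] hx[of t] st by simp
    qed
    have "2 * (p - T) = a" by (simp add: T_def)
    hence "R (2 * (p - T)) = 0" using a(3) by (simp add: R_def)
    moreover have "liftable (Complex (p - T) (pi / 2))" using a0 by (intro liftable_vertical) (auto simp: T_def)
    ultimately show "liftable (?\<alpha> T)" by simp
  qed
  moreover have "pi / 2 + arcsin (R (2 * (p - 0))) = q"
  proof -
    have "R (2 * p) ^ 2 = (sqrt (D * \<phi>0))^2 / (2 * \<phi>0 * sinh (2 * p))"
      using R2[of "2 * p"] \<phi>0 s0 by (simp add: \<phi>0_def [symmetric] c_def)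
    also have "\<dots> = cos q ^ 2" using D \<phi>0 s0 by (simp add: D2)
    finally have "R (2 * p) = - cos q" using R(1)[of 0] T cosq by (simp add: power2_eq_iff)
    also have "\<dots> = sin (q - pi / 2)" by (simp add: sin_diff)
    finally show ?thesis using q by (simp add: arcsin_sin)
  qed
  ultimately show ?thesis by simp
qed

text \<open>Conjugation reduces to 0 \<le> Im w \<le> \<pi>/2, and there only the left half with Re
  \<xi> > 0 needs a change of sheet. The map w -> i\<pi> - w keeps z and reverses the sign of Re
  \<xi>; the path then returns to the principal sheet across Im w = \<pi>/2, that is across a
  cut.\<close>

lemma liftable_off_left_level_curves:
  assumes "z \<notin> left_level_curves"
  shows "\<exists>w. sinh w = z \<and> liftable w"
proof -
  have main: "\<exists>w'. sinh w' = sinh (Complex p q) \<and> liftable w'"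
    if q: "0 \<le> q" "q \<le> pi / 2" and p0: "q = pi / 2 \<Longrightarrow> p > 0" and h: "p < 0 \<Longrightarrow> hxi p q \<noteq> 0" for p q
  proof -
    consider "q \<le> pi / 4" | "q > pi / 4" "p \<ge> 0" | "q > pi / 4" "p < 0" "hxi p q < 0" | "q > pi / 4" "p < 0" "hxi p q > 0"
      using h by linarith
    thus ?thesis
    proof cases
      case 1
      thus ?thesis using liftable_ray[of q p] q by auto
    next
      case 2
      hence "liftable (Complex p q)" using q p0 by (intro liftable_vertical) (auto simp: less_le)
      thus ?thesis by blast
    next
      case 3
      hence "q < pi / 2" using q p0 by (auto simp: less_le)
      thus ?thesis using liftable_left_sheet[of p q] 3 by blast
    next
      case 4
      hence q2: "q < pi / 2" using q p0 by (auto simp: less_le)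
      have "hxi (- p) (pi - q) = - hxi p q" by (simp add: hxi_def right_diff_distrib cos_diff)
      hence "liftable (Complex (- p) (pi - q))" using 4 q2 pi_gt_zero by (intro liftable_tongue) auto
      moreover have "sinh (Complex (- p) (pi - q)) = sinh (Complex p q)"
        by (simp add: complex_eq_iff Re_Im_sinh_cosh cos_diff sin_diff)
      ultimately show ?thesis by blast
    qed
  qed
  obtain w where w: "z = sinh w" "\<bar>Im w\<bar> \<le> pi / 2" "\<bar>Im w\<bar> = pi / 2 \<longrightarrow> Re w \<ge> 0"
    by (rule sinh_coordinates)
  have hcnj: "hxi (Re w) \<bar>Im w\<bar> = hxi (Re w) (Im w)" by (simp add: hxi_def abs_if)
  have 1: "Re w > 0" if "\<bar>Im w\<bar> = pi / 2"
  proof -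
    have "Re w \<noteq> 0"
    proof
      assume 0: "Re w = 0"
      have "Im w = pi / 2 \<or> Im w = - (pi / 2)" using that by linarith
      hence "sin (Im w) = 1 \<and> cos (Im w) = 0 \<or> sin (Im w) = - 1 \<and> cos (Im w) = 0"
        by (elim disjE) (simp_all only: sin_minus cos_minus sin_pi_half cos_pi_half simp_thms)
      hence "z = \<i> \<or> z = - \<i>" unfolding w(1) using 0 by (auto simp: complex_eq_iff Re_Im_sinh_cosh)
      thus False using assms by (auto simp: left_level_curves_def)
    qed
    thus ?thesis using w(3) that by simp
  qed
  have 2: "hxi (Re w) \<bar>Im w\<bar> \<noteq> 0" if "Re w < 0"
  proof
    assume "hxi (Re w) \<bar>Im w\<bar> = 0"
    hence h0: "hxi (Re w) (Im w) = 0" using hcnj by simp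
    have "\<bar>Im w\<bar> < pi / 2" using w(2,3) that by (auto simp: less_le)
    hence c: "cos (Im w) > 0" by (intro cos_gt_zero_pi) auto
    have "Re z < 0" unfolding w(1) Re_Im_sinh_cosh using c that by (simp add: mult_neg_pos)
    moreover have "Re (xibar z) = 0" using Re_xibar_sinh[of w] c h0 w(1) by (simp add: Re_Im_sinh_cosh)
    ultimately show False using assms by (simp add: left_level_curves_eq)
  qed
  obtain w' where w': "sinh w' = sinh (Complex (Re w) \<bar>Im w\<bar>)" "liftable w'"
    using main[of "\<bar>Im w\<bar>" "Re w"] w(2) 1 2 by auto
  show ?thesis
  proof (cases "Im w \<ge> 0")
    case True
    thus ?thesis using w' w(1) by auto
  next
    case False
    have "sinh (cnj w') = cnj (sinh w')" by (simp add: complex_eq_iff Re_Im_sinh_cosh)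
    also have "\<dots> = z" unfolding w' w(1) using False by (simp add: complex_eq_iff Re_Im_sinh_cosh)
    finally show ?thesis using liftable_cnj[OF w'(2)] by blast
  qed
qed

section \<open>Reflection in the origin\<close>

lemma R2_chain_uminus:
  assumes "R2_chain \<gamma>"
  shows "R2_chain (\<lambda>t. - \<gamma> t)"
  by (rule R2_chain_compose[where F = uminus and S = UNIV])
     (use assms in \<open>auto intro!: holomorphic_intros\<close>)

lemma vector_derivative_uminus:
  assumes "(f has_vector_derivative vector_derivative f (at t)) (at t)"
  shows "vector_derivative (\<lambda>t. - f t) (at t) = - vector_derivative f (at t)"
  by (rule vector_derivative_at[OF has_vector_derivative_minus[OF assms]])

text \<open>\<open>vector_derivative\<close> is meaningful only where a derivative exists. Off a
  finite set it exists for the path and for its \<beta> image, so negation passes through it up to a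
  null set.\<close>

lemma admissible_regular:
  assumes "admissible_to \<sigma> z \<gamma> Q X"
  obtains T where "finite T"
    "\<And>t. t \<ge> 0 \<Longrightarrow> t \<notin> T \<Longrightarrow> (\<gamma> has_vector_derivative vector_derivative \<gamma> (at t)) (at t)"
    "\<And>t. t \<ge> 0 \<Longrightarrow> t \<notin> T \<Longrightarrow>
      (beta_along \<gamma> Q has_vector_derivative vector_derivative (beta_along \<gamma> Q) (at t)) (at t)"
proof -
  have a: "R2_chain \<gamma>" "\<And>t. t \<ge> 0 \<Longrightarrow> \<gamma> t \<noteq> \<i> \<and> \<gamma> t \<noteq> -\<i>" "continuous_on {0..} Q"
    "\<And>t. t \<ge> 0 \<Longrightarrow> Q t ^ 4 = 1 + (\<gamma> t)^2"
    using assms by (simp_all add: admissible_to_def continued_along_def)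
  obtain T where T: "finite T" "\<And>t. t > 0 \<Longrightarrow> t \<notin> T \<Longrightarrow> nice_at \<gamma> t"
    using R2_chain_nice(2)[OF a(1)] by blast
  have d: "(\<gamma> has_vector_derivative vector_derivative \<gamma> (at t)) (at t) \<and>
      (beta_along \<gamma> Q has_vector_derivative vector_derivative (beta_along \<gamma> Q) (at t)) (at t)"
    if t: "t \<ge> 0" "t \<notin> insert 0 T" for t
  proof -
    have t0: "t > 0" using t by auto
    have \<gamma>: "(\<gamma> has_vector_derivative vector_derivative \<gamma> (at t)) (at t)"
      using T(2)[OF t0] t by (auto simp: nice_at_def)
    have d\<gamma>: "\<gamma> differentiable (at t)" by (rule differentiableI_vector[OF \<gamma>])
    have Q0: "Q t \<noteq> 0"
    proof
      assume "Q t = 0"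
      hence "1 + (\<gamma> t)^2 = 0" using a(4)[OF t(1)] by simp
      hence "(\<gamma> t - \<i>) * (\<gamma> t + \<i>) = 0" by (simp add: algebra_simps power2_eq_square)
      thus False using a(2)[OF t(1)] by (auto simp: eq_neg_iff_add_eq_0)
    qed
    have "isCont Q t" using continuous_on_interior[OF a(3)] t0 by (simp add: interior_real_atLeast)
    moreover have "(\<lambda>s. 1 + \<gamma> s * \<gamma> s) differentiable (at t)"
      by (intro differentiable_add differentiable_const differentiable_mult d\<gamma>)
    hence "((\<lambda>s. 1 + \<gamma> s * \<gamma> s) has_vector_derivative vector_derivative (\<lambda>s. 1 + \<gamma> s * \<gamma> s) (at t)) (at t)"
      by (simp only: vector_derivative_works)
    moreover have "\<forall>\<^sub>F s in nhds t. Q s ^ 4 = 1 + \<gamma> s * \<gamma> s"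
      using eventually_nhds_in_open[of "{0<..}" t] t0
      by (auto elim!: eventually_mono simp: a(4) power2_eq_square)
    ultimately have "Q differentiable (at t)"
      using differentiableI_vector[OF continuous_root4_has_vector_derivative] Q0 by blast
    hence "(\<lambda>t. \<gamma> t / (Q t * Q t)) differentiable (at t)"
      using Q0 by (intro differentiable_divide differentiable_mult d\<gamma>) auto
    moreover have "beta_along \<gamma> Q = (\<lambda>t. \<gamma> t / (Q t * Q t))"
      by (simp add: fun_eq_iff beta_along_def power2_eq_square)
    ultimately show ?thesis using \<gamma> by (simp only: vector_derivative_works)
  qed
  show ?thesis by (rule that[of "insert 0 T"]) (use T(1) d in auto)
qed

lemma beta_along_uminus: "beta_along (\<lambda>t. - \<gamma> t) Q = (\<lambda>t. - beta_along \<gamma> Q t)"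
  by (simp add: fun_eq_iff beta_along_def)

text \<open>xsqrt is even and z + xsqrt z goes into its reciprocal; the logarithm just changes sign
  because its argument avoids the negative axis.\<close>

lemma xibar_uminus:
  assumes "z \<in> cut_plane"
  shows "xibar (- z) = - xibar z"
proof -
  have "- z \<in> cut_plane" using assms by (simp add: cut_plane_iff)
  moreover have "xsqrt (- z) = xsqrt z" by (simp add: xsqrt_def)
  moreover have "xsqrt z - z = inverse (z + xsqrt z)"
    using xsqrt_mult[of z] by (simp add: inverse_unique)
  hence "Ln (xsqrt z - z) = - Ln (z + xsqrt z)" using Ln_inverse[OF add_xsqrt_notin[of z]] by (simp only:)
  ultimately show ?thesis using assms by (simp add: xibar_eq xibar_closed_def diff_divide_distrib add_divide_distrib)
qed

text \<open>\<open>Q\<close> is kept since 1 + z^2 is even; \<xi> and \<sigma> change sign together,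
  so the monotonicity condition is preserved.\<close>

lemma admissible_to_uminus:
  assumes "admissible_to \<sigma> z \<gamma> Q X"
  shows "admissible_to (- \<sigma>) (- z) (\<lambda>t. - \<gamma> t) Q (\<lambda>t. - X t)"
proof -
  have a: "R2_chain \<gamma>" "\<gamma> 0 = z" "\<And>t. t \<ge> 0 \<Longrightarrow> \<gamma> t \<noteq> \<i> \<and> \<gamma> t \<noteq> -\<i>"
    "filterlim (\<lambda>t. \<sigma> * Re (\<gamma> t)) at_top at_top"
    "continuous_on {0..} Q" "\<And>t. t \<ge> 0 \<Longrightarrow> Q t ^ 4 = 1 + (\<gamma> t)^2"
    "\<forall>\<^sub>F t in at_top. Q t = (1 + (\<gamma> t)^2) powr (1/4)"
    "\<And>t. t \<ge> 0 \<Longrightarrow> ((\<lambda>s. (Q s)^2 * vector_derivative \<gamma> (at s)) has_integral (X t - X 0)) {0..t}"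
    "\<forall>\<^sub>F t in at_top. X t = xibar (\<gamma> t)"
    "mono_on {0..} (\<lambda>t. \<sigma> * Re (X t))"
    "(\<lambda>t. vector_derivative (beta_along \<gamma> Q) (at t)) absolutely_integrable_on {0..}"
    using assms by (simp_all add: admissible_to_def continued_along_def)
  obtain T where T: "finite T"
    "\<And>t. t \<ge> 0 \<Longrightarrow> t \<notin> T \<Longrightarrow> (\<gamma> has_vector_derivative vector_derivative \<gamma> (at t)) (at t)"
    "\<And>t. t \<ge> 0 \<Longrightarrow> t \<notin> T \<Longrightarrow>
      (beta_along \<gamma> Q has_vector_derivative vector_derivative (beta_along \<gamma> Q) (at t)) (at t)"
    using admissible_regular[OF assms] by blast
  have X: "((\<lambda>s. (Q s)^2 * vector_derivative (\<lambda>t. - \<gamma> t) (at s)) has_integral (- X t - - X 0)) {0..t}" if "t \<ge> 0" for t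
  proof (rule has_integral_spike_finite[OF T(1)])
    show "((\<lambda>s. - ((Q s)^2 * vector_derivative \<gamma> (at s))) has_integral (- X t - - X 0)) {0..t}"
      using has_integral_neg[OF a(8)[OF that]] by simp
  qed (use T(2) in \<open>auto simp: vector_derivative_uminus\<close>)
  have ev: "\<forall>\<^sub>F t in at_top. - X t = xibar (- \<gamma> t)"
  proof -
    have "\<forall>\<^sub>F t in at_top. \<sigma> * Re (\<gamma> t) > 0" using a(4) by (simp add: filterlim_at_top_dense)
    thus ?thesis using a(9)
    proof eventually_elim
      case (elim t)
      hence "\<gamma> t \<in> cut_plane" by (auto simp: cut_plane_iff)
      thus ?case using elim xibar_uminus by simp
    qed
  qed
  have ne: "\<forall>t\<ge>0. - \<gamma> t \<noteq> \<i> \<and> - \<gamma> t \<noteq> - \<i>"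
    using a(3) by (metis minus_minus)
  have "(\<lambda>t. - vector_derivative (beta_along \<gamma> Q) (at t)) absolutely_integrable_on {0..}"
    using absolutely_integrable_scaleR_left[OF a(11), of "-1"] by simp
  hence "(\<lambda>t. vector_derivative (\<lambda>t. - beta_along \<gamma> Q t) (at t)) absolutely_integrable_on {0..}"
    by (rule absolutely_integrable_spike[OF _ negligible_finite[OF T(1)]])
       (use T(3) vector_derivative_uminus in auto)
  thus ?thesis
    unfolding admissible_to_def continued_along_def beta_along_uminus
    using R2_chain_uminus[OF a(1)] a(2) ne a(4-7) X ev a(10) by simp
qed

lemma abs_path_integral_uminus:
  assumes T: "finite T" "\<And>t. t \<ge> 0 \<Longrightarrow> t \<notin> T \<Longrightarrow> (B has_vector_derivative vector_derivative B (at t)) (at t)"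
    and g: "\<And>p. norm (g (- p)) = norm (g p)"
  shows "abs_path_integral (\<lambda>t. - B t) g = abs_path_integral B g"
  unfolding abs_path_integral_def
  by (rule integral_spike[OF negligible_finite[OF T(1)]])
     (use T(2) in \<open>simp add: vector_derivative_uminus norm_mult g\<close>)

text \<open>By parity each integrand acquires only a sign under \<beta> -> -\<beta>. All terms of an
  inner sum acquire the same sign, because the indices k and s + n - k - 1 have a constant
  sum.\<close>

lemma error_bound_uminus:
  assumes "finite T" "\<And>t. t \<ge> 0 \<Longrightarrow> t \<notin> T \<Longrightarrow> (B has_vector_derivative vector_derivative B (at t)) (at t)"
  shows "error_bound n u (\<lambda>t. - B t) = error_bound n u B"
proof -
  have 1: "abs_path_integral (\<lambda>t. - B t) (deriv (Ebar s)) = abs_path_integral B (deriv (Ebar s))" for s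
    by (rule abs_path_integral_uminus[OF assms]) (auto simp: deriv_Ebar_parity norm_mult norm_power)
  have 2: "abs_path_integral (\<lambda>t. - B t) (\<lambda>p. \<Sum>k\<in>{s..<n}. (1 - p^2)^2 * deriv (Ebar k) p * deriv (Ebar (s + n - k - 1)) p)
    = abs_path_integral B (\<lambda>p. \<Sum>k\<in>{s..<n}. (1 - p^2)^2 * deriv (Ebar k) p * deriv (Ebar (s + n - k - 1)) p)" for s
  proof (rule abs_path_integral_uminus[OF assms])
    fix p :: complex
    have "(1 - (- p)^2)^2 * deriv (Ebar k) (- p) * deriv (Ebar (s + n - k - 1)) (- p) =
      (-1) ^ (s + n - 1) * ((1 - p^2)^2 * deriv (Ebar k) p * deriv (Ebar (s + n - k - 1)) p)" if k: "k \<in> {s..<n}" for k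
    proof -
      have "k + (s + n - k - 1) = s + n - 1" using k by auto
      hence "(-1 :: complex) ^ k * (-1) ^ (s + n - k - 1) = (-1) ^ (s + n - 1)" by (simp only: flip: power_add)
      thus ?thesis unfolding deriv_Ebar_parity by (simp add: mult_ac)
    qed
    hence "(\<Sum>k\<in>{s..<n}. (1 - (- p)^2)^2 * deriv (Ebar k) (- p) * deriv (Ebar (s + n - k - 1)) (- p)) =
      (-1) ^ (s + n - 1) * (\<Sum>k\<in>{s..<n}. (1 - p^2)^2 * deriv (Ebar k) p * deriv (Ebar (s + n - k - 1)) p)"
      unfolding sum_distrib_left by (rule sum.cong[OF refl])
    thus "norm (\<Sum>k\<in>{s..<n}. (1 - (- p)^2)^2 * deriv (Ebar k) (- p) * deriv (Ebar (s + n - k - 1)) (- p)) =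
      norm (\<Sum>k\<in>{s..<n}. (1 - p^2)^2 * deriv (Ebar k) p * deriv (Ebar (s + n - k - 1)) p)"
      by (simp only: norm_mult norm_power norm_minus_cancel norm_one power_one mult_1)
  qed
  show ?thesis unfolding error_bound_def omega_def varpi_def 1 2 by (rule refl)
qed

section \<open>Assembly of the two directions\<close>

lemma admissible_iff: "(\<exists>\<gamma> Q X. admissible_to 1 z \<gamma> Q X) \<longleftrightarrow> z \<notin> left_level_curves"
  using not_admissible_on_left_level_curves liftable_off_left_level_curves liftable_imp_admissible
  by metis

lemma admissible_left_iff: "(\<exists>\<gamma> Q X. admissible_to (-1) z \<gamma> Q X) \<longleftrightarrow> - z \<notin> left_level_curves"
  unfolding admissible_iff [symmetric]
  using admissible_to_uminus[of "-1" z] admissible_to_uminus[of 1 "- z"] unfolding minus_minus by blast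

text \<open>The exceptional set for paths to the left arises as the image under z -> -z, whereas the
  theorem reflects in the imaginary axis, z -> -cnj z; symmetry under conjugation reconciles the
  two.\<close>

lemma cnj_in_left_level_curves:
  assumes "z \<in> left_level_curves"
  shows "cnj z \<in> left_level_curves"
proof -
  have "Re (xibar (cnj z)) = Re (xibar z)" if "Re z < 0"
  proof -
    have c: "z \<in> cut_plane" "cnj z \<in> cut_plane" using that by (auto simp: cut_plane_iff)
    have "1 + (cnj z)^2 = cnj (xsqrt z) ^ 2" using arg_cong[OF xsqrt_square[of z], of cnj] by simp
    hence "xsqrt (cnj z) = cnj (xsqrt z)"
      using Re_xsqrt_pos[OF c(1)] unfolding xsqrt_def[of "cnj z"] by (simp only:) (intro csqrt_square, simp)
    hence "cnj z + xsqrt (cnj z) = cnj (z + xsqrt z)" by simp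
    moreover have "Re_xi (cnj v) = Re_xi v" for v
    proof -
      have "(cnj v)^2 - 1 / (cnj v)^2 = cnj (v^2 - 1 / v^2)" by simp
      thus ?thesis unfolding Re_xi_def by (simp only: cnj.simps(1) complex_mod_cnj)
    qed
    ultimately show ?thesis unfolding Re_xibar_eq[OF c(1)] Re_xibar_eq[OF c(2)] by (simp only:)
  qed
  thus ?thesis using assms by (auto simp: left_level_curves_eq)
qed

theorem mainTheorem3:
  fixes u :: real and n :: nat
  assumes "u > 0" and "n \<ge> 1"
  shows "(\<forall>z \<gamma> Q X. admissible_to 1 z \<gamma> Q X \<longrightarrow>
      (\<exists>\<eta>. pcfU (of_real (u / 2)) (of_real (sqrt (2 * u)) * z) =
            of_real ((2 * exp 1 / u) powr (u / 4)) * (1 / (of_real ((2 * u) powr (1/4)) * Q 0)) *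
            exp (- of_real u * X 0 +
                 (\<Sum>s\<in>{1..<n}. (-1)^s * (Ebar s (beta_along \<gamma> Q 0) - Ebar s 1) / of_real u ^ s)) *
            (1 + \<eta>) \<and>
          norm \<eta> \<le> error_bound n u (beta_along \<gamma> Q))) \<and>
    (\<forall>z \<gamma> Q X. admissible_to (-1) z \<gamma> Q X \<longrightarrow>
      (\<exists>\<eta>. pcfU (of_real (u / 2)) (- of_real (sqrt (2 * u)) * z) =
            of_real ((2 * exp 1 / u) powr (u / 4)) * (1 / (of_real ((2 * u) powr (1/4)) * Q 0)) *
            exp (of_real u * X 0 +
                 (\<Sum>s\<in>{1..<n}. (Ebar s (beta_along \<gamma> Q 0) - Ebar s (-1)) / of_real u ^ s)) *
            (1 + \<eta>) \<and>
          norm \<eta> \<le> error_bound n u (beta_along \<gamma> Q))) \<and>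
    {z. \<exists>\<gamma> Q X. admissible_to 1 z \<gamma> Q X} = - left_level_curves \<and>
    {z. \<exists>\<gamma> Q X. admissible_to (-1) z \<gamma> Q X} = - ((\<lambda>z. - cnj z) ` left_level_curves)"
proof (intro conjI allI impI)
  fix z \<gamma> Q X assume "admissible_to 1 z \<gamma> Q X"
  then interpret admissible_right z \<gamma> Q X by unfold_locales
  show "\<exists>\<eta>. pcfU (of_real (u / 2)) (of_real (sqrt (2 * u)) * z) =
            of_real ((2 * exp 1 / u) powr (u / 4)) * (1 / (of_real ((2 * u) powr (1/4)) * Q 0)) *
            exp (- of_real u * X 0 +
                 (\<Sum>s\<in>{1..<n}. (-1)^s * (Ebar s (beta_along \<gamma> Q 0) - Ebar s 1) / of_real u ^ s)) *
            (1 + \<eta>) \<and>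
          norm \<eta> \<le> error_bound n u (beta_along \<gamma> Q)"
    by (rule pcfU_representation[OF assms])
next
  fix z \<gamma> Q X assume left: "admissible_to (-1) z \<gamma> Q X"
  interpret admissible_right "- z" "\<lambda>t. - \<gamma> t" Q "\<lambda>t. - X t"
    by unfold_locales (use admissible_to_uminus[OF left] in simp)
  \<comment> \<open>Parity turns the alternating sum of the reflected path, normalised at \<beta> =
    1, into the sum normalised at \<beta> = -1.\<close>
  have E: "(-1)^s * (Ebar s (- b) - Ebar s 1) = Ebar s b - Ebar s (-1)" for s b
    unfolding Ebar_parity by (simp add: right_diff_distrib flip: mult.assoc power_mult_distrib)
  have err: "error_bound n u (\<lambda>t. - beta_along \<gamma> Q t) = error_bound n u (beta_along \<gamma> Q)"
    by (rule admissible_regular[OF left]) (rule error_bound_uminus)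
  have arg: "of_real (sqrt (2 * u)) * - z = - of_real (sqrt (2 * u)) * z" "- of_real u * - X 0 = of_real u * X 0"
    by simp_all
  show "\<exists>\<eta>. pcfU (of_real (u / 2)) (- of_real (sqrt (2 * u)) * z) =
            of_real ((2 * exp 1 / u) powr (u / 4)) * (1 / (of_real ((2 * u) powr (1/4)) * Q 0)) *
            exp (of_real u * X 0 +
                 (\<Sum>s\<in>{1..<n}. (Ebar s (beta_along \<gamma> Q 0) - Ebar s (-1)) / of_real u ^ s)) *
            (1 + \<eta>) \<and>
          norm \<eta> \<le> error_bound n u (beta_along \<gamma> Q)"
    using pcfU_representation[OF assms] unfolding beta_along_uminus E err arg .
next
  show "{z. \<exists>\<gamma> Q X. admissible_to 1 z \<gamma> Q X} = - left_level_curves"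
    unfolding admissible_iff by blast
  have "- z \<in> left_level_curves \<longleftrightarrow> z \<in> (\<lambda>z. - cnj z) ` left_level_curves" for z
  proof
    assume "- z \<in> left_level_curves"
    from cnj_in_left_level_curves[OF this] show "z \<in> (\<lambda>z. - cnj z) ` left_level_curves"
      by (rule rev_image_eqI) simp
  qed (use cnj_in_left_level_curves in auto)
  thus "{z. \<exists>\<gamma> Q X. admissible_to (-1) z \<gamma> Q X} = - ((\<lambda>z. - cnj z) ` left_level_curves)"
    unfolding admissible_left_iff by blast
qed

end
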